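(* Let $\mathcal{C}$ be compactly generated with a generating set $\mathcal{G}$, and suppose that $\bar\pi_{Y,X}\colon f_!(f^*Y\otimes X)\to Y\otimes f_!X$ is an isomorphism for all $Y\in\mathcal{D}$ and all $X\in\mathcal{G}$. Then $\bar\pi_{Y,X}$ is an isomorphism for all $Y\in\mathcal{D}$ and all $X\in\mathcal{C}$; in particular the natural map $\omega_X\colon f_*X\to f_!(X\otimes C)$ is defined. Suppose moreover that $\omega_X$ is an isomorphism for all $X\in\mathcal{G}$. Then: (1) if the objects of $\mathcal{G}$ are dualizable, then $\omega_X$ is an isomorphism for all dualizable $X\in\mathcal{C}$; (2) if $\mathcal{D}$ is compactly generated with a generating set $\mathcal{H}$ such that $f^*Y$ is compact for all $Y\in\mathcal{H}$, then $\omega_X$ is an isomorphism for all $X\in\mathcal{C}$.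
   Context: $\mathcal{C}$ and $\mathcal{D}$ are closed symmetric monoidal categories with unit objects $S$ and $T$ respectively; $\otimes$ and $\mathrm{Hom}$ denote product and internal hom in either category, and $DX=\mathrm{Hom}(X,S)$ (resp. $\mathrm{Hom}(X,T)$ in $\mathcal D$). Both carry compatible triangulations: $\otimes$ is exact in each variable, and $\mathrm{Hom}$ is exact in each variable (contravariantly, up to the usual sign, in the first), where exact means additive, commuting up to natural isomorphism with the suspension $\Sigma$, and preserving distinguished triangles. $f^*\colon\mathcal{D}\to\mathcal{C}$ is a strong symmetric monoidal exact functor, so there are coherent isomorphisms $f^*T\cong S$ and $f^*(Y\otimes Z)\cong f^*Y\otimes f^*Z$; the suspension isomorphisms are compatible with these. $f^*$ has a right adjoint $f_*$, with unit $\eta\colon Y\to f_*f^*Y$ and counit $\varepsilon\colon f^*f_*X\to X$, and a left adjoint $f_!\colon\mathcal{C}\to\mathcal{D}$, with unit $\zeta\colon X\to f^*f_!X$ and counit $\sigma\colon f_!f^*Y\to Y$. The maps $\bar\pi$ and $\omega$ below commute with $\Sigma$. The natural map $\bar\pi_{Y,X}$ is the composite $f_!(f^*Y\otimes X)\to f_!f^*Y\otimes f_!X\xrightarrow{\sigma\otimes\mathrm{id}}Y\otimes f_!X$, where the first arrow is an instance of the map $f_!(W\otimes X)\to f_!W\otimes f_!X$ adjoint to $W\otimes X\xrightarrow{\zeta\otimes\zeta}f^*f_!W\otimes f^*f_!X\cong f^*(f_!W\otimes f_!X)$. Fixed throughout is an object $C\in\mathcal{C}$ together with an isomorphism $f_*S\cong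 f_!C$. Let $\tau\colon T\to f_*S\cong f_!C$, where $T\to f_*S$ is adjoint to $f^*T\cong S$. Write $f_\sharp X=f_!(X\otimes C)$. When $\bar\pi_{Y,C}$ is an isomorphism for all $Y$, define $\tau_Y\colon Y\cong Y\otimes T\xrightarrow{\mathrm{id}\otimes\tau}Y\otimes f_!C\xrightarrow{\bar\pi^{-1}}f_!(f^*Y\otimes C)=f_\sharp f^*Y$, and let $\omega_X$ be the composite $f_*X\xrightarrow{\tau_{f_*X}}f_\sharp f^*f_*X\xrightarrow{f_\sharp\varepsilon}f_\sharp X$. An object $X$ is dualizable if the canonical map $\nu\colon DX\otimes X\to\mathrm{Hom}(X,X)$ (adjoint to $DX\otimes X\otimes X\to X$ given by evaluating $DX$ on the last factor, after a symmetry) is an isomorphism. An object $X$ of an additive category $\mathcal{A}$ is compact if $\mathcal{A}(X,-)$ converts coproducts to direct sums. $\mathcal{A}$ is compactly generated with generating set $\mathcal{G}$ if it has arbitrary coproducts and $\mathcal{G}$ is a set of compact objects that detects isomorphisms: a map $g$ in $\mathcal{A}$ is an isomorphism if and only if $\mathcal{A}(X,g)$ is an isomorphism for all $X\in\mathcal{G}$. When $\mathcal{A}$ is symmetric monoidal, its unit object is also required to be compact. *)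

theory Defs
  imports "HOL-Algebra.Free_Abelian_Groups"
begin

section \<open>Categories, functors, natural transformations\<close>

text \<open>
  The objects of a category are all elements of the type of objects, its arrows all elements of
  the type of arrows; only the composite of composable arrows is meaningful.
\<close>

record ('o, 'm) cat =
  Dom :: "'m \<Rightarrow> 'o"
  Cod :: "'m \<Rightarrow> 'o"
  Idt :: "'o \<Rightarrow> 'm"
  Cmp :: "'m \<Rightarrow> 'm \<Rightarrow> 'm"  (infixl \<open>\<cdot>\<index>\<close> 75)

definition Mor :: "('o, 'm, 'z) cat_scheme \<Rightarrow> 'o \<Rightarrow> 'o \<Rightarrow> 'm set" where
  "Mor C X Y = {f. Dom C f = X \<and> Cod C f = Y}"

locale category =
  fixes C :: "('o, 'm, 'z) cat_scheme" (structure)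
  assumes ident_in: "Idt C X \<in> Mor C X X"
    and comp_in: "f \<in> Mor C X Y \<Longrightarrow> g \<in> Mor C Y Z \<Longrightarrow> g \<cdot> f \<in> Mor C X Z"
    and comp_ident_right: "f \<in> Mor C X Y \<Longrightarrow> f \<cdot> Idt C X = f"
    and comp_ident_left: "f \<in> Mor C X Y \<Longrightarrow> Idt C Y \<cdot> f = f"
    and comp_assoc: "f \<in> Mor C X Y \<Longrightarrow> g \<in> Mor C Y Z \<Longrightarrow> h \<in> Mor C Z W
      \<Longrightarrow> h \<cdot> g \<cdot> f = h \<cdot> (g \<cdot> f)"

definition inverse_arrows :: "('o, 'm, 'z) cat_scheme \<Rightarrow> 'm \<Rightarrow> 'm \<Rightarrow> bool" where
  "inverse_arrows C f g \<longleftrightarrow> g \<in> Mor C (Cod C f) (Dom C f)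
     \<and> g \<cdot>\<^bsub>C\<^esub> f = Idt C (Dom C f) \<and> f \<cdot>\<^bsub>C\<^esub> g = Idt C (Cod C f)"

definition isom :: "('o, 'm, 'z) cat_scheme \<Rightarrow> 'm \<Rightarrow> bool" where
  "isom C f \<longleftrightarrow> (\<exists>g. inverse_arrows C f g)"

definition inverse_arrow :: "('o, 'm, 'z) cat_scheme \<Rightarrow> 'm \<Rightarrow> 'm" where
  "inverse_arrow C f = (THE g. inverse_arrows C f g)"

record ('o, 'm, 'p, 'n) fctr =
  Fo :: "'o \<Rightarrow> 'p"
  Fa :: "'m \<Rightarrow> 'n"

definition functor_id :: "('o, 'm, 'o, 'm) fctr" where
  "functor_id = \<lparr>Fo = (\<lambda>X. X), Fa = (\<lambda>f. f)\<rparr>"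

definition functor_comp :: "('p, 'n, 'q, 'r) fctr \<Rightarrow> ('o, 'm, 'p, 'n) fctr \<Rightarrow> ('o, 'm, 'q, 'r) fctr"
    (infixl \<open>\<circ>\<^sub>F\<close> 75) where
  "G \<circ>\<^sub>F F = \<lparr>Fo = (\<lambda>X. Fo G (Fo F X)), Fa = (\<lambda>f. Fa G (Fa F f))\<rparr>"

definition is_functor ::
  "('o, 'm, 'y) cat_scheme \<Rightarrow> ('p, 'n, 'z) cat_scheme \<Rightarrow> ('o, 'm, 'p, 'n) fctr \<Rightarrow> bool" where
  "is_functor A B F \<longleftrightarrow>
     (\<forall>X Y f. f \<in> Mor A X Y \<longrightarrow> Fa F f \<in> Mor B (Fo F X) (Fo F Y))
   \<and> (\<forall>X. Fa F (Idt A X) = Idt B (Fo F X))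
   \<and> (\<forall>X Y Z f g. f \<in> Mor A X Y \<longrightarrow> g \<in> Mor A Y Z
        \<longrightarrow> Fa F (g \<cdot>\<^bsub>A\<^esub> f) = Fa F g \<cdot>\<^bsub>B\<^esub> Fa F f)"

definition natural ::
  "('o, 'm, 'y) cat_scheme \<Rightarrow> ('p, 'n, 'z) cat_scheme
     \<Rightarrow> ('o, 'm, 'p, 'n) fctr \<Rightarrow> ('o, 'm, 'p, 'n) fctr \<Rightarrow> ('o \<Rightarrow> 'n) \<Rightarrow> bool" where
  "natural A B F G t \<longleftrightarrow>
     (\<forall>X. t X \<in> Mor B (Fo F X) (Fo G X))
   \<and> (\<forall>X Y f. f \<in> Mor A X Y \<longrightarrow> t Y \<cdot>\<^bsub>B\<^esub> Fa F f = Fa G f \<cdot>\<^bsub>B\<^esub> t X)"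

definition adjunction ::
  "('o, 'm, 'y) cat_scheme \<Rightarrow> ('p, 'n, 'z) cat_scheme
     \<Rightarrow> ('o, 'm, 'p, 'n) fctr \<Rightarrow> ('p, 'n, 'o, 'm) fctr \<Rightarrow> ('o \<Rightarrow> 'm) \<Rightarrow> ('p \<Rightarrow> 'n) \<Rightarrow> bool" where
  "adjunction A B L R unit counit \<longleftrightarrow>
     is_functor A B L \<and> is_functor B A R
   \<and> natural A A functor_id (R \<circ>\<^sub>F L) unit
   \<and> natural B B (L \<circ>\<^sub>F R) functor_id counit
   \<and> (\<forall>X. counit (Fo L X) \<cdot>\<^bsub>B\<^esub> Fa L (unit X) = Idt B (Fo L X))
   \<and> (\<forall>Y. Fa R (counit Y) \<cdot>\<^bsub>A\<^esub> unit (Fo R Y) = Idt A (Fo R Y))"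

section \<open>Additive categories\<close>

record ('o, 'm) acat = "('o, 'm) cat" +
  Add :: "'m \<Rightarrow> 'm \<Rightarrow> 'm"  (infixl \<open>\<^bold>+\<index>\<close> 65)
  Zer :: "'o \<Rightarrow> 'o \<Rightarrow> 'm"

definition homgrp :: "('o, 'm, 'z) acat_scheme \<Rightarrow> 'o \<Rightarrow> 'o \<Rightarrow> 'm monoid" where
  "homgrp C X Y = \<lparr>carrier = Mor C X Y, monoid.mult = Add C, one = Zer C X Y\<rparr>"

definition Neg :: "('o, 'm, 'z) acat_scheme \<Rightarrow> 'm \<Rightarrow> 'm" where
  "Neg C f = inv\<^bsub>homgrp C (Dom C f) (Cod C f)\<^esub> f"

definition zero_object :: "('o, 'm, 'z) cat_scheme \<Rightarrow> 'o \<Rightarrow> bool" where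
  "zero_object C Z \<longleftrightarrow> (\<forall>X. (\<exists>!f. f \<in> Mor C Z X) \<and> (\<exists>!f. f \<in> Mor C X Z))"

locale additive_category = category C
  for C :: "('o, 'm, 'z) acat_scheme" (structure) +
  assumes hom_comm_group: "comm_group (homgrp C X Y)"
    and add_comp: "f \<in> Mor C X Y \<Longrightarrow> g \<in> Mor C Y Z \<Longrightarrow> g' \<in> Mor C Y Z
      \<Longrightarrow> (g \<^bold>+ g') \<cdot> f = g \<cdot> f \<^bold>+ g' \<cdot> f"
    and comp_add: "f \<in> Mor C X Y \<Longrightarrow> f' \<in> Mor C X Y \<Longrightarrow> g \<in> Mor C Y Z
      \<Longrightarrow> g \<cdot> (f \<^bold>+ f') = g \<cdot> f \<^bold>+ g \<cdot> f'"
    and zero_object_exists: "\<exists>Z. zero_object C Z"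
    and biproduct_exists: "\<exists>P i j p q. i \<in> Mor C X P \<and> j \<in> Mor C Y P \<and> p \<in> Mor C P X \<and> q \<in> Mor C P Y
      \<and> p \<cdot> i = Idt C X \<and> q \<cdot> j = Idt C Y \<and> q \<cdot> i = Zer C X Y \<and> p \<cdot> j = Zer C Y X
      \<and> i \<cdot> p \<^bold>+ j \<cdot> q = Idt C P"

definition additive_functor ::
  "('o, 'm, 'y) acat_scheme \<Rightarrow> ('p, 'n, 'z) acat_scheme \<Rightarrow> ('o, 'm, 'p, 'n) fctr \<Rightarrow> bool" where
  "additive_functor A B F \<longleftrightarrow> is_functor A B F
   \<and> (\<forall>X Y. \<forall>f\<in>Mor A X Y. \<forall>g\<in>Mor A X Y. Fa F (f \<^bold>+\<^bsub>A\<^esub> g) = Fa F f \<^bold>+\<^bsub>B\<^esub> Fa F g)"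

section \<open>Triangulated categories\<close>

record ('o, 'm) tcat = "('o, 'm) acat" +
  Sus :: "('o, 'm, 'o, 'm) fctr"
  Tri :: "('m \<times> 'm \<times> 'm) set"

abbreviation So :: "('o, 'm, 'z) tcat_scheme \<Rightarrow> 'o \<Rightarrow> 'o" where
  "So C X \<equiv> Fo (Sus C) X"

abbreviation Sa :: "('o, 'm, 'z) tcat_scheme \<Rightarrow> 'm \<Rightarrow> 'm" where
  "Sa C f \<equiv> Fa (Sus C) f"

definition triangle :: "('o, 'm, 'z) tcat_scheme \<Rightarrow> 'o \<Rightarrow> 'o \<Rightarrow> 'o \<Rightarrow> 'm \<Rightarrow> 'm \<Rightarrow> 'm \<Rightarrow> bool" where
  "triangle C X Y Z f g h \<longleftrightarrow> f \<in> Mor C X Y \<and> g \<in> Mor C Y Z \<and> h \<in> Mor C Z (So C X)"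

text \<open>
  \<open>\<Sigma>\<close> is an additive self-equivalence (fully faithful and essentially surjective), not
  necessarily an automorphism.  In \<open>octahedral\<close> the three given triangles are those on
  \<open>f\<close>, \<open>g\<close> and \<open>g f\<close>.
\<close>

locale triangulated_category = additive_category C
  for C :: "('o, 'm, 'z) tcat_scheme" (structure) +
  assumes sus_additive: "additive_functor C C (Sus C)"
    and sus_fully_faithful: "bij_betw (Sa C) (Mor C X Y) (Mor C (So C X) (So C Y))"
    and sus_ess_surj: "\<exists>X f. f \<in> Mor C (So C X) Y \<and> isom C f"
    and tri_triangle: "(f, g, h) \<in> Tri C \<Longrightarrow> \<exists>X Y Z. triangle C X Y Z f g h"
    and tri_ident: "zero_object C Z \<Longrightarrow> (Idt C X, Zer C X Z, Zer C Z (So C X)) \<in> Tri C"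
    and tri_exists: "\<exists>g h. (f, g, h) \<in> Tri C"
    and tri_isom: "(f, g, h) \<in> Tri C \<Longrightarrow> triangle C X Y Z f g h \<Longrightarrow> triangle C X' Y' Z' f' g' h'
      \<Longrightarrow> a \<in> Mor C X X' \<Longrightarrow> b \<in> Mor C Y Y' \<Longrightarrow> c \<in> Mor C Z Z'
      \<Longrightarrow> isom C a \<Longrightarrow> isom C b \<Longrightarrow> isom C c
      \<Longrightarrow> b \<cdot> f = f' \<cdot> a \<Longrightarrow> c \<cdot> g = g' \<cdot> b \<Longrightarrow> Sa C a \<cdot> h = h' \<cdot> c
      \<Longrightarrow> (f', g', h') \<in> Tri C"
    and tri_rotate: "triangle C X Y Z f g h
      \<Longrightarrow> (f, g, h) \<in> Tri C \<longleftrightarrow> (g, h, Neg C (Sa C f)) \<in> Tri C"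
    and tri_morphism: "(f, g, h) \<in> Tri C \<Longrightarrow> triangle C X Y Z f g h
      \<Longrightarrow> (f', g', h') \<in> Tri C \<Longrightarrow> triangle C X' Y' Z' f' g' h'
      \<Longrightarrow> a \<in> Mor C X X' \<Longrightarrow> b \<in> Mor C Y Y' \<Longrightarrow> b \<cdot> f = f' \<cdot> a
      \<Longrightarrow> \<exists>c\<in>Mor C Z Z'. c \<cdot> g = g' \<cdot> b \<and> Sa C a \<cdot> h = h' \<cdot> c"
    and octahedral: "f \<in> Mor C X Y \<Longrightarrow> g \<in> Mor C Y Z
      \<Longrightarrow> (f, f1, f2) \<in> Tri C \<Longrightarrow> triangle C X Y P f f1 f2
      \<Longrightarrow> (g, g1, g2) \<in> Tri C \<Longrightarrow> triangle C Y Z R g g1 g2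
      \<Longrightarrow> (g \<cdot> f, k1, k2) \<in> Tri C \<Longrightarrow> triangle C X Z Q (g \<cdot> f) k1 k2
      \<Longrightarrow> \<exists>u\<in>Mor C P Q. \<exists>v\<in>Mor C Q R. (u, v, Sa C f1 \<cdot> g2) \<in> Tri C
            \<and> u \<cdot> f1 = k1 \<cdot> g \<and> k2 \<cdot> u = f2 \<and> v \<cdot> k1 = g1 \<and> g2 \<cdot> v = Sa C f \<cdot> k2"

text \<open>An exact functor comes with its suspension isomorphism \<open>F \<Sigma> \<cong> \<Sigma> F\<close>.\<close>

definition exact_functor ::
  "('o, 'm, 'y) tcat_scheme \<Rightarrow> ('p, 'n, 'z) tcat_scheme
     \<Rightarrow> ('o, 'm, 'p, 'n) fctr \<Rightarrow> ('o \<Rightarrow> 'n) \<Rightarrow> bool" where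
  "exact_functor A B F s \<longleftrightarrow> additive_functor A B F
   \<and> natural A B (F \<circ>\<^sub>F Sus A) (Sus B \<circ>\<^sub>F F) s \<and> (\<forall>X. isom B (s X))
   \<and> (\<forall>f g h. (f, g, h) \<in> Tri A
        \<longrightarrow> (Fa F f, Fa F g, s (Dom A f) \<cdot>\<^bsub>B\<^esub> Fa F h) \<in> Tri B)"

section \<open>Closed symmetric monoidal categories with compatible triangulation\<close>

record ('o, 'm) ttcat = "('o, 'm) tcat" +
  Tenso :: "'o \<Rightarrow> 'o \<Rightarrow> 'o"  (infixl \<open>\<otimes>\<^sub>o\<index>\<close> 80)
  Tensa :: "'m \<Rightarrow> 'm \<Rightarrow> 'm"  (infixl \<open>\<otimes>\<^sub>a\<index>\<close> 80)
  Unit :: "'o"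
  Assoc :: "'o \<Rightarrow> 'o \<Rightarrow> 'o \<Rightarrow> 'm"  \<comment> \<open>\<open>(X \<otimes> Y) \<otimes> Z \<rightarrow> X \<otimes> (Y \<otimes> Z)\<close>\<close>
  Lunit :: "'o \<Rightarrow> 'm"  \<comment> \<open>\<open>S \<otimes> X \<rightarrow> X\<close>\<close>
  Runit :: "'o \<Rightarrow> 'm"  \<comment> \<open>\<open>X \<otimes> S \<rightarrow> X\<close>\<close>
  Symm :: "'o \<Rightarrow> 'o \<Rightarrow> 'm"  \<comment> \<open>\<open>X \<otimes> Y \<rightarrow> Y \<otimes> X\<close>\<close>
  Ihom :: "'o \<Rightarrow> 'o \<Rightarrow> 'o"
  Eval :: "'o \<Rightarrow> 'o \<Rightarrow> 'm"  \<comment> \<open>\<open>Hom(X, Y) \<otimes> X \<rightarrow> Y\<close>\<close>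
  SusL :: "'o \<Rightarrow> 'o \<Rightarrow> 'm"  \<comment> \<open>\<open>\<Sigma>X \<otimes> Y \<rightarrow> \<Sigma>(X \<otimes> Y)\<close>\<close>
  SusR :: "'o \<Rightarrow> 'o \<Rightarrow> 'm"  \<comment> \<open>\<open>X \<otimes> \<Sigma>Y \<rightarrow> \<Sigma>(X \<otimes> Y)\<close>\<close>

definition curry_arrow :: "('o, 'm, 'z) ttcat_scheme \<Rightarrow> 'o \<Rightarrow> 'o \<Rightarrow> 'o \<Rightarrow> 'm \<Rightarrow> 'm" where
  "curry_arrow C Z X Y g =
     (THE h. h \<in> Mor C Z (Ihom C X Y) \<and> Eval C X Y \<cdot>\<^bsub>C\<^esub> (h \<otimes>\<^sub>a\<^bsub>C\<^esub> Idt C X) = g)"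

text \<open>\<open>Hom(f, g) : Hom(X, Y) \<rightarrow> Hom(X', Y')\<close> for \<open>f : X' \<rightarrow> X\<close> and \<open>g : Y \<rightarrow> Y'\<close>.\<close>

definition Ihom_arrow :: "('o, 'm, 'z) ttcat_scheme \<Rightarrow> 'm \<Rightarrow> 'm \<Rightarrow> 'm" where
  "Ihom_arrow C f g =
     (let X' = Dom C f; X = Cod C f; Y = Dom C g; Y' = Cod C g in
      curry_arrow C (Ihom C X Y) X' Y'
        (g \<cdot>\<^bsub>C\<^esub> Eval C X Y \<cdot>\<^bsub>C\<^esub> (Idt C (Ihom C X Y) \<otimes>\<^sub>a\<^bsub>C\<^esub> f)))"

definition tensor_left :: "('o, 'm, 'z) ttcat_scheme \<Rightarrow> 'o \<Rightarrow> ('o, 'm, 'o, 'm) fctr" where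
  "tensor_left C X = \<lparr>Fo = (\<lambda>Y. X \<otimes>\<^sub>o\<^bsub>C\<^esub> Y), Fa = (\<lambda>f. Idt C X \<otimes>\<^sub>a\<^bsub>C\<^esub> f)\<rparr>"

definition tensor_right :: "('o, 'm, 'z) ttcat_scheme \<Rightarrow> 'o \<Rightarrow> ('o, 'm, 'o, 'm) fctr" where
  "tensor_right C Y = \<lparr>Fo = (\<lambda>X. X \<otimes>\<^sub>o\<^bsub>C\<^esub> Y), Fa = (\<lambda>f. f \<otimes>\<^sub>a\<^bsub>C\<^esub> Idt C Y)\<rparr>"

definition ihom_from :: "('o, 'm, 'z) ttcat_scheme \<Rightarrow> 'o \<Rightarrow> ('o, 'm, 'o, 'm) fctr" where
  "ihom_from C X = \<lparr>Fo = (\<lambda>Y. Ihom C X Y), Fa = (\<lambda>g. Ihom_arrow C (Idt C X) g)\<rparr>"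

locale closed_symmetric_monoidal_category = category C
  for C :: "('o, 'm, 'z) ttcat_scheme" (structure) +
  assumes tensor_in: "f \<in> Mor C X X' \<Longrightarrow> g \<in> Mor C Y Y'
      \<Longrightarrow> f \<otimes>\<^sub>a g \<in> Mor C (X \<otimes>\<^sub>o Y) (X' \<otimes>\<^sub>o Y')"
    and tensor_ident: "Idt C X \<otimes>\<^sub>a Idt C Y = Idt C (X \<otimes>\<^sub>o Y)"
    and tensor_comp: "f \<in> Mor C X X' \<Longrightarrow> f' \<in> Mor C X' X'' \<Longrightarrow> g \<in> Mor C Y Y' \<Longrightarrow> g' \<in> Mor C Y' Y''
      \<Longrightarrow> (f' \<cdot> f) \<otimes>\<^sub>a (g' \<cdot> g) = (f' \<otimes>\<^sub>a g') \<cdot> (f \<otimes>\<^sub>a g)"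
    and assoc_in: "Assoc C X Y Z \<in> Mor C (X \<otimes>\<^sub>o Y \<otimes>\<^sub>o Z) (X \<otimes>\<^sub>o (Y \<otimes>\<^sub>o Z))"
    and assoc_isom: "isom C (Assoc C X Y Z)"
    and assoc_natural: "f \<in> Mor C X X' \<Longrightarrow> g \<in> Mor C Y Y' \<Longrightarrow> h \<in> Mor C Z Z'
      \<Longrightarrow> Assoc C X' Y' Z' \<cdot> (f \<otimes>\<^sub>a g \<otimes>\<^sub>a h) = (f \<otimes>\<^sub>a (g \<otimes>\<^sub>a h)) \<cdot> Assoc C X Y Z"
    and lunit_in: "Lunit C X \<in> Mor C (Unit C \<otimes>\<^sub>o X) X"
    and lunit_isom: "isom C (Lunit C X)"
    and lunit_natural: "f \<in> Mor C X X'
      \<Longrightarrow> Lunit C X' \<cdot> (Idt C (Unit C) \<otimes>\<^sub>a f) = f \<cdot> Lunit C X"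
    and runit_in: "Runit C X \<in> Mor C (X \<otimes>\<^sub>o Unit C) X"
    and runit_isom: "isom C (Runit C X)"
    and runit_natural: "f \<in> Mor C X X'
      \<Longrightarrow> Runit C X' \<cdot> (f \<otimes>\<^sub>a Idt C (Unit C)) = f \<cdot> Runit C X"
    and symm_in: "Symm C X Y \<in> Mor C (X \<otimes>\<^sub>o Y) (Y \<otimes>\<^sub>o X)"
    and symm_natural: "f \<in> Mor C X X' \<Longrightarrow> g \<in> Mor C Y Y'
      \<Longrightarrow> Symm C X' Y' \<cdot> (f \<otimes>\<^sub>a g) = (g \<otimes>\<^sub>a f) \<cdot> Symm C X Y"
    and symm_symm: "Symm C Y X \<cdot> Symm C X Y = Idt C (X \<otimes>\<^sub>o Y)"
    and pentagon: "(Idt C W \<otimes>\<^sub>a Assoc C X Y Z) \<cdot> Assoc C W (X \<otimes>\<^sub>o Y) Z \<cdot> (Assoc C W X Y \<otimes>\<^sub>a Idt C Z)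
      = Assoc C W X (Y \<otimes>\<^sub>o Z) \<cdot> Assoc C (W \<otimes>\<^sub>o X) Y Z"
    and unit_triangle: "(Idt C X \<otimes>\<^sub>a Lunit C Y) \<cdot> Assoc C X (Unit C) Y = Runit C X \<otimes>\<^sub>a Idt C Y"
    and hexagon: "Assoc C Y Z X \<cdot> Symm C X (Y \<otimes>\<^sub>o Z) \<cdot> Assoc C X Y Z
      = (Idt C Y \<otimes>\<^sub>a Symm C X Z) \<cdot> Assoc C Y X Z \<cdot> (Symm C X Y \<otimes>\<^sub>a Idt C Z)"
    and eval_in: "Eval C X Y \<in> Mor C (Ihom C X Y \<otimes>\<^sub>o X) Y"
    and eval_universal: "g \<in> Mor C (Z \<otimes>\<^sub>o X) Y
      \<Longrightarrow> \<exists>!h. h \<in> Mor C Z (Ihom C X Y) \<and> Eval C X Y \<cdot> (h \<otimes>\<^sub>a Idt C X) = g"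

text \<open>
  Exactness of \<open>Hom(-, W)\<close> is stated without a choice of \<open>\<Sigma>\<^sup>-\<^sup>1\<close>, through a natural isomorphism
  \<open>s X : Hom(X, W) \<cong> \<Sigma> Hom(\<Sigma>X, W)\<close>.  Replacing \<open>s\<close> by its negative shows that the sign
  in \<open>ihom_exact_contra\<close> is a convention only.
\<close>

locale compatible_triangulation =
  triangulated_category C + closed_symmetric_monoidal_category C
  for C :: "('o, 'm, 'z) ttcat_scheme" (structure) +
  assumes tensor_left_exact: "exact_functor C C (tensor_left C X) (\<lambda>Y. SusR C X Y)"
    and tensor_right_exact: "exact_functor C C (tensor_right C Y) (\<lambda>X. SusL C X Y)"
    and ihom_exact: "\<exists>s. exact_functor C C (ihom_from C X) s"
    and ihom_additive_contra: "f \<in> Mor C X Y \<Longrightarrow> f' \<in> Mor C X Y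
      \<Longrightarrow> Ihom_arrow C (f \<^bold>+ f') (Idt C W) = Ihom_arrow C f (Idt C W) \<^bold>+ Ihom_arrow C f' (Idt C W)"
    and ihom_exact_contra: "\<exists>s.
        (\<forall>X. s X \<in> Mor C (Ihom C X W) (So C (Ihom C (So C X) W)) \<and> isom C (s X))
      \<and> (\<forall>X X' f. f \<in> Mor C X X' \<longrightarrow>
           s X \<cdot> Ihom_arrow C f (Idt C W) = Sa C (Ihom_arrow C (Sa C f) (Idt C W)) \<cdot> s X')
      \<and> (\<forall>X Y Z f g h. (f, g, h) \<in> Tri C \<longrightarrow> triangle C X Y Z f g h \<longrightarrow>
           (Ihom_arrow C g (Idt C W), Ihom_arrow C f (Idt C W),
            Neg C (Sa C (Ihom_arrow C h (Idt C W)) \<cdot> s X)) \<in> Tri C)"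

definition dual :: "('o, 'm, 'z) ttcat_scheme \<Rightarrow> 'o \<Rightarrow> 'o" where
  "dual C X = Ihom C X (Unit C)"

text \<open>
  The map \<open>(DX \<otimes> X) \<otimes> X \<rightarrow> X\<close> exchanging the two factors \<open>X\<close> and then evaluating \<open>DX\<close>, and its
  adjoint \<open>\<nu> : DX \<otimes> X \<rightarrow> Hom(X, X)\<close>.
\<close>

definition dual_eval :: "('o, 'm, 'z) ttcat_scheme \<Rightarrow> 'o \<Rightarrow> 'm" where
  "dual_eval C X =
     Lunit C X
     \<cdot>\<^bsub>C\<^esub> (Eval C X (Unit C) \<otimes>\<^sub>a\<^bsub>C\<^esub> Idt C X)
     \<cdot>\<^bsub>C\<^esub> inverse_arrow C (Assoc C (dual C X) X X)
     \<cdot>\<^bsub>C\<^esub> (Idt C (dual C X) \<otimes>\<^sub>a\<^bsub>C\<^esub> Symm C X X)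
     \<cdot>\<^bsub>C\<^esub> Assoc C (dual C X) X X"

definition nu :: "('o, 'm, 'z) ttcat_scheme \<Rightarrow> 'o \<Rightarrow> 'm" where
  "nu C X = curry_arrow C (dual C X \<otimes>\<^sub>o\<^bsub>C\<^esub> X) X X (dual_eval C X)"

definition dualizable :: "('o, 'm, 'z) ttcat_scheme \<Rightarrow> 'o \<Rightarrow> bool" where
  "dualizable C X \<longleftrightarrow> isom C (nu C X)"

section \<open>Compact generation\<close>

text \<open>
  ``Arbitrary'' coproducts are those indexed by small sets, where a set is small if its
  cardinality is less than that of a fixed set \<open>U\<close> of regular uncountable cardinality.
  If \<open>U\<close> is a Grothendieck universe this is the usual notion of smallness.
\<close>

definition smallness_bound :: "'u set \<Rightarrow> bool" where
  "smallness_bound U \<longleftrightarrow> (UNIV :: nat set) \<prec> U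
   \<and> (\<forall>(I :: 'u set) (A :: 'u \<Rightarrow> 'u set).
        I \<subseteq> U \<longrightarrow> I \<prec> U \<longrightarrow> (\<forall>i\<in>I. A i \<subseteq> U \<and> A i \<prec> U) \<longrightarrow> (\<Union>i\<in>I. A i) \<prec> U)"

definition is_coproduct ::
  "('o, 'm, 'z) cat_scheme \<Rightarrow> 'u set \<Rightarrow> ('u \<Rightarrow> 'o) \<Rightarrow> 'o \<Rightarrow> ('u \<Rightarrow> 'm) \<Rightarrow> bool" where
  "is_coproduct C I Y P \<iota> \<longleftrightarrow>
     (\<forall>i\<in>I. \<iota> i \<in> Mor C (Y i) P)
   \<and> (\<forall>Z f. (\<forall>i\<in>I. f i \<in> Mor C (Y i) Z)
        \<longrightarrow> (\<exists>!h. h \<in> Mor C P Z \<and> (\<forall>i\<in>I. h \<cdot>\<^bsub>C\<^esub> \<iota> i = f i)))"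

definition has_coproducts :: "'u set \<Rightarrow> ('o, 'm, 'z) cat_scheme \<Rightarrow> bool" where
  "has_coproducts U C \<longleftrightarrow>
     (\<forall>I Y. I \<subseteq> U \<longrightarrow> I \<prec> U \<longrightarrow> (\<exists>P \<iota>. is_coproduct C I Y P \<iota>))"

definition compact_object :: "'u set \<Rightarrow> ('o, 'm, 'z) acat_scheme \<Rightarrow> 'o \<Rightarrow> bool" where
  "compact_object U C X \<longleftrightarrow>
     (\<forall>I Y P \<iota>. I \<subseteq> U \<longrightarrow> I \<prec> U \<longrightarrow> is_coproduct C I Y P \<iota> \<longrightarrow>
        (\<lambda>x. gfinprod (homgrp C X P) (\<lambda>i. \<iota> i \<cdot>\<^bsub>C\<^esub> x i) I)
          \<in> iso (sum_group I (\<lambda>i. homgrp C X (Y i))) (homgrp C X P))"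

text \<open>
  The clause on \<open>Mor C X Y\<close> is automatic for locally small categories.  It is required only for
  generators \<open>X\<close> because local smallness and coproducts indexed by all small sets force a category
  to be a preorder unless smallness is closed under power sets.
\<close>

definition compactly_generated :: "'u set \<Rightarrow> ('o, 'm, 'z) ttcat_scheme \<Rightarrow> 'o set \<Rightarrow> bool" where
  "compactly_generated U C G \<longleftrightarrow>
     has_coproducts U C
   \<and> G \<prec> U \<and> (\<forall>X\<in>G. \<forall>Y. Mor C X Y \<prec> U)
   \<and> (\<forall>X\<in>G. compact_object U C X)
   \<and> compact_object U C (Unit C)
   \<and> (\<forall>A B g. g \<in> Mor C A B \<longrightarrow>
        (isom C g \<longleftrightarrow> (\<forall>X\<in>G. (\<lambda>h. g \<cdot>\<^bsub>C\<^esub> h) \<in> iso (homgrp C X A) (homgrp C X B))))"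

section \<open>The adjoint functors and the canonical maps\<close>

record ('c, 'k, 'd, 'l) adjoint_data =
  CC :: "('c, 'k) ttcat"
  DD :: "('d, 'l) ttcat"
  up_star :: "('d, 'l, 'c, 'k) fctr"  \<comment> \<open>\<open>f\<^sup>*\<close>\<close>
  low_star :: "('c, 'k, 'd, 'l) fctr"  \<comment> \<open>\<open>f\<^sub>*\<close>\<close>
  low_shriek :: "('c, 'k, 'd, 'l) fctr"  \<comment> \<open>\<open>f\<^sub>!\<close>\<close>
  mon_unit :: 'k  \<comment> \<open>\<open>f\<^sup>* T \<rightarrow> S\<close>\<close>
  mon_prod :: "'d \<Rightarrow> 'd \<Rightarrow> 'k"  \<comment> \<open>\<open>f\<^sup>*(Y \<otimes> Z) \<rightarrow> f\<^sup>* Y \<otimes> f\<^sup>* Z\<close>\<close>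
  sus_up :: "'d \<Rightarrow> 'k"  \<comment> \<open>\<open>f\<^sup>* \<Sigma>Y \<rightarrow> \<Sigma> f\<^sup>* Y\<close>\<close>
  eta :: "'d \<Rightarrow> 'l"
  eps :: "'c \<Rightarrow> 'k"
  zeta :: "'c \<Rightarrow> 'k"
  sigma :: "'d \<Rightarrow> 'l"
  CObj :: 'c  \<comment> \<open>the object \<open>C\<close>\<close>
  theta :: 'l  \<comment> \<open>\<open>f\<^sub>* S \<rightarrow> f\<^sub>! C\<close>\<close>

locale strong_symmetric_monoidal_functor =
  fixes A :: "('d, 'l, 'y) ttcat_scheme" and B :: "('c, 'k, 'z) ttcat_scheme"
    and F :: "('d, 'l, 'c, 'k) fctr" and u :: 'k and m :: "'d \<Rightarrow> 'd \<Rightarrow> 'k"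
  assumes F_functor: "is_functor A B F"
    and unit_in: "u \<in> Mor B (Fo F (Unit A)) (Unit B)"
    and unit_isom: "isom B u"
    and prod_in: "m X Y \<in> Mor B (Fo F (X \<otimes>\<^sub>o\<^bsub>A\<^esub> Y)) (Fo F X \<otimes>\<^sub>o\<^bsub>B\<^esub> Fo F Y)"
    and prod_isom: "isom B (m X Y)"
    and prod_natural: "f \<in> Mor A X X' \<Longrightarrow> g \<in> Mor A Y Y'
      \<Longrightarrow> m X' Y' \<cdot>\<^bsub>B\<^esub> Fa F (f \<otimes>\<^sub>a\<^bsub>A\<^esub> g) = (Fa F f \<otimes>\<^sub>a\<^bsub>B\<^esub> Fa F g) \<cdot>\<^bsub>B\<^esub> m X Y"
    and prod_assoc: "Assoc B (Fo F X) (Fo F Y) (Fo F Z)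
        \<cdot>\<^bsub>B\<^esub> (m X Y \<otimes>\<^sub>a\<^bsub>B\<^esub> Idt B (Fo F Z)) \<cdot>\<^bsub>B\<^esub> m (X \<otimes>\<^sub>o\<^bsub>A\<^esub> Y) Z
      = (Idt B (Fo F X) \<otimes>\<^sub>a\<^bsub>B\<^esub> m Y Z) \<cdot>\<^bsub>B\<^esub> m X (Y \<otimes>\<^sub>o\<^bsub>A\<^esub> Z) \<cdot>\<^bsub>B\<^esub> Fa F (Assoc A X Y Z)"
    and prod_lunit: "Lunit B (Fo F X) \<cdot>\<^bsub>B\<^esub> (u \<otimes>\<^sub>a\<^bsub>B\<^esub> Idt B (Fo F X)) \<cdot>\<^bsub>B\<^esub> m (Unit A) X
      = Fa F (Lunit A X)"
    and prod_runit: "Runit B (Fo F X) \<cdot>\<^bsub>B\<^esub> (Idt B (Fo F X) \<otimes>\<^sub>a\<^bsub>B\<^esub> u) \<cdot>\<^bsub>B\<^esub> m X (Unit A)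
      = Fa F (Runit A X)"
    and prod_symm: "Symm B (Fo F X) (Fo F Y) \<cdot>\<^bsub>B\<^esub> m X Y = m Y X \<cdot>\<^bsub>B\<^esub> Fa F (Symm A X Y)"

text \<open>\<open>f\<^sub>!(V \<otimes> X) \<rightarrow> f\<^sub>! V \<otimes> f\<^sub>! X\<close>\<close>

definition shriek_prod :: "('c, 'k, 'd, 'l) adjoint_data \<Rightarrow> 'c \<Rightarrow> 'c \<Rightarrow> 'l" where
  "shriek_prod W V X =
     (let P = Fo (low_shriek W) V; Q = Fo (low_shriek W) X in
      sigma W (P \<otimes>\<^sub>o\<^bsub>DD W\<^esub> Q)
      \<cdot>\<^bsub>DD W\<^esub> Fa (low_shriek W)
          (inverse_arrow (CC W) (mon_prod W P Q) \<cdot>\<^bsub>CC W\<^esub> (zeta W V \<otimes>\<^sub>a\<^bsub>CC W\<^esub> zeta W X)))"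

definition pibar :: "('c, 'k, 'd, 'l) adjoint_data \<Rightarrow> 'd \<Rightarrow> 'c \<Rightarrow> 'l" where
  "pibar W Y X =
     (sigma W Y \<otimes>\<^sub>a\<^bsub>DD W\<^esub> Idt (DD W) (Fo (low_shriek W) X))
     \<cdot>\<^bsub>DD W\<^esub> shriek_prod W (Fo (up_star W) Y) X"

definition fsharp :: "('c, 'k, 'd, 'l) adjoint_data \<Rightarrow> ('c, 'k, 'd, 'l) fctr" where
  "fsharp W = low_shriek W \<circ>\<^sub>F tensor_right (CC W) (CObj W)"

definition tau :: "('c, 'k, 'd, 'l) adjoint_data \<Rightarrow> 'l" where
  "tau W = theta W \<cdot>\<^bsub>DD W\<^esub> (Fa (low_star W) (mon_unit W) \<cdot>\<^bsub>DD W\<^esub> eta W (Unit (DD W)))"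

text \<open>The next two are meaningful only when \<open>pibar W Y (CObj W)\<close> is invertible for all \<open>Y\<close>.\<close>

definition tau_at :: "('c, 'k, 'd, 'l) adjoint_data \<Rightarrow> 'd \<Rightarrow> 'l" where
  "tau_at W Y =
     inverse_arrow (DD W) (pibar W Y (CObj W))
     \<cdot>\<^bsub>DD W\<^esub> (Idt (DD W) Y \<otimes>\<^sub>a\<^bsub>DD W\<^esub> tau W)
     \<cdot>\<^bsub>DD W\<^esub> inverse_arrow (DD W) (Runit (DD W) Y)"

definition omega :: "('c, 'k, 'd, 'l) adjoint_data \<Rightarrow> 'c \<Rightarrow> 'l" where
  "omega W X = Fa (fsharp W) (eps W X) \<cdot>\<^bsub>DD W\<^esub> tau_at W (Fo (low_star W) X)"

text \<open>
  The suspension isomorphisms \<open>f\<^sub>! \<Sigma>X \<rightarrow> \<Sigma> f\<^sub>! X\<close> and \<open>\<Sigma> f\<^sub>* X \<rightarrow> f\<^sub>* \<Sigma>X\<close> are the mates of that of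
  \<open>f\<^sup>*\<close>.
\<close>

definition sus_shriek :: "('c, 'k, 'd, 'l) adjoint_data \<Rightarrow> 'c \<Rightarrow> 'l" where
  "sus_shriek W X =
     (let P = Fo (low_shriek W) X in
      sigma W (So (DD W) P)
      \<cdot>\<^bsub>DD W\<^esub> Fa (low_shriek W) (inverse_arrow (CC W) (sus_up W P) \<cdot>\<^bsub>CC W\<^esub> Sa (CC W) (zeta W X)))"

definition sus_low_star :: "('c, 'k, 'd, 'l) adjoint_data \<Rightarrow> 'c \<Rightarrow> 'l" where
  "sus_low_star W X =
     (let Q = Fo (low_star W) X in
      Fa (low_star W) (Sa (CC W) (eps W X) \<cdot>\<^bsub>CC W\<^esub> sus_up W Q)
      \<cdot>\<^bsub>DD W\<^esub> eta W (So (DD W) Q))"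

definition sus_fsharp :: "('c, 'k, 'd, 'l) adjoint_data \<Rightarrow> 'c \<Rightarrow> 'l" where
  "sus_fsharp W X =
     sus_shriek W (X \<otimes>\<^sub>o\<^bsub>CC W\<^esub> CObj W)
     \<cdot>\<^bsub>DD W\<^esub> Fa (low_shriek W) (SusL (CC W) X (CObj W))"

locale adjoint_context =
  fixes W :: "('c, 'k, 'd, 'l) adjoint_data"
  assumes C_triangulation: "compatible_triangulation (CC W)"
    and D_triangulation: "compatible_triangulation (DD W)"
    and up_star_monoidal:
      "strong_symmetric_monoidal_functor (DD W) (CC W) (up_star W) (mon_unit W) (mon_prod W)"
    and up_star_exact: "exact_functor (DD W) (CC W) (up_star W) (sus_up W)"
    and mon_prod_sus_right: "
      SusR (CC W) (Fo (up_star W) Y) (Fo (up_star W) Z)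
        \<cdot>\<^bsub>CC W\<^esub> (Idt (CC W) (Fo (up_star W) Y) \<otimes>\<^sub>a\<^bsub>CC W\<^esub> sus_up W Z)
        \<cdot>\<^bsub>CC W\<^esub> mon_prod W Y (So (DD W) Z)
      = Sa (CC W) (mon_prod W Y Z) \<cdot>\<^bsub>CC W\<^esub> sus_up W (Y \<otimes>\<^sub>o\<^bsub>DD W\<^esub> Z)
        \<cdot>\<^bsub>CC W\<^esub> Fa (up_star W) (SusR (DD W) Y Z)"
    and mon_prod_sus_left: "
      SusL (CC W) (Fo (up_star W) Y) (Fo (up_star W) Z)
        \<cdot>\<^bsub>CC W\<^esub> (sus_up W Y \<otimes>\<^sub>a\<^bsub>CC W\<^esub> Idt (CC W) (Fo (up_star W) Z))
        \<cdot>\<^bsub>CC W\<^esub> mon_prod W (So (DD W) Y) Z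
      = Sa (CC W) (mon_prod W Y Z) \<cdot>\<^bsub>CC W\<^esub> sus_up W (Y \<otimes>\<^sub>o\<^bsub>DD W\<^esub> Z)
        \<cdot>\<^bsub>CC W\<^esub> Fa (up_star W) (SusL (DD W) Y Z)"
    and low_star_adjunction:
      "adjunction (DD W) (CC W) (up_star W) (low_star W) (eta W) (eps W)"
    and low_shriek_adjunction:
      "adjunction (CC W) (DD W) (low_shriek W) (up_star W) (zeta W) (sigma W)"
    and theta_in:
      "theta W \<in> Mor (DD W) (Fo (low_star W) (Unit (CC W))) (Fo (low_shriek W) (CObj W))"
    and theta_isom: "isom (DD W) (theta W)"
    and pibar_sus_right: "
      Sa (DD W) (pibar W Y X) \<cdot>\<^bsub>DD W\<^esub> sus_shriek W (Fo (up_star W) Y \<otimes>\<^sub>o\<^bsub>CC W\<^esub> X)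
        \<cdot>\<^bsub>DD W\<^esub> Fa (low_shriek W) (SusR (CC W) (Fo (up_star W) Y) X)
      = SusR (DD W) Y (Fo (low_shriek W) X) \<cdot>\<^bsub>DD W\<^esub> (Idt (DD W) Y \<otimes>\<^sub>a\<^bsub>DD W\<^esub> sus_shriek W X)
        \<cdot>\<^bsub>DD W\<^esub> pibar W Y (So (CC W) X)"
    and pibar_sus_left: "
      Sa (DD W) (pibar W Y X) \<cdot>\<^bsub>DD W\<^esub> sus_shriek W (Fo (up_star W) Y \<otimes>\<^sub>o\<^bsub>CC W\<^esub> X)
        \<cdot>\<^bsub>DD W\<^esub> Fa (low_shriek W) (SusL (CC W) (Fo (up_star W) Y) X
                                    \<cdot>\<^bsub>CC W\<^esub> (sus_up W Y \<otimes>\<^sub>a\<^bsub>CC W\<^esub> Idt (CC W) X))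
      = SusL (DD W) Y (Fo (low_shriek W) X) \<cdot>\<^bsub>DD W\<^esub> pibar W (So (DD W) Y) X"
    and omega_sus: "(\<And>Y. isom (DD W) (pibar W Y (CObj W)))
      \<Longrightarrow> sus_fsharp W X \<cdot>\<^bsub>DD W\<^esub> omega W (So (CC W) X) \<cdot>\<^bsub>DD W\<^esub> sus_low_star W X
          = Sa (DD W) (omega W X)"

end

theory Submission
  imports Defs
begin

text \<open>
  Fix \<open>Y\<close>. Both sides of \<open>\<pi>\<close> are left adjoints in \<open>X\<close>, and the mate of \<open>\<pi>\<close> on the right adjoints is tested
  on generators, so \<open>\<pi>\<close> is invertible as soon as it is invertible on generators.

  The objects at which \<open>\<omega>\<close> is invertible are closed under cones: \<open>f\<^sub>*\<close> and \<open>f\<^sub>!(_ \<otimes> C)\<close> turn triangles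
  into sequences on which \<open>Hom(V, _)\<close> is exact, and the five lemma applies. If every \<open>f\<^sup>*Y\<close> with
  \<open>Y \<in> H\<close> is compact, they are also closed under coproducts, hence everything, because each object of
  \<open>\<C>\<close> is the homotopy colimit of a tower built from generators by coproducts and cones. In general,
  dualizable objects are compact, since the unit is, and every compact object is a retract of a compact
  object at which \<open>\<omega>\<close> is invertible.
\<close>

section \<open>Categories and adjunctions\<close>

text \<open>The generating set is not assumed closed under suspension, so an arrow cannot be tested
  by asking that its cone receive no nonzero arrow from a generator. Injectivity and surjectivity on
  Hom sets are tested separately instead; this shapes the tower for an object, whose stage 0 takes
  care of surjectivity and whose later stages take care of injectivity.

  \<open>f_*\<close> and \<open>f_!\<close> are given only as adjoints of an exact functor. They are
  never shown to preserve distinguished triangles: exactness of \<open>Hom(V, F _)\<close> in the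
  middle is enough for the five lemma. That lemma also needs \<open>omega\<close> at the suspended
  objects, and there compatibility of \<open>omega\<close> with the suspension enters, together with
  invertibility of the mates of the suspension isomorphism of \<open>f^*\<close>.

  Without compactness of the \<open>f^* Y\<close>, nothing makes \<open>f_*\<close> respect
  coproducts. The objects with invertible \<open>omega\<close> are then only known to be closed
  under finite constructions and retracts, which is why the dualizable case must first exhibit each
  compact object as a retract of one built finitely.\<close>

context category begin

lemma Mor_iff: "f \<in> Mor C X Y \<longleftrightarrow> Dom C f = X \<and> Cod C f = Y"
  by (auto simp: Mor_def)

lemma dom_ident [simp]: "Dom C (Idt C X) = X" and cod_ident [simp]: "Cod C (Idt C X) = X"
  using ident_in[of X] by (auto simp: Mor_iff)

lemma dom_comp [simp]: "Cod C f = Dom C g \<Longrightarrow> Dom C (g \<cdot> f) = Dom C f"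
  and cod_comp [simp]: "Cod C f = Dom C g \<Longrightarrow> Cod C (g \<cdot> f) = Cod C g"
  using comp_in[of f "Dom C f" "Cod C f" g "Cod C g"] by (auto simp: Mor_iff)

lemma ident_right [simp]: "Dom C f = X \<Longrightarrow> f \<cdot> Idt C X = f"
  using comp_ident_right by (auto simp: Mor_iff)

lemma ident_left [simp]: "Cod C f = X \<Longrightarrow> Idt C X \<cdot> f = f"
  using comp_ident_left by (auto simp: Mor_iff)

lemma assoc: "Cod C f = Dom C g \<Longrightarrow> Cod C g = Dom C h \<Longrightarrow> h \<cdot> g \<cdot> f = h \<cdot> (g \<cdot> f)"
  by (rule comp_assoc) (auto simp: Mor_iff)

lemma isomI:
  assumes "Dom C g = Cod C f" "Cod C g = Dom C f"
    and "g \<cdot> f = Idt C (Dom C f)" "f \<cdot> g = Idt C (Cod C f)"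
  shows "isom C f"
  using assms by (auto simp: isom_def inverse_arrows_def Mor_iff)

lemma inverse_arrows_unique:
  assumes "inverse_arrows C f g" "inverse_arrows C f g'" shows "g = g'"
proof -
  have "g = g \<cdot> (f \<cdot> g')"
    using assms by (auto simp: inverse_arrows_def Mor_iff)
  also have "\<dots> = g \<cdot> f \<cdot> g'"
    using assms by (intro assoc[symmetric]) (auto simp: inverse_arrows_def Mor_iff)
  also have "\<dots> = g'"
    using assms by (auto simp: inverse_arrows_def Mor_iff)
  finally show ?thesis .
qed

lemma
  assumes "isom C f"
  shows dom_inverse [simp]: "Dom C (inverse_arrow C f) = Cod C f"
    and cod_inverse [simp]: "Cod C (inverse_arrow C f) = Dom C f"
    and inverse_left [simp]: "inverse_arrow C f \<cdot> f = Idt C (Dom C f)"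
    and inverse_right [simp]: "f \<cdot> inverse_arrow C f = Idt C (Cod C f)"
proof -
  have "inverse_arrows C f (inverse_arrow C f)"
    unfolding inverse_arrow_def
    by (rule theI') (use assms inverse_arrows_unique in \<open>auto simp: isom_def\<close>)
  then show "Dom C (inverse_arrow C f) = Cod C f" "Cod C (inverse_arrow C f) = Dom C f"
    "inverse_arrow C f \<cdot> f = Idt C (Dom C f)" "f \<cdot> inverse_arrow C f = Idt C (Cod C f)"
    by (auto simp: inverse_arrows_def Mor_iff)
qed

lemma inverse_left_assoc [simp]:
  "isom C f \<Longrightarrow> Cod C v = Dom C f \<Longrightarrow> inverse_arrow C f \<cdot> (f \<cdot> v) = v"
  by (simp flip: assoc)

lemma inverse_right_assoc [simp]:
  "isom C f \<Longrightarrow> Cod C v = Cod C f \<Longrightarrow> f \<cdot> (inverse_arrow C f \<cdot> v) = v"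
  by (simp flip: assoc)

lemma isom_ident [simp]: "isom C (Idt C X)"
  by (rule isomI[of "Idt C X"]) auto

lemma isom_inverse [simp]: "isom C f \<Longrightarrow> isom C (inverse_arrow C f)"
  by (rule isomI[of f]) auto

lemma isom_cancel_left:
  assumes "isom C f" "f \<cdot> v = f \<cdot> w" "Cod C v = Dom C f" "Cod C w = Dom C f"
  shows "v = w"
proof -
  have "v = inverse_arrow C f \<cdot> (f \<cdot> v)" using assms(1,3) by simp
  also have "\<dots> = w" unfolding assms(2) using assms(1,4) by simp
  finally show ?thesis .
qed

lemma isom_cancel_right:
  assumes "isom C f" "v \<cdot> f = w \<cdot> f" "Dom C v = Cod C f" "Dom C w = Cod C f"
  shows "v = w"
proof -
  have "v = v \<cdot> f \<cdot> inverse_arrow C f" using assms(1,3) by (simp add: assoc)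
  also have "\<dots> = w" using assms(1,3,4) unfolding assms(2) by (simp add: assoc)
  finally show ?thesis .
qed

lemma isom_comp [simp]:
  assumes "isom C f" "isom C g" "Cod C f = Dom C g" shows "isom C (g \<cdot> f)"
  using assms by (intro isomI[of "inverse_arrow C f \<cdot> inverse_arrow C g"]) (simp_all add: assoc)

lemma isom_comp_cancel_left:
  assumes "isom C (g \<cdot> f)" "isom C g" "Cod C f = Dom C g" shows "isom C f"
proof -
  have "isom C (inverse_arrow C g \<cdot> (g \<cdot> f))"
    using assms(2,3) by (intro isom_comp[OF assms(1)]) simp_all
  then show ?thesis using assms by simp
qed

lemma isom_comp_cancel_right:
  assumes "isom C (g \<cdot> f)" "isom C f" "Cod C f = Dom C g" shows "isom C g"
proof -
  have "isom C (g \<cdot> f \<cdot> inverse_arrow C f)"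
    using assms(2,3) by (intro isom_comp[OF _ assms(1)]) simp_all
  then show ?thesis using assms by (simp add: assoc)
qed

text \<open>A preimage \<open>g\<close> of the identity is a right inverse of \<open>f\<close>, and
  injectivity applied to \<open>f (g f) = f\<close> makes it a left inverse.\<close>

lemma isom_yoneda:
  assumes inj: "\<And>v w. Dom C v = Dom C w \<Longrightarrow> Cod C v = Dom C f \<Longrightarrow> Cod C w = Dom C f
      \<Longrightarrow> f \<cdot> v = f \<cdot> w \<Longrightarrow> v = w"
    and surj: "\<And>v. Cod C v = Cod C f \<Longrightarrow> \<exists>w. Dom C w = Dom C v \<and> Cod C w = Dom C f \<and> f \<cdot> w = v"
  shows "isom C f"
proof -
  obtain g where g: "Dom C g = Cod C f" "Cod C g = Dom C f" "f \<cdot> g = Idt C (Cod C f)"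
    using surj[of "Idt C (Cod C f)"] by auto
  have "g \<cdot> f = Idt C (Dom C f)"
    by (rule inj) (simp_all add: g flip: assoc)
  with g show ?thesis by (intro isomI)
qed

lemma isom_coyoneda:
  assumes inj: "\<And>v w. Cod C v = Cod C w \<Longrightarrow> Dom C v = Cod C f \<Longrightarrow> Dom C w = Cod C f
      \<Longrightarrow> v \<cdot> f = w \<cdot> f \<Longrightarrow> v = w"
    and surj: "\<And>v. Dom C v = Dom C f \<Longrightarrow> \<exists>w. Cod C w = Cod C v \<and> Dom C w = Cod C f \<and> w \<cdot> f = v"
  shows "isom C f"
proof -
  obtain g where g: "Dom C g = Cod C f" "Cod C g = Dom C f" "g \<cdot> f = Idt C (Dom C f)"
    using surj[of "Idt C (Dom C f)"] by auto
  have "f \<cdot> g = Idt C (Cod C f)"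
    by (rule inj) (simp_all add: g assoc)
  with g show ?thesis by (intro isomI)
qed

text \<open>Applies a commutative square at the head of a composite bracketed to the right, the
  normal form produced by \<open>assoc\<close>; long naturality chases advance by such
  rewrites.\<close>

lemma comp_push:
  "a \<cdot> b = c \<cdot> d \<Longrightarrow> Cod C b = Dom C a \<Longrightarrow> Cod C d = Dom C c \<Longrightarrow> Cod C v = Dom C b \<Longrightarrow> Dom C d = Dom C b
    \<Longrightarrow> a \<cdot> (b \<cdot> v) = c \<cdot> (d \<cdot> v)"
  by (simp flip: assoc)

lemma inverse_natural:
  assumes "isom C a" "isom C b" "b \<cdot> f = g \<cdot> a"
    and "Dom C f = Dom C a" "Cod C f = Dom C b" "Dom C g = Cod C a" "Cod C g = Cod C b"
  shows "inverse_arrow C b \<cdot> g = f \<cdot> inverse_arrow C a"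
proof -
  have "inverse_arrow C b \<cdot> g = inverse_arrow C b \<cdot> (g \<cdot> a \<cdot> inverse_arrow C a)"
    using assms(1,2,4-) by (simp add: assoc)
  also have "\<dots> = f \<cdot> inverse_arrow C a"
    unfolding assms(3)[symmetric] using assms(1,2,4-) by (simp add: assoc)
  finally show ?thesis .
qed

text \<open>\<open>g\<close> is a retract of \<open>f\<close> in the category of arrows, so
  \<open>r f^-1 k\<close> inverts it. This is how invertibility of \<open>omega\<close> descends to
  retracts.\<close>

lemma isom_retract:
  assumes f: "isom C f" and ij: "Dom C i = Dom C g" "Cod C r = Dom C g" "Cod C i = Dom C r"
      "r \<cdot> i = Idt C (Dom C g)" "Cod C i = Dom C f"
    and kl: "Dom C k = Cod C g" "Cod C s = Cod C g" "Cod C k = Dom C s" "s \<cdot> k = Idt C (Cod C g)" "Cod C k = Cod C f"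
    and eq: "k \<cdot> g = f \<cdot> i" "g \<cdot> r = s \<cdot> f"
  shows "isom C g"
proof -
  define h where "h = r \<cdot> inverse_arrow C f \<cdot> k"
  have "h \<cdot> g = r \<cdot> (inverse_arrow C f \<cdot> (k \<cdot> g))"
    using f ij kl by (simp add: h_def assoc)
  also have "\<dots> = Idt C (Dom C g)"
    using f ij kl by (simp add: eq)
  finally have 1: "h \<cdot> g = Idt C (Dom C g)" .
  have "g \<cdot> h = (g \<cdot> r) \<cdot> (inverse_arrow C f \<cdot> k)"
    using f ij kl by (simp add: h_def assoc)
  also have "\<dots> = Idt C (Cod C g)"
    using f ij kl by (simp add: eq assoc)
  finally have 2: "g \<cdot> h = Idt C (Cod C g)" .
  show ?thesis
    using f ij kl by (intro isomI[OF _ _ 1 2]) (simp_all add: h_def)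
qed

end

section \<open>Functors, adjunctions and transposition\<close>

locale category_functor = A: category A + B: category B
  for A :: "('o, 'm, 'y) cat_scheme" and B :: "('p, 'n, 'z) cat_scheme" +
  fixes F :: "('o, 'm, 'p, 'n) fctr"
  assumes F_functor: "is_functor A B F"
begin

lemma F_dom [simp]: "Dom B (Fa F f) = Fo F (Dom A f)"
  and F_cod [simp]: "Cod B (Fa F f) = Fo F (Cod A f)"
  using F_functor by (auto simp: is_functor_def A.Mor_iff B.Mor_iff)

lemma F_ident [simp]: "Fa F (Idt A X) = Idt B (Fo F X)"
  using F_functor by (auto simp: is_functor_def)

lemma F_comp: "Cod A f = Dom A g \<Longrightarrow> Fa F (g \<cdot>\<^bsub>A\<^esub> f) = Fa F g \<cdot>\<^bsub>B\<^esub> Fa F f"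
  using F_functor by (auto simp: is_functor_def A.Mor_iff B.Mor_iff)

lemma F_inverse: 
  assumes "isom A f"
  shows "Fa F f \<cdot>\<^bsub>B\<^esub> Fa F (inverse_arrow A f) = Idt B (Fo F (Cod A f))"
    and "Fa F (inverse_arrow A f) \<cdot>\<^bsub>B\<^esub> Fa F f = Idt B (Fo F (Dom A f))"
  using assms by (simp_all flip: F_comp)

lemma F_isom [simp]: "isom A f \<Longrightarrow> isom B (Fa F f)"
  by (rule B.isomI[of "Fa F (inverse_arrow A f)"]) (simp_all add: F_inverse)

end

lemma is_functor_comp:
  assumes "category_functor A B F" "category_functor B E G"
  shows "category_functor A E (G \<circ>\<^sub>F F)"
proof -
  interpret F: category_functor A B F by fact
  interpret G: category_functor B E G by fact
  show ?thesis
    by unfold_locales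
      (auto simp: is_functor_def functor_comp_def F.A.Mor_iff F.B.Mor_iff G.B.Mor_iff F.F_comp G.F_comp)
qed

locale adjoint_pair = A: category A + B: category B
  for A :: "('o, 'm, 'y) cat_scheme" and B :: "('p, 'n, 'z) cat_scheme" +
  fixes L R unit counit
  assumes adjunction: "adjunction A B L R unit counit"
begin

sublocale L: category_functor A B L
  using adjunction by unfold_locales (simp add: adjunction_def)

sublocale R: category_functor B A R
  using adjunction by unfold_locales (simp add: adjunction_def)

lemma dom_unit [simp]: "Dom A (unit X) = X" and cod_unit [simp]: "Cod A (unit X) = Fo R (Fo L X)"
  and dom_counit [simp]: "Dom B (counit Y) = Fo L (Fo R Y)" and cod_counit [simp]: "Cod B (counit Y) = Y"
  using adjunction
  by (auto simp: adjunction_def natural_def functor_id_def functor_comp_def A.Mor_iff B.Mor_iff)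

lemma unit_natural: "unit (Cod A f) \<cdot>\<^bsub>A\<^esub> f = Fa R (Fa L f) \<cdot>\<^bsub>A\<^esub> unit (Dom A f)"
  and counit_natural: "counit (Cod B g) \<cdot>\<^bsub>B\<^esub> Fa L (Fa R g) = g \<cdot>\<^bsub>B\<^esub> counit (Dom B g)"
  using adjunction
  by (auto simp: adjunction_def natural_def functor_id_def functor_comp_def A.Mor_iff B.Mor_iff)

lemma counit_unit: "counit (Fo L X) \<cdot>\<^bsub>B\<^esub> Fa L (unit X) = Idt B (Fo L X)"
  and unit_counit: "Fa R (counit Y) \<cdot>\<^bsub>A\<^esub> unit (Fo R Y) = Idt A (Fo R Y)"
  using adjunction by (auto simp: adjunction_def)

lemma transpose_right:
  assumes "Dom B g = Fo L X"
  shows "counit (Cod B g) \<cdot>\<^bsub>B\<^esub> Fa L (Fa R g \<cdot>\<^bsub>A\<^esub> unit X) = g"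
proof -
  have "counit (Cod B g) \<cdot>\<^bsub>B\<^esub> Fa L (Fa R g \<cdot>\<^bsub>A\<^esub> unit X)
      = counit (Cod B g) \<cdot>\<^bsub>B\<^esub> Fa L (Fa R g) \<cdot>\<^bsub>B\<^esub> Fa L (unit X)"
    using assms by (simp add: L.F_comp B.assoc)
  also have "\<dots> = g" using assms by (simp add: counit_natural B.assoc counit_unit)
  finally show ?thesis .
qed

lemma transpose_left:
  assumes "Cod A h = Fo R Y"
  shows "Fa R (counit Y \<cdot>\<^bsub>B\<^esub> Fa L h) \<cdot>\<^bsub>A\<^esub> unit (Dom A h) = h"
proof -
  have "Fa R (counit Y \<cdot>\<^bsub>B\<^esub> Fa L h) \<cdot>\<^bsub>A\<^esub> unit (Dom A h)
     = Fa R (counit Y) \<cdot>\<^bsub>A\<^esub> (Fa R (Fa L h) \<cdot>\<^bsub>A\<^esub> unit (Dom A h))"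
    using assms by (simp add: R.F_comp A.assoc)
  also have "\<dots> = h" using assms by (simp add: unit_counit flip: A.assoc unit_natural)
  finally show ?thesis .
qed

text \<open>Transposition is injective because \<open>transpose_right\<close> rebuilds
  \<open>g\<close> from its transpose.\<close>

lemma unit_cancel:
  assumes "Dom B g = Fo L X" "Dom B g' = Fo L X" "Cod B g = Cod B g'"
    and "Fa R g \<cdot>\<^bsub>A\<^esub> unit X = Fa R g' \<cdot>\<^bsub>A\<^esub> unit X"
  shows "g = g'"
  using transpose_right[OF assms(1)] transpose_right[OF assms(2)] unfolding assms(3,4) by (rule box_equals[OF refl])

lemma counit_cancel:
  assumes "Cod A h = Fo R Y" "Cod A h' = Fo R Y" "Dom A h = Dom A h'"
    and "counit Y \<cdot>\<^bsub>B\<^esub> Fa L h = counit Y \<cdot>\<^bsub>B\<^esub> Fa L h'"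
  shows "h = h'"
  using transpose_left[OF assms(1)] transpose_left[OF assms(2)] unfolding assms(3,4) by (rule box_equals[OF refl])

end

text \<open>That is, \<open>L\<close> has a right adjoint; couniversal arrows avoid having to choose it.\<close>

definition left_adjoint ::
  "('o, 'm, 'y) cat_scheme \<Rightarrow> ('p, 'n, 'z) cat_scheme \<Rightarrow> ('o, 'm, 'p, 'n) fctr \<Rightarrow> bool" where
  "left_adjoint A B L \<longleftrightarrow> (\<forall>V. \<exists>Q e. e \<in> Mor B (Fo L Q) V
     \<and> (\<forall>X. \<forall>g\<in>Mor B (Fo L X) V. \<exists>!h. h \<in> Mor A X Q \<and> e \<cdot>\<^bsub>B\<^esub> Fa L h = g))"

lemma left_adjointI:
  assumes "\<And>V. \<exists>Q e. Dom B e = Fo L Q \<and> Cod B e = V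
      \<and> (\<forall>g X. Dom B g = Fo L X \<longrightarrow> Cod B g = V
          \<longrightarrow> (\<exists>h. Dom A h = X \<and> Cod A h = Q \<and> e \<cdot>\<^bsub>B\<^esub> Fa L h = g))
      \<and> (\<forall>h h'. Dom A h = Dom A h' \<longrightarrow> Cod A h = Q \<longrightarrow> Cod A h' = Q
          \<longrightarrow> e \<cdot>\<^bsub>B\<^esub> Fa L h = e \<cdot>\<^bsub>B\<^esub> Fa L h' \<longrightarrow> h = h')"
  shows "left_adjoint A B L"
  unfolding left_adjoint_def
proof
  fix V
  obtain Q e where e: "Dom B e = Fo L Q" "Cod B e = V"
    and ex: "\<forall>g X. Dom B g = Fo L X \<longrightarrow> Cod B g = V
          \<longrightarrow> (\<exists>h. Dom A h = X \<and> Cod A h = Q \<and> e \<cdot>\<^bsub>B\<^esub> Fa L h = g)"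
    and uniq: "\<forall>h h'. Dom A h = Dom A h' \<longrightarrow> Cod A h = Q \<longrightarrow> Cod A h' = Q
          \<longrightarrow> e \<cdot>\<^bsub>B\<^esub> Fa L h = e \<cdot>\<^bsub>B\<^esub> Fa L h' \<longrightarrow> h = h'"
    using assms[of V] by auto
  have "\<exists>!h. h \<in> Mor A X Q \<and> e \<cdot>\<^bsub>B\<^esub> Fa L h = g" if g: "g \<in> Mor B (Fo L X) V" for X g
  proof -
    obtain h where "Dom A h = X" "Cod A h = Q" "e \<cdot>\<^bsub>B\<^esub> Fa L h = g"
      using g ex unfolding Mor_def by blast
    then show ?thesis using uniq by (intro ex1I[of _ h]) (auto simp: Mor_def)
  qed
  then show "\<exists>Q e. e \<in> Mor B (Fo L Q) V
     \<and> (\<forall>X. \<forall>g\<in>Mor B (Fo L X) V. \<exists>!h. h \<in> Mor A X Q \<and> e \<cdot>\<^bsub>B\<^esub> Fa L h = g)"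
    using e by (intro exI[of _ Q] exI[of _ e]) (auto simp: Mor_def)
qed

lemma left_adjointE:
  assumes "category_functor A B L" "left_adjoint A B L"
  obtains Q e where "Dom B e = Fo L Q" "Cod B e = V"
    "\<And>g X. Dom B g = Fo L X \<Longrightarrow> Cod B g = V \<Longrightarrow> \<exists>h. Dom A h = X \<and> Cod A h = Q \<and> e \<cdot>\<^bsub>B\<^esub> Fa L h = g"
    "\<And>h h'. Dom A h = Dom A h' \<Longrightarrow> Cod A h = Q \<Longrightarrow> Cod A h' = Q
          \<Longrightarrow> e \<cdot>\<^bsub>B\<^esub> Fa L h = e \<cdot>\<^bsub>B\<^esub> Fa L h' \<Longrightarrow> h = h'"
proof -
  interpret category_functor A B L by fact
  from assms(2)[unfolded left_adjoint_def, THEN spec, of V]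
  obtain Q e where e: "e \<in> Mor B (Fo L Q) V"
     and "\<forall>X. \<forall>g\<in>Mor B (Fo L X) V. \<exists>!h. h \<in> Mor A X Q \<and> e \<cdot>\<^bsub>B\<^esub> Fa L h = g"
    by (elim exE conjE)
  then have u: "\<exists>!h. h \<in> Mor A X Q \<and> e \<cdot>\<^bsub>B\<^esub> Fa L h = g" if "g \<in> Mor B (Fo L X) V" for g X
    using that by blast
  have e': "Dom B e = Fo L Q" "Cod B e = V" using e by (auto simp: Mor_def)
  have ex: "\<exists>h. Dom A h = X \<and> Cod A h = Q \<and> e \<cdot>\<^bsub>B\<^esub> Fa L h = g"
    if "Dom B g = Fo L X" "Cod B g = V" for g X
    using u[of g X, THEN ex1_implies_ex] that unfolding Mor_def by simp
  have uniq: "h = h'" if h: "Dom A h = Dom A h'" "Cod A h = Q" "Cod A h' = Q"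
      "e \<cdot>\<^bsub>B\<^esub> Fa L h = e \<cdot>\<^bsub>B\<^esub> Fa L h'" for h h'
  proof -
    have "\<exists>!k. k \<in> Mor A (Dom A h) Q \<and> e \<cdot>\<^bsub>B\<^esub> Fa L k = e \<cdot>\<^bsub>B\<^esub> Fa L h"
      by (rule u) (simp add: Mor_def h(2) e')
    moreover have "h \<in> Mor A (Dom A h) Q" "h' \<in> Mor A (Dom A h) Q"
      using h(1,2,3) by (simp_all add: Mor_def)
    ultimately show ?thesis using h(4)[symmetric] by blast
  qed
  show thesis by (rule that[OF e' ex uniq])
qed

lemma (in adjoint_pair) left_adjoint: "left_adjoint A B L"
proof (rule left_adjointI)
  fix V
  have "\<exists>h. Dom A h = X \<and> Cod A h = Fo R V \<and> counit V \<cdot>\<^bsub>B\<^esub> Fa L h = g"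
    if "Dom B g = Fo L X" "Cod B g = V" for g X
    using that transpose_right[of g X] by (intro exI[of _ "Fa R g \<cdot>\<^bsub>A\<^esub> unit X"]) auto
  then show "\<exists>Q e. Dom B e = Fo L Q \<and> Cod B e = V
      \<and> (\<forall>g X. Dom B g = Fo L X \<longrightarrow> Cod B g = V
          \<longrightarrow> (\<exists>h. Dom A h = X \<and> Cod A h = Q \<and> e \<cdot>\<^bsub>B\<^esub> Fa L h = g))
      \<and> (\<forall>h h'. Dom A h = Dom A h' \<longrightarrow> Cod A h = Q \<longrightarrow> Cod A h' = Q
          \<longrightarrow> e \<cdot>\<^bsub>B\<^esub> Fa L h = e \<cdot>\<^bsub>B\<^esub> Fa L h' \<longrightarrow> h = h')"
    using counit_cancel by (intro exI[of _ "Fo R V"] exI[of _ "counit V"]) auto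
qed

text \<open>A couniversal arrow for the composite at \<open>V\<close> is \<open>e\<close> after
  \<open>K e'\<close>, where \<open>e\<close> is couniversal for \<open>K\<close> at
  \<open>V\<close> and \<open>e'\<close> is couniversal for \<open>L\<close> at the object
  \<open>Q\<close> that comes with \<open>e\<close>.\<close>

lemma left_adjoint_comp:
  assumes "category_functor A B L" "category_functor B E K" "left_adjoint A B L" "left_adjoint B E K"
  shows "left_adjoint A E (K \<circ>\<^sub>F L)"
proof (rule left_adjointI)
  fix V
  interpret L: category_functor A B L by fact
  interpret K: category_functor B E K by fact
  obtain Q e where e: "Dom E e = Fo K Q" "Cod E e = V"
    and ex: "\<And>g X. Dom E g = Fo K X \<Longrightarrow> Cod E g = V \<Longrightarrow> \<exists>h. Dom B h = X \<and> Cod B h = Q \<and> e \<cdot>\<^bsub>E\<^esub> Fa K h = g"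
    and uniq: "\<And>h h'. Dom B h = Dom B h' \<Longrightarrow> Cod B h = Q \<Longrightarrow> Cod B h' = Q
          \<Longrightarrow> e \<cdot>\<^bsub>E\<^esub> Fa K h = e \<cdot>\<^bsub>E\<^esub> Fa K h' \<Longrightarrow> h = h'"
    by (rule left_adjointE[OF assms(2,4), of V]) (rule that; blast)
  obtain Q' e' where e': "Dom B e' = Fo L Q'" "Cod B e' = Q"
    and ex': "\<And>g X. Dom B g = Fo L X \<Longrightarrow> Cod B g = Q \<Longrightarrow> \<exists>h. Dom A h = X \<and> Cod A h = Q' \<and> e' \<cdot>\<^bsub>B\<^esub> Fa L h = g"
    and uniq': "\<And>h h'. Dom A h = Dom A h' \<Longrightarrow> Cod A h = Q' \<Longrightarrow> Cod A h' = Q'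
          \<Longrightarrow> e' \<cdot>\<^bsub>B\<^esub> Fa L h = e' \<cdot>\<^bsub>B\<^esub> Fa L h' \<Longrightarrow> h = h'"
    by (rule left_adjointE[OF assms(1,3), of Q]) (rule that; blast)
  have eq: "(e \<cdot>\<^bsub>E\<^esub> Fa K e') \<cdot>\<^bsub>E\<^esub> Fa (K \<circ>\<^sub>F L) h = e \<cdot>\<^bsub>E\<^esub> Fa K (e' \<cdot>\<^bsub>B\<^esub> Fa L h)" if "Cod A h = Q'" for h
    using that e e' by (simp add: functor_comp_def K.F_comp K.B.assoc)
  have 1: "\<exists>h. Dom A h = X \<and> Cod A h = Q' \<and> (e \<cdot>\<^bsub>E\<^esub> Fa K e') \<cdot>\<^bsub>E\<^esub> Fa (K \<circ>\<^sub>F L) h = g"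
    if g: "Dom E g = Fo (K \<circ>\<^sub>F L) X" "Cod E g = V" for g X
  proof -
    obtain k where k: "Dom B k = Fo L X" "Cod B k = Q" "e \<cdot>\<^bsub>E\<^esub> Fa K k = g"
      using ex[of g "Fo L X"] g by (auto simp: functor_comp_def)
    obtain h where h: "Dom A h = X" "Cod A h = Q'" "e' \<cdot>\<^bsub>B\<^esub> Fa L h = k"
      using ex'[OF k(1,2)] by auto
    then show ?thesis using eq[of h] k by auto
  qed
  have 2: "h = h'" if h: "Dom A h = Dom A h'" "Cod A h = Q'" "Cod A h' = Q'"
      "(e \<cdot>\<^bsub>E\<^esub> Fa K e') \<cdot>\<^bsub>E\<^esub> Fa (K \<circ>\<^sub>F L) h = (e \<cdot>\<^bsub>E\<^esub> Fa K e') \<cdot>\<^bsub>E\<^esub> Fa (K \<circ>\<^sub>F L) h'" for h h'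
    using h e' by (intro uniq' uniq) (simp_all add: eq)
  show "\<exists>Q e. Dom E e = Fo (K \<circ>\<^sub>F L) Q \<and> Cod E e = V
      \<and> (\<forall>g X. Dom E g = Fo (K \<circ>\<^sub>F L) X \<longrightarrow> Cod E g = V
          \<longrightarrow> (\<exists>h. Dom A h = X \<and> Cod A h = Q \<and> e \<cdot>\<^bsub>E\<^esub> Fa (K \<circ>\<^sub>F L) h = g))
      \<and> (\<forall>h h'. Dom A h = Dom A h' \<longrightarrow> Cod A h = Q \<longrightarrow> Cod A h' = Q
          \<longrightarrow> e \<cdot>\<^bsub>E\<^esub> Fa (K \<circ>\<^sub>F L) h = e \<cdot>\<^bsub>E\<^esub> Fa (K \<circ>\<^sub>F L) h' \<longrightarrow> h = h')"
    by (intro exI[of _ Q'] exI[of _ "e \<cdot>\<^bsub>E\<^esub> Fa K e'"] conjI allI impI 1 2)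
      (use e e' in \<open>auto simp: functor_comp_def\<close>)
qed

text \<open>
  On arrows out of an object \<open>X\<close>, the mate of \<open>t\<close> on the right adjoints induces the same map as
  composition with \<open>t X\<close>.  Hence it is invertible, being so on generators, and then so is \<open>t\<close>.
\<close>

lemma isom_of_left_adjoints:
  assumes L: "category_functor A B L" "left_adjoint A B L"
    and K: "category_functor A B K" "left_adjoint A B K"
    and t: "natural A B L K t"
    and detect: "\<And>g. (\<forall>X\<in>G. bij_betw (\<lambda>h. g \<cdot>\<^bsub>A\<^esub> h) (Mor A X (Dom A g)) (Mor A X (Cod A g)))
      \<Longrightarrow> isom A g"
    and iso: "\<And>X. X \<in> G \<Longrightarrow> isom B (t X)"
  shows "isom B (t X)"
proof -
  interpret L: category_functor A B L by fact
  interpret K: category_functor A B K by fact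
  have tm [simp]: "Dom B (t X) = Fo L X" "Cod B (t X) = Fo K X" for X
    using t by (auto simp: natural_def L.B.Mor_iff)
  have nat: "t (Cod A f) \<cdot>\<^bsub>B\<^esub> Fa L f = Fa K f \<cdot>\<^bsub>B\<^esub> t (Dom A f)" for f
    using t by (auto simp: natural_def L.A.Mor_iff)
  have main: "\<exists>w. (Dom B w = Fo K X \<and> Cod B w = Cod B v \<and> w \<cdot>\<^bsub>B\<^esub> t X = v)
      \<and> (\<forall>w'. Dom B w' = Fo K X \<longrightarrow> Cod B w' = Cod B v \<longrightarrow> w' \<cdot>\<^bsub>B\<^esub> t X = v \<longrightarrow> w' = w)"
    if v: "Dom B v = Fo L X" for v
  proof -
    obtain Q e where e: "Dom B e = Fo L Q" "Cod B e = Cod B v"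
      and ex: "\<And>g X. Dom B g = Fo L X \<Longrightarrow> Cod B g = Cod B v
        \<Longrightarrow> \<exists>h. Dom A h = X \<and> Cod A h = Q \<and> e \<cdot>\<^bsub>B\<^esub> Fa L h = g"
      and uniq: "\<And>h h'. Dom A h = Dom A h' \<Longrightarrow> Cod A h = Q \<Longrightarrow> Cod A h' = Q
        \<Longrightarrow> e \<cdot>\<^bsub>B\<^esub> Fa L h = e \<cdot>\<^bsub>B\<^esub> Fa L h' \<Longrightarrow> h = h'"
      by (rule left_adjointE[OF L, of "Cod B v"]) (rule that; blast)
    obtain Q' e' where e': "Dom B e' = Fo K Q'" "Cod B e' = Cod B v"
      and ex': "\<And>g X. Dom B g = Fo K X \<Longrightarrow> Cod B g = Cod B v
        \<Longrightarrow> \<exists>h. Dom A h = X \<and> Cod A h = Q' \<and> e' \<cdot>\<^bsub>B\<^esub> Fa K h = g"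
      and uniq': "\<And>h h'. Dom A h = Dom A h' \<Longrightarrow> Cod A h = Q' \<Longrightarrow> Cod A h' = Q'
        \<Longrightarrow> e' \<cdot>\<^bsub>B\<^esub> Fa K h = e' \<cdot>\<^bsub>B\<^esub> Fa K h' \<Longrightarrow> h = h'"
      by (rule left_adjointE[OF K, of "Cod B v"]) (rule that; blast)
    \<comment> \<open>\<open>b\<close> is the component at \<open>Cod B v\<close> of the mate of
      \<open>t\<close>: it runs from the value of the right adjoint of \<open>K\<close> to that of
      the right adjoint of \<open>L\<close>.\<close>
    obtain b where b: "Dom A b = Q'" "Cod A b = Q" "e \<cdot>\<^bsub>B\<^esub> Fa L b = e' \<cdot>\<^bsub>B\<^esub> t Q'"
      using ex[of "e' \<cdot>\<^bsub>B\<^esub> t Q'" Q'] e' by auto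
    have beq: "e \<cdot>\<^bsub>B\<^esub> Fa L (b \<cdot>\<^bsub>A\<^esub> h) = e' \<cdot>\<^bsub>B\<^esub> Fa K h \<cdot>\<^bsub>B\<^esub> t (Dom A h)" if "Cod A h = Q'" for h
    proof -
      have "e \<cdot>\<^bsub>B\<^esub> Fa L (b \<cdot>\<^bsub>A\<^esub> h) = e \<cdot>\<^bsub>B\<^esub> Fa L b \<cdot>\<^bsub>B\<^esub> Fa L h"
        using that b(1,2) e by (simp add: L.F_comp L.B.assoc)
      also have "\<dots> = e' \<cdot>\<^bsub>B\<^esub> (t (Cod A h) \<cdot>\<^bsub>B\<^esub> Fa L h)"
        using that e' by (simp add: b L.B.assoc)
      also have "\<dots> = e' \<cdot>\<^bsub>B\<^esub> (Fa K h \<cdot>\<^bsub>B\<^esub> t (Dom A h))"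
        by (simp only: nat)
      finally show ?thesis using that e' by (simp add: L.B.assoc)
    qed
    have "isom A b"
    proof (rule detect, rule ballI)
      fix X assume X: "X \<in> G"
      note isoX = iso[OF X]
      show "bij_betw (\<lambda>h. b \<cdot>\<^bsub>A\<^esub> h) (Mor A X (Dom A b)) (Mor A X (Cod A b))"
      proof (rule bij_betwI')
        fix h h' assume "h \<in> Mor A X (Dom A b)" "h' \<in> Mor A X (Dom A b)"
        then have h: "Dom A h = X" "Cod A h = Q'" "Dom A h' = X" "Cod A h' = Q'"
          by (auto simp: L.A.Mor_iff b)
        show "(b \<cdot>\<^bsub>A\<^esub> h = b \<cdot>\<^bsub>A\<^esub> h') = (h = h')"
        proof
          assume eq: "b \<cdot>\<^bsub>A\<^esub> h = b \<cdot>\<^bsub>A\<^esub> h'"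
          have "e' \<cdot>\<^bsub>B\<^esub> Fa K h \<cdot>\<^bsub>B\<^esub> t X = e' \<cdot>\<^bsub>B\<^esub> Fa K h' \<cdot>\<^bsub>B\<^esub> t X"
            using beq[of h] beq[of h'] h eq by simp
          then have "e' \<cdot>\<^bsub>B\<^esub> Fa K h = e' \<cdot>\<^bsub>B\<^esub> Fa K h'"
            by (rule L.B.isom_cancel_right[OF isoX]) (simp_all add: h e')
          then show "h = h'" using uniq'[of h h'] h by simp
        qed simp
      next
        fix h assume "h \<in> Mor A X (Dom A b)"
        then show "b \<cdot>\<^bsub>A\<^esub> h \<in> Mor A X (Cod A b)" by (auto simp: L.A.Mor_iff)
      next
        fix k assume "k \<in> Mor A X (Cod A b)"
        then have k: "Dom A k = X" "Cod A k = Q" by (auto simp: L.A.Mor_iff b)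
        \<comment> \<open>Surjectivity at a generator: transpose \<open>k\<close> along
          \<open>L\<close>, divide by \<open>t X\<close>, transpose back along
          \<open>K\<close>.\<close>
        obtain h where h: "Dom A h = X" "Cod A h = Q'"
            "e' \<cdot>\<^bsub>B\<^esub> Fa K h = e \<cdot>\<^bsub>B\<^esub> Fa L k \<cdot>\<^bsub>B\<^esub> inverse_arrow B (t X)"
          using ex'[of "e \<cdot>\<^bsub>B\<^esub> Fa L k \<cdot>\<^bsub>B\<^esub> inverse_arrow B (t X)" X] k isoX e by auto
        have "e \<cdot>\<^bsub>B\<^esub> Fa L (b \<cdot>\<^bsub>A\<^esub> h) = e \<cdot>\<^bsub>B\<^esub> Fa L k"
          using beq[of h] h k isoX e by (simp add: L.B.assoc)
        then have "k = b \<cdot>\<^bsub>A\<^esub> h" using uniq[of "b \<cdot>\<^bsub>A\<^esub> h" k] h k b by simp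
        then show "\<exists>h\<in>Mor A X (Dom A b). k = b \<cdot>\<^bsub>A\<^esub> h" using h b by (auto simp: L.A.Mor_iff)
      qed
    qed
    \<comment> \<open>Here \<open>X\<close> is again the arbitrary object of the claim. The
      factorization of \<open>v\<close> through \<open>t X\<close> is found by transposing
      \<open>v\<close> along \<open>L\<close>, dividing by \<open>b\<close>, and transposing back
      along \<open>K\<close>.\<close>
    obtain k where k: "Dom A k = X" "Cod A k = Q" "e \<cdot>\<^bsub>B\<^esub> Fa L k = v"
      using ex[OF v] by auto
    define h where "h = inverse_arrow A b \<cdot>\<^bsub>A\<^esub> k"
    have h: "Dom A h = X" "Cod A h = Q'" "b \<cdot>\<^bsub>A\<^esub> h = k"
      using \<open>isom A b\<close> k b by (auto simp: h_def)
    show ?thesis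
    proof (intro exI[of _ "e' \<cdot>\<^bsub>B\<^esub> Fa K h"] conjI allI impI)
      show "Dom B (e' \<cdot>\<^bsub>B\<^esub> Fa K h) = Fo K X" "Cod B (e' \<cdot>\<^bsub>B\<^esub> Fa K h) = Cod B v"
        "(e' \<cdot>\<^bsub>B\<^esub> Fa K h) \<cdot>\<^bsub>B\<^esub> t X = v"
        using h e' beq[of h] k by simp_all
      fix w assume w: "Dom B w = Fo K X" "Cod B w = Cod B v" "w \<cdot>\<^bsub>B\<^esub> t X = v"
      then obtain h' where h': "Dom A h' = X" "Cod A h' = Q'" "e' \<cdot>\<^bsub>B\<^esub> Fa K h' = w"
        using ex'[of w X] by auto
      have "e \<cdot>\<^bsub>B\<^esub> Fa L (b \<cdot>\<^bsub>A\<^esub> h') = v" using beq[of h'] h' w by simp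
      then have "b \<cdot>\<^bsub>A\<^esub> h' = b \<cdot>\<^bsub>A\<^esub> h" using uniq[of "b \<cdot>\<^bsub>A\<^esub> h'" k] k h h' b by simp
      then have "h' = h" by (rule L.A.isom_cancel_left[OF \<open>isom A b\<close>]) (simp_all add: h h' b)
      then show "w = e' \<cdot>\<^bsub>B\<^esub> Fa K h" using h' by simp
    qed
  qed
  show ?thesis
  proof (rule L.B.isom_coyoneda)
    fix v w assume vw: "Cod B v = Cod B w" "Dom B v = Cod B (t X)" "Dom B w = Cod B (t X)"
      "v \<cdot>\<^bsub>B\<^esub> t X = w \<cdot>\<^bsub>B\<^esub> t X"
    obtain u where "\<forall>w'. Dom B w' = Fo K X \<longrightarrow> Cod B w' = Cod B w \<longrightarrow> w' \<cdot>\<^bsub>B\<^esub> t X = w \<cdot>\<^bsub>B\<^esub> t X \<longrightarrow> w' = u"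
      using main[of "w \<cdot>\<^bsub>B\<^esub> t X"] vw by auto
    then have "v = u" "w = u" using vw by auto
    then show "v = w" by simp
  next
    fix v assume "Dom B v = Dom B (t X)"
    then show "\<exists>w. Cod B w = Cod B v \<and> Dom B w = Cod B (t X) \<and> w \<cdot>\<^bsub>B\<^esub> t X = v"
      using main[of v] by auto
  qed
qed

section \<open>Coproducts\<close>

context category begin

lemma coproduct_dom [simp]: "is_coproduct C I Y P \<iota> \<Longrightarrow> i \<in> I \<Longrightarrow> Dom C (\<iota> i) = Y i"
  and coproduct_cod [simp]: "is_coproduct C I Y P \<iota> \<Longrightarrow> i \<in> I \<Longrightarrow> Cod C (\<iota> i) = P"
  by (auto simp: is_coproduct_def Mor_iff)

lemma coproduct_extend:
  assumes "is_coproduct C I Y P \<iota>" and "\<And>i. i \<in> I \<Longrightarrow> Dom C (f i) = Y i"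
    and "\<And>i. i \<in> I \<Longrightarrow> Cod C (f i) = Z"
  obtains h where "Dom C h = P" "Cod C h = Z" "\<And>i. i \<in> I \<Longrightarrow> h \<cdot> \<iota> i = f i"
proof -
  have "\<forall>i\<in>I. f i \<in> Mor C (Y i) Z" using assms(2,3) by (simp add: Mor_iff)
  with assms(1) have "\<exists>!h. h \<in> Mor C P Z \<and> (\<forall>i\<in>I. h \<cdot> \<iota> i = f i)"
    unfolding is_coproduct_def by blast
  then show thesis using that unfolding Mor_iff by blast
qed

lemma coproduct_eqI:
  assumes "is_coproduct C I Y P \<iota>" and "Dom C g = P" "Dom C h = P" "Cod C g = Cod C h"
    and eq: "\<And>i. i \<in> I \<Longrightarrow> g \<cdot> \<iota> i = h \<cdot> \<iota> i"
  shows "g = h"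
proof -
  have "\<forall>i\<in>I. h \<cdot> \<iota> i \<in> Mor C (Y i) (Cod C h)"
    using assms by (simp add: Mor_iff)
  with assms(1) have "\<exists>!k. k \<in> Mor C P (Cod C h) \<and> (\<forall>i\<in>I. k \<cdot> \<iota> i = h \<cdot> \<iota> i)"
    unfolding is_coproduct_def by (elim conjE allE[of _ "Cod C h"] allE[of _ "\<lambda>i. h \<cdot> \<iota> i"] impE) simp_all
  moreover have "g \<in> Mor C P (Cod C h)" "h \<in> Mor C P (Cod C h)"
    using assms by (simp_all add: Mor_iff)
  ultimately show ?thesis using eq by blast
qed

lemma coproductI:
  assumes "\<And>i. i \<in> I \<Longrightarrow> Dom C (\<iota> i) = Y i" and "\<And>i. i \<in> I \<Longrightarrow> Cod C (\<iota> i) = P"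
    and "\<And>Z f. (\<And>i. i \<in> I \<Longrightarrow> Dom C (f i) = Y i) \<Longrightarrow> (\<And>i. i \<in> I \<Longrightarrow> Cod C (f i) = Z)
      \<Longrightarrow> \<exists>h. Dom C h = P \<and> Cod C h = Z \<and> (\<forall>i\<in>I. h \<cdot> \<iota> i = f i)"
    and uniq: "\<And>g h. Dom C g = P \<Longrightarrow> Dom C h = P \<Longrightarrow> Cod C g = Cod C h
      \<Longrightarrow> (\<And>i. i \<in> I \<Longrightarrow> g \<cdot> \<iota> i = h \<cdot> \<iota> i) \<Longrightarrow> g = h"
  shows "is_coproduct C I Y P \<iota>"
  unfolding is_coproduct_def
proof (intro conjI ballI allI impI)
  show "\<iota> i \<in> Mor C (Y i) P" if "i \<in> I" for i using assms that by (simp add: Mor_iff)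
  fix Z f assume "\<forall>i\<in>I. f i \<in> Mor C (Y i) Z"
  then obtain h where h: "Dom C h = P" "Cod C h = Z" "\<forall>i\<in>I. h \<cdot> \<iota> i = f i"
    using assms(3)[of f Z] by (auto simp: Mor_iff)
  show "\<exists>!h. h \<in> Mor C P Z \<and> (\<forall>i\<in>I. h \<cdot> \<iota> i = f i)"
  proof (rule ex1I)
    show "h \<in> Mor C P Z \<and> (\<forall>i\<in>I. h \<cdot> \<iota> i = f i)" using h by (simp add: Mor_iff)
    fix g assume "g \<in> Mor C P Z \<and> (\<forall>i\<in>I. g \<cdot> \<iota> i = f i)"
    then have g: "Dom C g = P" "Cod C g = Z" "\<forall>i\<in>I. g \<cdot> \<iota> i = f i" by (simp_all add: Mor_iff)
    show "g = h" by (rule uniq) (use g h in simp_all)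
  qed
qed

lemma coproduct_reindex:
  assumes k: "bij_betw k J I" and P: "is_coproduct C I Y P \<iota>"
  shows "is_coproduct C J (\<lambda>j. Y (k j)) P (\<lambda>j. \<iota> (k j))"
proof (rule coproductI)
  have kI: "k j \<in> I" if "j \<in> J" for j using k that by (auto simp: bij_betw_def)
  define l where "l = inv_into J k"
  have l: "l i \<in> J" "k (l i) = i" if "i \<in> I" for i
    using k that by (auto simp: l_def bij_betw_def inv_into_into f_inv_into_f)
  have lk: "l (k j) = j" if "j \<in> J" for j
    using k that by (auto simp: l_def bij_betw_def)
  show "Dom C (\<iota> (k j)) = Y (k j)" "Cod C (\<iota> (k j)) = P" if "j \<in> J" for j
    using that kI P by simp_all
  show "\<exists>h. Dom C h = P \<and> Cod C h = Z \<and> (\<forall>i\<in>J. h \<cdot> \<iota> (k i) = f i)"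
    if f: "\<And>i. i \<in> J \<Longrightarrow> Dom C (f i) = Y (k i)" "\<And>i. i \<in> J \<Longrightarrow> Cod C (f i) = Z" for f Z
  proof -
    obtain h where "Dom C h = P" "Cod C h = Z" "\<And>i. i \<in> I \<Longrightarrow> h \<cdot> \<iota> i = f (l i)"
      by (rule coproduct_extend[OF P, of "\<lambda>i. f (l i)" Z]) (use f l in auto)
    then show ?thesis using kI lk by auto
  qed
  show "g = h" if gh: "Dom C g = P" "Dom C h = P" "Cod C g = Cod C h"
      "\<And>i. i \<in> J \<Longrightarrow> g \<cdot> \<iota> (k i) = h \<cdot> \<iota> (k i)" for g h
  proof (rule coproduct_eqI[OF P gh(1-3)])
    fix i assume "i \<in> I"
    then show "g \<cdot> \<iota> i = h \<cdot> \<iota> i" using gh(4)[of "l i"] l[of i] by simp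
  qed
qed

text \<open>\<open>has_coproducts\<close> speaks only of index sets inside \<open>U\<close>. Sets of
  arrows and the natural numbers merely inject into \<open>U\<close>, so the coproduct is formed
  over the image and reindexed.\<close>

lemma coproduct_exists:
  assumes "has_coproducts U C" "J \<prec> U"
  obtains P \<iota> where "is_coproduct C J Y P \<iota>"
proof -
  obtain k where k: "inj_on k J" "k ` J \<subseteq> U"
    using lesspoll_imp_lepoll[OF assms(2)] by (auto simp: lepoll_def)
  then have "bij_betw k J (k ` J)" by (auto simp: bij_betw_def)
  moreover have "k ` J \<prec> U"
    using lesspoll_trans1[OF image_lepoll assms(2)] .
  then obtain P \<iota> where "is_coproduct C (k ` J) (\<lambda>i. Y (inv_into J k i)) P \<iota>"
    using assms(1) k unfolding has_coproducts_def by blast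
  ultimately have "is_coproduct C J (\<lambda>j. Y (inv_into J k (k j))) P (\<lambda>j. \<iota> (k j))"
    by (rule coproduct_reindex)
  then have "is_coproduct C J Y P (\<lambda>j. \<iota> (k j))"
    using k by (simp add: is_coproduct_def)
  then show thesis by (rule that)
qed

end

text \<open>A family out of the \<open>Fo L (Y i)\<close> transposes to a family out of the
  \<open>Y i\<close> with a common target \<open>Q\<close>; it is extended over \<open>P\<close>
  there and transposed back.\<close>

lemma left_adjoint_coproduct:
  assumes L: "category_functor A B L" "left_adjoint A B L" and P: "is_coproduct A I Y P \<iota>"
  shows "is_coproduct B I (\<lambda>i. Fo L (Y i)) (Fo L P) (\<lambda>i. Fa L (\<iota> i))"
proof -
  interpret L: category_functor A B L by fact
  show ?thesis
  proof (rule L.B.coproductI)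
    show "Dom B (Fa L (\<iota> i)) = Fo L (Y i)" "Cod B (Fa L (\<iota> i)) = Fo L P" if "i \<in> I" for i
      using that P by simp_all
    show "\<exists>h. Dom B h = Fo L P \<and> Cod B h = Z \<and> (\<forall>i\<in>I. h \<cdot>\<^bsub>B\<^esub> Fa L (\<iota> i) = f i)"
      if f: "\<And>i. i \<in> I \<Longrightarrow> Dom B (f i) = Fo L (Y i)" "\<And>i. i \<in> I \<Longrightarrow> Cod B (f i) = Z" for f Z
    proof -
      obtain Q e where e: "Dom B e = Fo L Q" "Cod B e = Z"
        and ex: "\<And>g X. Dom B g = Fo L X \<Longrightarrow> Cod B g = Z
          \<Longrightarrow> \<exists>h. Dom A h = X \<and> Cod A h = Q \<and> e \<cdot>\<^bsub>B\<^esub> Fa L h = g"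
        by (rule left_adjointE[OF L, of Z]) (rule that; blast)
      have "\<forall>i. \<exists>h. i \<in> I \<longrightarrow> Dom A h = Y i \<and> Cod A h = Q \<and> e \<cdot>\<^bsub>B\<^esub> Fa L h = f i"
        using ex f by blast
      then obtain k where k: "\<And>i. i \<in> I \<Longrightarrow> Dom A (k i) = Y i" "\<And>i. i \<in> I \<Longrightarrow> Cod A (k i) = Q"
          "\<And>i. i \<in> I \<Longrightarrow> e \<cdot>\<^bsub>B\<^esub> Fa L (k i) = f i"
        by metis
      obtain h where h: "Dom A h = P" "Cod A h = Q" "\<And>i. i \<in> I \<Longrightarrow> h \<cdot>\<^bsub>A\<^esub> \<iota> i = k i"
        by (rule L.A.coproduct_extend[OF P, of k Q]) (use k in auto)
      have "e \<cdot>\<^bsub>B\<^esub> Fa L h \<cdot>\<^bsub>B\<^esub> Fa L (\<iota> i) = f i" if i: "i \<in> I" for i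
      proof -
        have "e \<cdot>\<^bsub>B\<^esub> Fa L h \<cdot>\<^bsub>B\<^esub> Fa L (\<iota> i) = e \<cdot>\<^bsub>B\<^esub> Fa L (h \<cdot>\<^bsub>A\<^esub> \<iota> i)"
          using i h(1,2) e P by (simp add: L.F_comp L.B.assoc)
        then show ?thesis using i h k by simp
      qed
      then show ?thesis using e h by (intro exI[of _ "e \<cdot>\<^bsub>B\<^esub> Fa L h"]) simp
    qed
    show "g = h" if gh: "Dom B g = Fo L P" "Dom B h = Fo L P" "Cod B g = Cod B h"
      "\<And>i. i \<in> I \<Longrightarrow> g \<cdot>\<^bsub>B\<^esub> Fa L (\<iota> i) = h \<cdot>\<^bsub>B\<^esub> Fa L (\<iota> i)" for g h
    proof -
      obtain Q e where e: "Dom B e = Fo L Q" "Cod B e = Cod B h"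
        and ex: "\<And>g X. Dom B g = Fo L X \<Longrightarrow> Cod B g = Cod B h
          \<Longrightarrow> \<exists>h. Dom A h = X \<and> Cod A h = Q \<and> e \<cdot>\<^bsub>B\<^esub> Fa L h = g"
        and uniq: "\<And>h h'. Dom A h = Dom A h' \<Longrightarrow> Cod A h = Q \<Longrightarrow> Cod A h' = Q
          \<Longrightarrow> e \<cdot>\<^bsub>B\<^esub> Fa L h = e \<cdot>\<^bsub>B\<^esub> Fa L h' \<Longrightarrow> h = h'"
        by (rule left_adjointE[OF L, of "Cod B h"]) (rule that; blast)
      obtain g' where g': "Dom A g' = P" "Cod A g' = Q" "e \<cdot>\<^bsub>B\<^esub> Fa L g' = g" using ex[OF gh(1,3)] by blast
      obtain h' where h': "Dom A h' = P" "Cod A h' = Q" "e \<cdot>\<^bsub>B\<^esub> Fa L h' = h" using ex[OF gh(2)] by blast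
      have eq: "e \<cdot>\<^bsub>B\<^esub> Fa L (k \<cdot>\<^bsub>A\<^esub> \<iota> i) = e \<cdot>\<^bsub>B\<^esub> Fa L k \<cdot>\<^bsub>B\<^esub> Fa L (\<iota> i)"
        if "Dom A k = P" "Cod A k = Q" "i \<in> I" for k i
        using that e P by (simp add: L.F_comp L.B.assoc)
      have "g' = h'"
      proof (rule L.A.coproduct_eqI[OF P g'(1) h'(1)])
        fix i assume i: "i \<in> I"
        show "g' \<cdot>\<^bsub>A\<^esub> \<iota> i = h' \<cdot>\<^bsub>A\<^esub> \<iota> i"
        proof (rule uniq)
          show "e \<cdot>\<^bsub>B\<^esub> Fa L (g' \<cdot>\<^bsub>A\<^esub> \<iota> i) = e \<cdot>\<^bsub>B\<^esub> Fa L (h' \<cdot>\<^bsub>A\<^esub> \<iota> i)"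
            unfolding eq[OF g'(1,2) i] eq[OF h'(1,2) i] g'(3) h'(3) by (rule gh(4)[OF i])
        qed (use g'(1,2) h'(1,2) i P in simp_all)
      qed (use g' h' in simp)
      then show "g = h" using g'(3) h'(3) by simp
    qed
  qed
qed

section \<open>Additive categories\<close>

definition Sub :: "('o, 'm, 'z) acat_scheme \<Rightarrow> 'm \<Rightarrow> 'm \<Rightarrow> 'm" where
  "Sub C f g = f \<^bold>+\<^bsub>C\<^esub> Neg C g"

text \<open>Says that \<open>x\<close> behaves as if it factored through the sub-sum over
  \<open>F\<close>. Testing against arrows out of \<open>P\<close> avoids choosing that sub-sum and
  its projections, and makes enlarging \<open>F\<close> harmless.\<close>

definition supports :: "('o, 'm, 'z) acat_scheme \<Rightarrow> 'u set \<Rightarrow> 'o \<Rightarrow> ('u \<Rightarrow> 'm) \<Rightarrow> 'm \<Rightarrow> bool" where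
  "supports C F P \<iota> x \<longleftrightarrow> (\<forall>u. Dom C u = P \<longrightarrow> (\<forall>i\<in>F. u \<cdot>\<^bsub>C\<^esub> \<iota> i = Zer C (Dom C (\<iota> i)) (Cod C u))
     \<longrightarrow> u \<cdot>\<^bsub>C\<^esub> x = Zer C (Dom C x) (Cod C u))"

definition finite_support :: "('o, 'm, 'z) acat_scheme \<Rightarrow> 'u set \<Rightarrow> 'o \<Rightarrow> ('u \<Rightarrow> 'm) \<Rightarrow> 'm \<Rightarrow> bool" where
  "finite_support C I P \<iota> x \<longleftrightarrow> (\<exists>F. finite F \<and> F \<subseteq> I \<and> supports C F P \<iota> x)"

text \<open>
  Equivalent to compactness in an additive category: the comparison map out of the direct sum is
  always injective, because coproducts have projections.
\<close>

definition small_object :: "'u set \<Rightarrow> ('o, 'm, 'z) acat_scheme \<Rightarrow> 'o \<Rightarrow> bool" where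
  "small_object U C K \<longleftrightarrow> (\<forall>I Y P \<iota>. I \<subseteq> U \<longrightarrow> I \<prec> U \<longrightarrow> is_coproduct C I Y P \<iota> \<longrightarrow>
     (\<forall>x. Dom C x = K \<longrightarrow> Cod C x = P \<longrightarrow> finite_support C I P \<iota> x))"

context additive_category begin

lemma homgrp_simps [simp]: "carrier (homgrp C X Y) = Mor C X Y" "monoid.mult (homgrp C X Y) = Add C"
    "one (homgrp C X Y) = Zer C X Y"
  by (simp_all add: homgrp_def)

lemma dom_zero [simp]: "Dom C (Zer C X Y) = X" and cod_zero [simp]: "Cod C (Zer C X Y) = Y"
  using comm_groupE(2)[OF hom_comm_group[of X Y]] by (auto simp: Mor_iff)

lemma
  assumes "Dom C f = Dom C g" "Cod C f = Cod C g"
  shows dom_add [simp]: "Dom C (f \<^bold>+ g) = Dom C g" and cod_add [simp]: "Cod C (f \<^bold>+ g) = Cod C g"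
  using comm_groupE(1)[OF hom_comm_group[of "Dom C g" "Cod C g"], of f g] assms by (auto simp: Mor_iff)

lemma dom_neg [simp]: "Dom C (Neg C f) = Dom C f" and cod_neg [simp]: "Cod C (Neg C f) = Cod C f"
  using group.inv_closed[OF comm_group.axioms(2)[OF hom_comm_group[of "Dom C f" "Cod C f"]], of f]
  by (auto simp: Mor_iff Neg_def)

lemma add_assoc:
  assumes "Dom C f = Dom C h" "Cod C f = Cod C h" "Dom C g = Dom C h" "Cod C g = Cod C h"
  shows "f \<^bold>+ g \<^bold>+ h = f \<^bold>+ (g \<^bold>+ h)"
  using comm_groupE(3)[OF hom_comm_group[of "Dom C h" "Cod C h"], of f g h] assms by (auto simp: Mor_iff)

lemma add_commute:
  assumes "Dom C f = Dom C g" "Cod C f = Cod C g"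
  shows "f \<^bold>+ g = g \<^bold>+ f"
  using comm_groupE(4)[OF hom_comm_group[of "Dom C g" "Cod C g"], of f g] assms by (auto simp: Mor_iff)

lemma zero_add [simp]: "Dom C f = X \<Longrightarrow> Cod C f = Y \<Longrightarrow> Zer C X Y \<^bold>+ f = f"
  using comm_groupE(5)[OF hom_comm_group[of X Y], of f] by (auto simp: Mor_iff)

lemma add_zero [simp]: "Dom C f = X \<Longrightarrow> Cod C f = Y \<Longrightarrow> f \<^bold>+ Zer C X Y = f"
  using add_commute[of f "Zer C X Y"] by simp

lemma add_neg [simp]: "f \<^bold>+ Neg C f = Zer C (Dom C f) (Cod C f)"
  using group.r_inv[OF comm_group.axioms(2)[OF hom_comm_group[of "Dom C f" "Cod C f"]], of f]
  by (auto simp: Mor_iff Neg_def)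

lemma neg_add [simp]: "Neg C f \<^bold>+ f = Zer C (Dom C f) (Cod C f)"
  using add_commute[of "Neg C f" f] by simp

lemma comp_distrib_add:
  "Dom C f = Dom C g \<Longrightarrow> Cod C f = Cod C g \<Longrightarrow> Dom C h = Cod C g \<Longrightarrow> h \<cdot> (f \<^bold>+ g) = h \<cdot> f \<^bold>+ h \<cdot> g"
  by (rule comp_add) (auto simp: Mor_iff)

lemma add_distrib_comp:
  "Dom C f = Dom C g \<Longrightarrow> Cod C f = Cod C g \<Longrightarrow> Cod C h = Dom C g \<Longrightarrow> (f \<^bold>+ g) \<cdot> h = f \<cdot> h \<^bold>+ g \<cdot> h"
  by (rule add_comp) (auto simp: Mor_iff)

lemma add_self_eq_zero:
  assumes "f \<^bold>+ f = f" shows "f = Zer C (Dom C f) (Cod C f)"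
proof -
  have "f = f \<^bold>+ (f \<^bold>+ Neg C f)" by simp
  also have "\<dots> = f \<^bold>+ f \<^bold>+ Neg C f" by (subst add_assoc) auto
  also have "\<dots> = Zer C (Dom C f) (Cod C f)" by (simp add: assms)
  finally show ?thesis .
qed

lemma comp_zero [simp]: "Dom C g = Y \<Longrightarrow> g \<cdot> Zer C X Y = Zer C X (Cod C g)"
  using add_self_eq_zero[of "g \<cdot> Zer C X Y"] comp_distrib_add[of "Zer C X Y" "Zer C X Y" g] by simp

lemma zero_comp [simp]: "Cod C f = Y \<Longrightarrow> Zer C Y Z \<cdot> f = Zer C (Dom C f) Z"
  using add_self_eq_zero[of "Zer C Y Z \<cdot> f"] add_distrib_comp[of "Zer C Y Z" "Zer C Y Z" f] by simp

lemma neg_unique: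
  assumes "Dom C f = Dom C g" "Cod C f = Cod C g" "f \<^bold>+ g = Zer C (Dom C g) (Cod C g)"
  shows "f = Neg C g"
proof -
  have "f = f \<^bold>+ (g \<^bold>+ Neg C g)" using assms(1,2) by simp
  also have "\<dots> = f \<^bold>+ g \<^bold>+ Neg C g" using assms(1,2) by (subst add_assoc) auto
  also have "\<dots> = Neg C g" unfolding assms(3) by simp
  finally show ?thesis .
qed

lemma neg_neg [simp]: "Neg C (Neg C f) = f"
  using neg_unique[of f "Neg C f"] by simp

lemma neg_zero [simp]: "Neg C (Zer C X Y) = Zer C X Y"
  using neg_unique[of "Zer C X Y" "Zer C X Y"] by simp

lemma comp_neg: "Dom C g = Cod C f \<Longrightarrow> g \<cdot> Neg C f = Neg C (g \<cdot> f)"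
  by (rule neg_unique) (simp_all flip: comp_distrib_add)

lemma neg_comp: "Dom C g = Cod C f \<Longrightarrow> Neg C g \<cdot> f = Neg C (g \<cdot> f)"
  by (rule neg_unique) (simp_all flip: add_distrib_comp)

lemma
  assumes "Dom C f = Dom C g" "Cod C f = Cod C g"
  shows dom_sub [simp]: "Dom C (Sub C f g) = Dom C g" and cod_sub [simp]: "Cod C (Sub C f g) = Cod C g"
  using assms by (simp_all add: Sub_def)

lemma sub_self [simp]: "Sub C f f = Zer C (Dom C f) (Cod C f)"
  by (simp add: Sub_def)

lemma sub_zero [simp]: "Dom C f = X \<Longrightarrow> Cod C f = Y \<Longrightarrow> Sub C f (Zer C X Y) = f"
  by (simp add: Sub_def)

lemma sub_add_cancel:
  "Dom C f = Dom C g \<Longrightarrow> Cod C f = Cod C g \<Longrightarrow> Sub C f g \<^bold>+ g = f"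
  by (simp add: Sub_def add_assoc)

lemma sub_eq_zeroD:
  assumes "Dom C f = Dom C g" "Cod C f = Cod C g" "Sub C f g = Zer C (Dom C g) (Cod C g)"
  shows "f = g"
  using sub_add_cancel[OF assms(1,2)] unfolding assms(3) by simp

lemma comp_sub:
  "Dom C f = Dom C g \<Longrightarrow> Cod C f = Cod C g \<Longrightarrow> Dom C h = Cod C g \<Longrightarrow> h \<cdot> Sub C f g = Sub C (h \<cdot> f) (h \<cdot> g)"
  by (simp add: Sub_def comp_distrib_add comp_neg)

lemma sub_comp:
  "Dom C f = Dom C g \<Longrightarrow> Cod C f = Cod C g \<Longrightarrow> Cod C h = Dom C g \<Longrightarrow> Sub C f g \<cdot> h = Sub C (f \<cdot> h) (g \<cdot> h)"
  by (simp add: Sub_def add_distrib_comp neg_comp)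

lemma zero_object_iff: "zero_object C Z \<longleftrightarrow> Idt C Z = Zer C Z Z"
proof
  assume "zero_object C Z"
  then have "\<exists>!f. f \<in> Mor C Z Z" by (simp add: zero_object_def)
  moreover have "Idt C Z \<in> Mor C Z Z" "Zer C Z Z \<in> Mor C Z Z" by (simp_all add: Mor_iff)
  ultimately show "Idt C Z = Zer C Z Z" by blast
next
  assume Z: "Idt C Z = Zer C Z Z"
  have "f = Zer C Z X" if "Dom C f = Z" "Cod C f = X" for f X
  proof -
    have "f = f \<cdot> Idt C Z" using that by simp
    then show ?thesis unfolding Z using that by simp
  qed
  moreover have "f = Zer C X Z" if "Dom C f = X" "Cod C f = Z" for f X
  proof -
    have "f = Idt C Z \<cdot> f" using that by simp
    then show ?thesis unfolding Z using that by simp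
  qed
  ultimately show "zero_object C Z"
    unfolding zero_object_def Mor_iff by (metis dom_zero cod_zero)
qed

lemma isom_yoneda_additive:
  assumes inj: "\<And>v. Cod C v = Dom C f \<Longrightarrow> f \<cdot> v = Zer C (Dom C v) (Cod C f) \<Longrightarrow> v = Zer C (Dom C v) (Dom C f)"
    and surj: "\<And>v. Cod C v = Cod C f \<Longrightarrow> \<exists>w. Dom C w = Dom C v \<and> Cod C w = Dom C f \<and> f \<cdot> w = v"
  shows "isom C f"
proof (rule isom_yoneda)
  fix v w assume vw: "Dom C v = Dom C w" "Cod C v = Dom C f" "Cod C w = Dom C f" and eq: "f \<cdot> v = f \<cdot> w"
  have "f \<cdot> Sub C v w = Sub C (f \<cdot> w) (f \<cdot> w)" using vw by (simp add: comp_sub eq)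
  then have "Sub C v w = Zer C (Dom C w) (Dom C f)" using vw inj[of "Sub C v w"] by simp
  then show "v = w" using vw sub_eq_zeroD[of v w] by simp
qed (rule surj)

lemma coproduct_projection:
  assumes P: "is_coproduct C I Y P \<iota>" and i: "i \<in> I"
  obtains p where "Dom C p = P" "Cod C p = Y i" "p \<cdot> \<iota> i = Idt C (Y i)"
    "\<And>j. j \<in> I \<Longrightarrow> j \<noteq> i \<Longrightarrow> p \<cdot> \<iota> j = Zer C (Y j) (Y i)"
proof -
  obtain p where p: "Dom C p = P" "Cod C p = Y i"
      "\<And>j. j \<in> I \<Longrightarrow> p \<cdot> \<iota> j = (if j = i then Idt C (Y i) else Zer C (Y j) (Y i))"
    by (rule coproduct_extend[OF P, of "\<lambda>j. if j = i then Idt C (Y i) else Zer C (Y j) (Y i)" "Y i"]) auto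
  then show thesis using that[of p] i by simp
qed

section \<open>Arrows supported on finitely many summands\<close>

lemma supports_eq:
  assumes x: "supports C F P \<iota> x" "Cod C x = P" and F: "\<And>i. i \<in> F \<Longrightarrow> Cod C (\<iota> i) = P"
    and uv: "Dom C u = P" "Dom C v = P" "Cod C u = Cod C v" "\<And>i. i \<in> F \<Longrightarrow> u \<cdot> \<iota> i = v \<cdot> \<iota> i"
  shows "u \<cdot> x = v \<cdot> x"
proof (rule sub_eq_zeroD)
  have "Sub C u v \<cdot> \<iota> i = Zer C (Dom C (\<iota> i)) (Cod C (Sub C u v))" if "i \<in> F" for i
    using uv(1-3) F[OF that] by (simp add: sub_comp uv(4)[OF that])
  then have "Sub C u v \<cdot> x = Zer C (Dom C x) (Cod C (Sub C u v))"
    using x(1) uv unfolding supports_def by simp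
  then show "Sub C (u \<cdot> x) (v \<cdot> x) = Zer C (Dom C (v \<cdot> x)) (Cod C (v \<cdot> x))"
    using uv(1-3) x(2) by (simp add: sub_comp)
qed (use uv x in simp_all)

text \<open>\<open>e\<close> is the idempotent that cuts \<open>P\<close> down to the summands
  indexed by \<open>F\<close>.\<close>

lemma partial_identity:
  assumes P: "is_coproduct C I Y P \<iota>"
  obtains e where "Dom C e = P" "Cod C e = P" "\<And>i. i \<in> F \<Longrightarrow> i \<in> I \<Longrightarrow> e \<cdot> \<iota> i = \<iota> i"
    "\<And>i. i \<in> I \<Longrightarrow> i \<notin> F \<Longrightarrow> e \<cdot> \<iota> i = Zer C (Y i) P"
proof -
  obtain e where e: "Dom C e = P" "Cod C e = P"
      "\<And>i. i \<in> I \<Longrightarrow> e \<cdot> \<iota> i = (if i \<in> F then \<iota> i else Zer C (Y i) P)"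
    by (rule coproduct_extend[OF P, of "\<lambda>i. if i \<in> F then \<iota> i else Zer C (Y i) P" P]) (use P in auto)
  then show thesis using that[of e] by simp
qed

lemma supports_partial_identity:
  assumes P: "is_coproduct C I Y P \<iota>" and F: "F \<subseteq> I" "supports C F P \<iota> x" and x: "Cod C x = P"
    and e: "Dom C e = P" "Cod C e = P" "\<And>i. i \<in> F \<Longrightarrow> e \<cdot> \<iota> i = \<iota> i"
  shows "e \<cdot> x = x"
proof -
  have "e \<cdot> x = Idt C P \<cdot> x"
    by (rule supports_eq[OF F(2) x]) (use P F(1) e in auto)
  then show ?thesis using x by simp
qed

text \<open>A finitely supported \<open>x\<close> is the sum of its components
  \<open>\<iota> i p x\<close> over the support, so a property that holds at zero and is stable
  under addition need only be checked on single components.\<close>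

lemma finite_support_induct:
  assumes P: "is_coproduct C I Y P \<iota>" and fs: "finite_support C I P \<iota> x" and x: "Cod C x = P"
    and zero: "Q (Zer C (Dom C x) P)"
    and add: "\<And>a b. Dom C a = Dom C x \<Longrightarrow> Cod C a = P \<Longrightarrow> Dom C b = Dom C x \<Longrightarrow> Cod C b = P
      \<Longrightarrow> Q a \<Longrightarrow> Q b \<Longrightarrow> Q (a \<^bold>+ b)"
    and single: "\<And>i p. i \<in> I \<Longrightarrow> Dom C p = P \<Longrightarrow> Cod C p = Y i \<Longrightarrow> p \<cdot> \<iota> i = Idt C (Y i)
      \<Longrightarrow> (\<And>j. j \<in> I \<Longrightarrow> j \<noteq> i \<Longrightarrow> p \<cdot> \<iota> j = Zer C (Y j) (Y i)) \<Longrightarrow> Q (\<iota> i \<cdot> (p \<cdot> x))"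
  shows "Q x"
proof -
  obtain F where F: "finite F" "F \<subseteq> I" "supports C F P \<iota> x"
    using fs by (auto simp: finite_support_def)
  \<comment> \<open>Induction on \<open>E\<close> builds the partial identity \<open>e\<close> of
    \<open>E\<close> together with the property for \<open>e x\<close>; for \<open>E = F\<close> it
    fixes \<open>x\<close>.\<close>
  have "\<exists>e. Dom C e = P \<and> Cod C e = P \<and> (\<forall>i\<in>E. e \<cdot> \<iota> i = \<iota> i)
      \<and> (\<forall>i\<in>I - E. e \<cdot> \<iota> i = Zer C (Y i) P) \<and> Q (e \<cdot> x)" if "E \<subseteq> I" "finite E" for E
    using that(2,1)
  proof (induction E)
    case empty
    show ?case using zero x P by (intro exI[of _ "Zer C P P"]) simp
  next
    case (insert i E)
    then obtain e where e: "Dom C e = P" "Cod C e = P" "\<And>j. j \<in> E \<Longrightarrow> e \<cdot> \<iota> j = \<iota> j"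
        "\<And>j. j \<in> I - E \<Longrightarrow> e \<cdot> \<iota> j = Zer C (Y j) P" "Q (e \<cdot> x)"
      by auto
    have i: "i \<in> I" using insert by simp
    obtain p where p: "Dom C p = P" "Cod C p = Y i" "p \<cdot> \<iota> i = Idt C (Y i)"
        "\<And>j. j \<in> I \<Longrightarrow> j \<noteq> i \<Longrightarrow> p \<cdot> \<iota> j = Zer C (Y j) (Y i)"
      using coproduct_projection[OF P i] by blast
    have \<iota> [simp]: "\<And>j. j \<in> I \<Longrightarrow> Dom C (\<iota> j) = Y j" "\<And>j. j \<in> I \<Longrightarrow> Cod C (\<iota> j) = P"
      using P by simp_all
    define e' where "e' = e \<^bold>+ \<iota> i \<cdot> p"
    have e': "Dom C e' = P" "Cod C e' = P" using e p i by (simp_all add: e'_def)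
    have comp: "e' \<cdot> \<iota> j = e \<cdot> \<iota> j \<^bold>+ \<iota> i \<cdot> (p \<cdot> \<iota> j)" if "j \<in> I" for j
      using that e(1,2) p(1,2) i by (simp add: e'_def add_distrib_comp assoc)
    have "e' \<cdot> \<iota> j = \<iota> j" if "j \<in> insert i E" for j
    proof (cases "j = i")
      case True
      then show ?thesis using comp[of j] i p(3) e(4)[of j] insert.hyps by simp
    next
      case False
      then show ?thesis using comp[of j] i p(4)[of j] e(3)[of j] that insert.prems by auto
    qed
    moreover have "e' \<cdot> \<iota> j = Zer C (Y j) P" if "j \<in> I - insert i E" for j
      using comp[of j] that e(4)[of j] p(4)[of j] i by simp
    moreover have "e' \<cdot> x = e \<cdot> x \<^bold>+ \<iota> i \<cdot> (p \<cdot> x)"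
      using e(1,2) p(1,2) i x by (simp add: e'_def add_distrib_comp assoc)
    then have "Q (e' \<cdot> x)"
      using add[of "e \<cdot> x" "\<iota> i \<cdot> (p \<cdot> x)"] e(1,2,5) p(1,2) single[OF i p] i x by simp
    ultimately show ?case using e' by (intro exI[of _ e']) simp
  qed
  from this[OF F(2,1)] obtain e where "Dom C e = P" "Cod C e = P" "\<And>i. i \<in> F \<Longrightarrow> e \<cdot> \<iota> i = \<iota> i" "Q (e \<cdot> x)"
    by auto
  then show ?thesis using supports_partial_identity[OF P F(2,3) x, of e] by simp
qed

lemma small_object_finite_support:
  assumes K: "small_object U C K" and J: "J \<prec> U" and P: "is_coproduct C J Y P \<iota>"
    and x: "Dom C x = K" "Cod C x = P"
  shows "finite_support C J P \<iota> x"
proof -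
  obtain k where k: "inj_on k J" "k ` J \<subseteq> U"
    using lesspoll_imp_lepoll[OF J] by (auto simp: lepoll_def)
  then have bij: "bij_betw (inv_into J k) (k ` J) J"
    by (intro bij_betw_inv_into) (simp add: bij_betw_def)
  moreover have "k ` J \<prec> U"
    using lesspoll_trans1[OF image_lepoll J] .
  ultimately have "finite_support C (k ` J) P (\<lambda>i. \<iota> (inv_into J k i)) x"
    using K x k coproduct_reindex[OF bij P] unfolding small_object_def by blast
  then obtain F where F: "finite F" "F \<subseteq> k ` J" "supports C F P (\<lambda>i. \<iota> (inv_into J k i)) x"
    by (auto simp: finite_support_def)
  then have "supports C (inv_into J k ` F) P \<iota> x" "inv_into J k ` F \<subseteq> J"
    using k by (auto simp: supports_def inv_into_into)
  then show ?thesis using F(1) unfolding finite_support_def by blast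
qed

lemma comp_finprod_zero:
  assumes u: "Dom C u = P" and f: "\<And>i. i \<in> F \<Longrightarrow> f i \<in> Mor C X P" "\<And>i. i \<in> F \<Longrightarrow> u \<cdot> f i = Zer C X (Cod C u)"
  shows "u \<cdot> finprod (homgrp C X P) f F = Zer C X (Cod C u)"
proof -
  interpret H: comm_group "homgrp C X P" by (rule hom_comm_group)
  show ?thesis
  proof (cases "finite F")
    case True
    then show ?thesis using f
    proof (induction F)
      case empty
      then show ?case using u by simp
    next
      case (insert i F)
      have "finprod (homgrp C X P) f F \<in> Mor C X P"
        using insert H.finprod_closed[of f F] by auto
      then show ?case
        using insert u by (auto simp: Mor_iff comp_distrib_add)
    qed
  \<comment> \<open>\<open>finprod\<close> over an infinite index set is the neutral element, here
    the zero arrow.\<close>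
  qed (use u in \<open>simp add: finprod_def\<close>)
qed

text \<open>Surjectivity of the comparison map out of the direct sum writes \<open>x\<close> as a
  sum of arrows \<open>\<iota> i y i\<close>, and the nonzero terms index a support.\<close>

lemma compact_object_small_object:
  assumes "compact_object U C K" shows "small_object U C K"
  unfolding small_object_def
proof (intro allI impI)
  fix I Y P \<iota> x
  assume IU: "I \<subseteq> U" "I \<prec> U" and P: "is_coproduct C I Y P \<iota>" and x: "Dom C x = K" "Cod C x = P"
  interpret H: comm_group "homgrp C K P" by (rule hom_comm_group)
  have "(\<lambda>x. gfinprod (homgrp C K P) (\<lambda>i. \<iota> i \<cdot> x i) I)
          \<in> iso (sum_group I (\<lambda>i. homgrp C K (Y i))) (homgrp C K P)"
    using assms IU P unfolding compact_object_def by blast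
  then have "x \<in> (\<lambda>x. gfinprod (homgrp C K P) (\<lambda>i. \<iota> i \<cdot> x i) I) ` carrier (sum_group I (\<lambda>i. homgrp C K (Y i)))"
    using x by (auto simp: iso_def bij_betw_def Mor_iff)
  then obtain y where "y \<in> carrier (sum_group I (\<lambda>i. homgrp C K (Y i)))"
      and xy: "x = gfinprod (homgrp C K P) (\<lambda>i. \<iota> i \<cdot> y i) I"
    by auto
  then have y: "\<And>i. i \<in> I \<Longrightarrow> Dom C (y i) = K" "\<And>i. i \<in> I \<Longrightarrow> Cod C (y i) = Y i"
    using comm_group.axioms(2)[OF hom_comm_group] by (auto simp: carrier_sum_group Mor_iff)
  define F where "F = {i \<in> I. \<iota> i \<cdot> y i \<noteq> Zer C K P}"
  show "finite_support C I P \<iota> x"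
  proof (cases "finite F")
    case True
    have "supports C F P \<iota> x"
      unfolding supports_def
    proof (intro allI impI)
      fix u assume u: "Dom C u = P" "\<forall>i\<in>F. u \<cdot> \<iota> i = Zer C (Dom C (\<iota> i)) (Cod C u)"
      have "u \<cdot> finprod (homgrp C K P) (\<lambda>i. \<iota> i \<cdot> y i) F = Zer C K (Cod C u)"
      proof (rule comp_finprod_zero[OF u(1)])
        fix i assume i: "i \<in> F"
        then have "i \<in> I" by (simp add: F_def)
        then show "\<iota> i \<cdot> y i \<in> Mor C K P" using y P by (simp add: Mor_iff)
        have "u \<cdot> (\<iota> i \<cdot> y i) = u \<cdot> \<iota> i \<cdot> y i" using y P u(1) \<open>i \<in> I\<close> by (simp add: assoc)
        then show "u \<cdot> (\<iota> i \<cdot> y i) = Zer C K (Cod C u)"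
          using u(2) i y P \<open>i \<in> I\<close> by simp
      qed
      moreover have "x = finprod (homgrp C K P) (\<lambda>i. \<iota> i \<cdot> y i) F"
        using True by (simp add: xy gfinprod_def F_def)
      ultimately show "u \<cdot> x = Zer C (Dom C x) (Cod C u)" using x(1) by simp
    qed
    then show ?thesis using True unfolding finite_support_def F_def by blast
  next
    case False
    \<comment> \<open>\<open>gfinprod\<close> returns the neutral element when infinitely many terms
      differ from it. In that case \<open>x\<close> is zero and the empty set supports it, so
      finiteness of \<open>F\<close> never has to be proved.\<close>
    then have "x = Zer C K P" by (simp add: xy gfinprod_def F_def)
    then have "supports C {} P \<iota> x" by (auto simp: supports_def)
    then show ?thesis unfolding finite_support_def by blast
  qed
qed

text \<open>Since \<open>x = x i p + x j q\<close>, the union of a support of \<open>x i\<close> and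
  one of \<open>x j\<close> supports \<open>x\<close>.\<close>

lemma small_object_biproduct:
  assumes ty: "Cod C i = Dom C p" "Cod C j = Dom C p" "Dom C q = Dom C p" "Cod C p = Dom C i" "Cod C q = Dom C j"
    and eq: "i \<cdot> p \<^bold>+ j \<cdot> q = Idt C (Dom C p)"
    and c: "small_object U C (Dom C i)" "small_object U C (Dom C j)"
  shows "small_object U C (Dom C p)"
  unfolding small_object_def
proof (intro allI impI)
  fix I Y P \<iota> x
  assume I: "I \<subseteq> U" "I \<prec> U" "is_coproduct C I Y P \<iota>" and x: "Dom C x = Dom C p" "Cod C x = P"
  have "finite_support C I P \<iota> (x \<cdot> i)" "finite_support C I P \<iota> (x \<cdot> j)"
    using c I x ty unfolding small_object_def by simp_all
  then obtain E F where E: "finite E" "E \<subseteq> I" "supports C E P \<iota> (x \<cdot> i)"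
    and F: "finite F" "F \<subseteq> I" "supports C F P \<iota> (x \<cdot> j)" by (auto simp: finite_support_def)
  have "supports C (E \<union> F) P \<iota> x"
    unfolding supports_def
  proof (intro allI impI)
    fix u assume u: "Dom C u = P" "\<forall>k\<in>E \<union> F. u \<cdot> \<iota> k = Zer C (Dom C (\<iota> k)) (Cod C u)"
    have "u \<cdot> (x \<cdot> i) = Zer C (Dom C i) (Cod C u)" "u \<cdot> (x \<cdot> j) = Zer C (Dom C j) (Cod C u)"
      using E(3) F(3) u x ty unfolding supports_def by simp_all
    moreover have "u \<cdot> x \<cdot> (i \<cdot> p \<^bold>+ j \<cdot> q) = u \<cdot> (x \<cdot> i) \<cdot> p \<^bold>+ u \<cdot> (x \<cdot> j) \<cdot> q"
      using u(1) x ty by (simp add: comp_distrib_add assoc)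
    ultimately show "u \<cdot> x = Zer C (Dom C x) (Cod C u)"
      unfolding eq using u(1) x ty by simp
  qed
  then show "finite_support C I P \<iota> x"
    using E F unfolding finite_support_def by (intro exI[of _ "E \<union> F"]) simp
qed

end

locale additive_category_functor = A: additive_category A + B: additive_category B
  for A :: "('o, 'm, 'y) acat_scheme" and B :: "('p, 'n, 'z) acat_scheme" +
  fixes F :: "('o, 'm, 'p, 'n) fctr"
  assumes F_additive: "additive_functor A B F"
begin

sublocale category_functor A B F
  using F_additive by unfold_locales (simp add: additive_functor_def)

lemma F_add:
  "Dom A f = Dom A g \<Longrightarrow> Cod A f = Cod A g \<Longrightarrow> Fa F (f \<^bold>+\<^bsub>A\<^esub> g) = Fa F f \<^bold>+\<^bsub>B\<^esub> Fa F g"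
  using F_additive by (auto simp: additive_functor_def A.Mor_iff)

lemma F_zero [simp]: "Fa F (Zer A X Y) = Zer B (Fo F X) (Fo F Y)"
  using F_add[of "Zer A X Y" "Zer A X Y"] B.add_self_eq_zero[of "Fa F (Zer A X Y)"] by simp

lemma F_neg: "Fa F (Neg A f) = Neg B (Fa F f)"
  by (rule B.neg_unique) (simp_all flip: F_add)

lemma F_sub: "Dom A f = Dom A g \<Longrightarrow> Cod A f = Cod A g \<Longrightarrow> Fa F (Sub A f g) = Sub B (Fa F f) (Fa F g)"
  by (simp add: Sub_def F_add F_neg)

end

section \<open>Triangulated categories\<close>

context triangulated_category begin

sublocale sus: additive_category_functor C C "Sus C"
  by unfold_locales (rule sus_additive)

lemma sus_faithful:
  assumes "Dom C f = Dom C g" "Cod C f = Cod C g" "Sa C f = Sa C g" shows "f = g"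
proof -
  have "inj_on (Sa C) (Mor C (Dom C g) (Cod C g))"
    using sus_fully_faithful by (simp add: bij_betw_def)
  then show ?thesis using assms by (auto simp: inj_on_def Mor_iff)
qed

lemma sus_full:
  assumes "Dom C v = So C X" "Cod C v = So C Y"
  obtains f where "Dom C f = X" "Cod C f = Y" "Sa C f = v"
proof -
  have "v \<in> Sa C ` Mor C X Y"
    using sus_fully_faithful[of X Y] assms by (simp add: bij_betw_def Mor_iff)
  then show thesis using that by (auto simp: Mor_iff)
qed

lemma desuspension:
  obtains X b where "Dom C b = So C X" "Cod C b = Y" "isom C b"
  using sus_ess_surj[of Y] by (auto simp: Mor_iff)

lemma sus_reflects_isom:
  assumes "isom C (Sa C f)" shows "isom C f"
proof -
  obtain g where g: "Dom C g = Cod C f" "Cod C g = Dom C f" "Sa C g = inverse_arrow C (Sa C f)"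
    by (rule sus_full[of "inverse_arrow C (Sa C f)" "Cod C f" "Dom C f"]) (use assms in auto)
  show ?thesis
  proof (rule isomI[OF g(1,2)])
    show "g \<cdot> f = Idt C (Dom C f)"
      by (rule sus_faithful) (use assms g in \<open>simp_all add: sus.F_comp\<close>)
    show "f \<cdot> g = Idt C (Cod C f)"
      by (rule sus_faithful) (use assms g in \<open>simp_all add: sus.F_comp\<close>)
  qed
qed

lemma tri_type:
  assumes "(f, g, h) \<in> Tri C"
  shows "Dom C g = Cod C f" "Dom C h = Cod C g" "Cod C h = So C (Dom C f)"
  using tri_triangle[OF assms] by (auto simp: triangle_def Mor_iff)

lemma triangle_of_tri:
  "(f, g, h) \<in> Tri C \<Longrightarrow> triangle C (Dom C f) (Cod C f) (Cod C g) f g h"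
  using tri_type[of f g h] by (simp add: triangle_def Mor_iff)

lemma tri_rotated: "(f, g, h) \<in> Tri C \<Longrightarrow> (g, h, Neg C (Sa C f)) \<in> Tri C"
  using tri_rotate triangle_of_tri by blast

lemma tri_fill:
  assumes "(f, g, h) \<in> Tri C" "(f', g', h') \<in> Tri C" "b \<cdot> f = f' \<cdot> a"
    and "Dom C a = Dom C f" "Cod C a = Dom C f'" "Dom C b = Cod C f" "Cod C b = Cod C f'"
  obtains c where "Dom C c = Cod C g" "Cod C c = Cod C g'" "c \<cdot> g = g' \<cdot> b" "Sa C a \<cdot> h = h' \<cdot> c"
proof -
  have "\<exists>c\<in>Mor C (Cod C g) (Cod C g'). c \<cdot> g = g' \<cdot> b \<and> Sa C a \<cdot> h = h' \<cdot> c"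
    by (rule tri_morphism[OF assms(1) triangle_of_tri[OF assms(1)] assms(2) triangle_of_tri[OF assms(2)] _ _ assms(3)])
      (use assms(4-) in \<open>simp_all add: Mor_iff\<close>)
  then show thesis using that by (auto simp: Mor_iff)
qed

section \<open>Exactness of Hom on distinguished triangles\<close>

lemma zero_obj:
  obtains Z where "zero_object C Z" "Idt C Z = Zer C Z Z"
  using zero_object_exists zero_object_iff by blast

text \<open>The triangle on the identity of \<open>Dom C f\<close>, with a zero object as its third
  term, maps to the given one by the identity and \<open>f\<close>. The filler starts at the zero
  object, and \<open>g f\<close> factors through it.\<close>

lemma tri_comp_zero:
  assumes T: "(f, g, h) \<in> Tri C"
  shows "g \<cdot> f = Zer C (Dom C f) (Cod C g)"
proof -
  obtain Z where Z: "zero_object C Z" by (rule zero_obj)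
  obtain c where "Dom C c = Z" "Cod C c = Cod C g" "c \<cdot> Zer C (Dom C f) Z = g \<cdot> f"
    by (rule tri_fill[OF tri_ident[OF Z, of "Dom C f"] T, of f "Idt C (Dom C f)"]) auto
  then show ?thesis using comp_zero[of c Z "Dom C f"] by simp
qed

lemma tri_comp_zero3:
  assumes T: "(f, g, h) \<in> Tri C"
  shows "Sa C f \<cdot> h = Zer C (Dom C h) (So C (Cod C f))"
proof -
  have "Neg C (Sa C f \<cdot> h) = Zer C (Dom C h) (So C (Cod C f))"
    using tri_comp_zero[OF tri_rotated[OF tri_rotated[OF T]]] tri_type[OF T] by (simp add: neg_comp)
  then have "Neg C (Neg C (Sa C f \<cdot> h)) = Neg C (Zer C (Dom C h) (So C (Cod C f)))" by (rule arg_cong)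
  then show ?thesis by simp
qed

text \<open>The weak cokernel property of \<open>g\<close>: \<open>v\<close> extends to a morphism
  into the triangle on \<open>Zer C Z V\<close>, whose cone is \<open>V\<close>, and the filler is
  the extension.\<close>

lemma tri_extend:
  assumes T: "(f, g, h) \<in> Tri C" and v: "Dom C v = Cod C f" "v \<cdot> f = Zer C (Dom C f) (Cod C v)"
  obtains w where "Dom C w = Cod C g" "Cod C w = Cod C v" "w \<cdot> g = v"
proof -
  obtain Z where Z: "zero_object C Z" "Idt C Z = Zer C Z Z" by (rule zero_obj)
  define V where "V = Cod C v"
  \<comment> \<open>The triangle on \<open>Zer C Z V\<close> arises from the triangle on
    \<open>Idt C V\<close> by rotating backwards, which requires the zero object there to be
    \<open>So C Z\<close>.\<close>
  have "Idt C (So C Z) = Zer C (So C Z) (So C Z)" using Z(2) sus.F_ident[of Z] by simp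
  then have "zero_object C (So C Z)" by (simp add: zero_object_iff)
  from tri_ident[OF this, of V] have "(Idt C V, Zer C V (So C Z), Neg C (Sa C (Zer C Z V))) \<in> Tri C"
    by simp
  moreover have "triangle C Z V V (Zer C Z V) (Idt C V) (Zer C V (So C Z))"
    by (simp add: triangle_def Mor_iff)
  ultimately have T': "(Zer C Z V, Idt C V, Zer C V (So C Z)) \<in> Tri C"
    using tri_rotate by blast
  obtain c where "Dom C c = Cod C g" "Cod C c = V" "c \<cdot> g = Idt C V \<cdot> v"
    by (rule tri_fill[OF T T', of v "Zer C (Dom C f) Z"]) (use v in \<open>auto simp: V_def\<close>)
  then show thesis using that[of c] by (simp add: V_def)
qed

lemma tri_extend2:
  assumes T: "(f, g, h) \<in> Tri C" and v: "Dom C v = Cod C g" "v \<cdot> g = Zer C (Dom C g) (Cod C v)"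
  obtains w where "Dom C w = Cod C h" "Cod C w = Cod C v" "w \<cdot> h = v"
  by (rule tri_extend[OF tri_rotated[OF T] v])

text \<open>The weak kernel property of \<open>f\<close>. The axioms fill in only the third arrow,
  so both triangles are rotated until the suspension of the wanted arrow stands there; full
  faithfulness of the suspension then gives \<open>x\<close>.\<close>

lemma tri_lift:
  assumes T: "(f, g, h) \<in> Tri C" and v: "Cod C v = Cod C f" "g \<cdot> v = Zer C (Dom C v) (Cod C g)"
  obtains x where "Dom C x = Dom C v" "Cod C x = Dom C f" "f \<cdot> x = v"
proof -
  note ty = tri_type[OF T]
  obtain Z where Z: "zero_object C Z" by (rule zero_obj)
  define V where "V = Dom C v"
  have T1: "(Zer C V Z, Zer C Z (So C V), Neg C (Sa C (Idt C V))) \<in> Tri C"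
    by (rule tri_rotated[OF tri_ident[OF Z]])
  obtain c where c: "Dom C c = So C V" "Cod C c = So C (Dom C f)"
      "Sa C v \<cdot> Neg C (Sa C (Idt C V)) = Neg C (Sa C f) \<cdot> c"
    by (rule tri_fill[OF T1 tri_rotated[OF T], of "Zer C Z (Cod C g)" v]) (use v ty in \<open>auto simp: V_def\<close>)
  obtain x where x: "Dom C x = V" "Cod C x = Dom C f" "Sa C x = c"
    by (rule sus_full[OF c(1,2)])
  have "Neg C (Sa C v) = Neg C (Sa C f \<cdot> Sa C x)"
    using c x v by (simp add: neg_comp comp_neg V_def)
  then have "Neg C (Neg C (Sa C v)) = Neg C (Neg C (Sa C f \<cdot> Sa C x))" by (rule arg_cong)
  then have "Sa C (f \<cdot> x) = Sa C v" using x by (simp add: sus.F_comp)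
  then have "f \<cdot> x = v"
    by (rule sus_faithful[rotated 2]) (use x v in \<open>simp_all add: V_def\<close>)
  then show thesis using x that by (simp add: V_def)
qed

lemma tri_lift2:
  assumes T: "(f, g, h) \<in> Tri C" and v: "Cod C v = Cod C g" "h \<cdot> v = Zer C (Dom C v) (Cod C h)"
  obtains x where "Dom C x = Dom C v" "Cod C x = Dom C g" "g \<cdot> x = v"
  by (rule tri_lift[OF tri_rotated[OF T] v])

lemma tri_lift3:
  assumes T: "(f, g, h) \<in> Tri C" and v: "Cod C v = Cod C h" "Sa C f \<cdot> v = Zer C (Dom C v) (So C (Cod C f))"
  obtains x where "Dom C x = Dom C v" "Cod C x = Dom C h" "h \<cdot> x = v"
proof (rule tri_lift[OF tri_rotated[OF tri_rotated[OF T]] v(1)])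
  show "Neg C (Sa C f) \<cdot> v = Zer C (Dom C v) (Cod C (Neg C (Sa C f)))"
    using v tri_type[OF T] by (simp add: neg_comp)
qed (rule that)

text \<open>A distinguished triangle on \<open>t\<close> is rotated backwards, which requires
  desuspending its third object. The sign in the choice of \<open>e\<close> cancels the one in
  \<open>tri_rotate\<close>.\<close>

lemma fibre_exists: obtains e s where "(e, t, s) \<in> Tri C"
proof -
  obtain m n where T: "(t, m, n) \<in> Tri C" using tri_exists by blast
  note ty = tri_type[OF T]
  obtain E b where b: "Dom C b = So C E" "Cod C b = Cod C m" "isom C b" by (rule desuspension)
  obtain e where e: "Dom C e = E" "Cod C e = Dom C t" "Sa C e = Neg C (n \<cdot> b)"
    by (rule sus_full[of "Neg C (n \<cdot> b)" E "Dom C t"]) (use b ty in auto)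
  define s where "s = inverse_arrow C b \<cdot> m"
  have s: "Dom C s = Cod C t" "Cod C s = So C E" using b ty by (simp_all add: s_def)
  have tr: "triangle C (Dom C t) (Cod C t) (So C E) t s (Neg C (Sa C e))"
    using s e b ty by (simp add: triangle_def Mor_iff)
  have "(t, s, Neg C (Sa C e)) \<in> Tri C"
    by (rule tri_isom[OF T triangle_of_tri[OF T] tr, of "Idt C (Dom C t)" "Idt C (Cod C t)" "inverse_arrow C b"])
      (use b s e ty in \<open>simp_all add: Mor_iff s_def assoc\<close>)
  moreover have "triangle C E (Dom C t) (Cod C t) e t s"
    using s e by (simp add: triangle_def Mor_iff)
  ultimately have "(e, t, s) \<in> Tri C" using tri_rotate by blast
  then show thesis by (rule that)
qed

section \<open>Compactness under isomorphism, suspension and cones\<close>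

lemma sus_left_adjoint: "left_adjoint C C (Sus C)"
proof (rule left_adjointI)
  fix V
  obtain Q e where e: "Dom C e = So C Q" "Cod C e = V" "isom C e" by (rule desuspension)
  have "\<exists>h. Dom C h = X \<and> Cod C h = Q \<and> e \<cdot> Sa C h = g" if g: "Dom C g = So C X" "Cod C g = V" for g X
  proof -
    obtain h where "Dom C h = X" "Cod C h = Q" "Sa C h = inverse_arrow C e \<cdot> g"
      by (rule sus_full[of "inverse_arrow C e \<cdot> g" X Q]) (use e g in auto)
    then show ?thesis using e g by (intro exI[of _ h]) simp
  qed
  moreover have "h = h'" if h: "Dom C h = Dom C h'" "Cod C h = Q" "Cod C h' = Q" "e \<cdot> Sa C h = e \<cdot> Sa C h'" for h h'
  proof (rule sus_faithful)
    show "Sa C h = Sa C h'" by (rule isom_cancel_left[OF e(3) h(4)]) (use h e in simp_all)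
  qed (use h in simp_all)
  ultimately show "\<exists>Q e. Dom C e = So C Q \<and> Cod C e = V
      \<and> (\<forall>g X. Dom C g = So C X \<longrightarrow> Cod C g = V
          \<longrightarrow> (\<exists>h. Dom C h = X \<and> Cod C h = Q \<and> e \<cdot> Sa C h = g))
      \<and> (\<forall>h h'. Dom C h = Dom C h' \<longrightarrow> Cod C h = Q \<longrightarrow> Cod C h' = Q
          \<longrightarrow> e \<cdot> Sa C h = e \<cdot> Sa C h' \<longrightarrow> h = h')"
    using e by blast
qed

lemma sus_coproduct:
  "is_coproduct C I Y P \<iota> \<Longrightarrow> is_coproduct C I (\<lambda>i. So C (Y i)) (So C P) (\<lambda>i. Sa C (\<iota> i))"
  by (rule left_adjoint_coproduct[OF sus.category_functor_axioms sus_left_adjoint])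

lemma small_object_isom:
  assumes K: "small_object U C K" and b: "isom C b" "Dom C b = K" "Cod C b = L"
  shows "small_object U C L"
  unfolding small_object_def
proof (intro allI impI)
  fix I Y P \<iota> x
  assume I: "I \<subseteq> U" "I \<prec> U" and P: "is_coproduct C I Y P \<iota>" and x: "Dom C x = L" "Cod C x = P"
  have "finite_support C I P \<iota> (x \<cdot> b)"
    using K I P x b unfolding small_object_def by simp
  then obtain F where F: "finite F" "F \<subseteq> I" "supports C F P \<iota> (x \<cdot> b)" by (auto simp: finite_support_def)
  have "supports C F P \<iota> x"
    unfolding supports_def
  proof (intro allI impI)
    fix u assume u: "Dom C u = P" "\<forall>i\<in>F. u \<cdot> \<iota> i = Zer C (Dom C (\<iota> i)) (Cod C u)"
    then have "u \<cdot> (x \<cdot> b) = Zer C (Dom C b) (Cod C u)"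
      using F(3) x b unfolding supports_def by simp
    then have "u \<cdot> x \<cdot> b = Zer C L (Cod C u) \<cdot> b" using u x b by (simp add: assoc)
    then show "u \<cdot> x = Zer C (Dom C x) (Cod C u)"
      by (rule isom_cancel_right[OF b(1), THEN trans]) (use u x b in simp_all)
  qed
  then show "finite_support C I P \<iota> x" using F by (auto simp: finite_support_def)
qed

text \<open>The suspension preserves coproducts and is faithful, so a support of
  \<open>Sa C x\<close> among the suspended summands is already a support of
  \<open>x\<close>.\<close>

lemma small_object_desus:
  assumes "small_object U C (So C K)" shows "small_object U C K"
  unfolding small_object_def
proof (intro allI impI)
  fix I Y P \<iota> x
  assume I: "I \<subseteq> U" "I \<prec> U" and P: "is_coproduct C I Y P \<iota>" and x: "Dom C x = K" "Cod C x = P"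
  have "finite_support C I (So C P) (\<lambda>i. Sa C (\<iota> i)) (Sa C x)"
    using assms I sus_coproduct[OF P] x unfolding small_object_def by simp
  then obtain F where F: "finite F" "F \<subseteq> I" "supports C F (So C P) (\<lambda>i. Sa C (\<iota> i)) (Sa C x)"
    by (auto simp: finite_support_def)
  have "supports C F P \<iota> x"
    unfolding supports_def
  proof (intro allI impI)
    fix u assume u: "Dom C u = P" "\<forall>i\<in>F. u \<cdot> \<iota> i = Zer C (Dom C (\<iota> i)) (Cod C u)"
    have "Sa C u \<cdot> Sa C (\<iota> i) = Zer C (Dom C (Sa C (\<iota> i))) (Cod C (Sa C u))" if "i \<in> F" for i
    proof -
      have "Sa C u \<cdot> Sa C (\<iota> i) = Sa C (u \<cdot> \<iota> i)" using u that F(2) P by (subst sus.F_comp) auto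
      then show ?thesis using u that by simp
    qed
    then have "Sa C u \<cdot> Sa C x = Zer C (Dom C (Sa C x)) (Cod C (Sa C u))"
      using F(3) u(1) unfolding supports_def by simp
    then show "u \<cdot> x = Zer C (Dom C x) (Cod C u)"
      using u x by - (rule sus_faithful, simp_all add: sus.F_comp)
  qed
  then show "finite_support C I P \<iota> x" using F by (auto simp: finite_support_def)
qed

text \<open>The summands \<open>Y i\<close> are desuspended to \<open>Q i\<close>, and
  \<open>P\<close> is compared with the suspension of a coproduct \<open>R\<close> of the
  \<open>Q i\<close>; the existence of \<open>R\<close> is where \<open>hc\<close> enters.\<close>

lemma small_object_sus:
  assumes K: "small_object U C K" and hc: "has_coproducts U C" shows "small_object U C (So C K)"
  unfolding small_object_def
proof (intro allI impI)
  fix I Y P \<iota> x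
  assume I: "I \<subseteq> U" "I \<prec> U" and P: "is_coproduct C I Y P \<iota>" and x: "Dom C x = So C K" "Cod C x = P"
  have "\<forall>i. \<exists>Q b. Dom C b = So C Q \<and> Cod C b = Y i \<and> isom C b"
    using desuspension by metis
  then obtain Q b where b: "\<And>i. Dom C (b i) = So C (Q i)" "\<And>i. Cod C (b i) = Y i" "\<And>i. isom C (b i)"
    by metis
  obtain R \<kappa> where R: "is_coproduct C I Q R \<kappa>"
    using coproduct_exists[OF hc I(2)] by blast
  note SR = sus_coproduct[OF R]
  obtain j where j: "Dom C j = P" "Cod C j = So C R" "\<And>i. i \<in> I \<Longrightarrow> j \<cdot> \<iota> i = Sa C (\<kappa> i) \<cdot> inverse_arrow C (b i)"
    by (rule coproduct_extend[OF P, of "\<lambda>i. Sa C (\<kappa> i) \<cdot> inverse_arrow C (b i)" "So C R"])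
      (use b R in simp_all)
  obtain k where k: "Dom C k = So C R" "Cod C k = P" "\<And>i. i \<in> I \<Longrightarrow> k \<cdot> Sa C (\<kappa> i) = \<iota> i \<cdot> b i"
    by (rule coproduct_extend[OF SR, of "\<lambda>i. \<iota> i \<cdot> b i" P]) (use b P in simp_all)
  \<comment> \<open>This one-sided identity recovers \<open>x\<close> as \<open>k (j x)\<close>,
    while \<open>j x\<close> is an arrow between suspensions and comes from an arrow
    \<open>y\<close> into \<open>R\<close>.\<close>
  have kj: "k \<cdot> j = Idt C P"
  proof (rule coproduct_eqI[OF P])
    fix i assume i: "i \<in> I"
    have "k \<cdot> j \<cdot> \<iota> i = k \<cdot> (j \<cdot> \<iota> i)" using i k(1,2) j(1,2) P by (simp add: assoc)
    also have "\<dots> = k \<cdot> Sa C (\<kappa> i) \<cdot> inverse_arrow C (b i)"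
      using i k(1,2) b R unfolding j(3)[OF i] by (simp add: assoc)
    also have "\<dots> = \<iota> i" using i b P unfolding k(3)[OF i] by (simp add: assoc)
    finally show "k \<cdot> j \<cdot> \<iota> i = Idt C P \<cdot> \<iota> i" using i P by simp
  qed (use k(1,2) j(1,2) in simp_all)
  obtain y where y: "Dom C y = K" "Cod C y = R" "Sa C y = j \<cdot> x"
    by (rule sus_full[of "j \<cdot> x" K R]) (use x j in simp_all)
  have "finite_support C I R \<kappa> y" using K I R y unfolding small_object_def by blast
  then obtain F where F: "finite F" "F \<subseteq> I" "supports C F R \<kappa> y" by (auto simp: finite_support_def)
  have "supports C F P \<iota> x"
    unfolding supports_def
  proof (intro allI impI)
    fix u assume u: "Dom C u = P" "\<forall>i\<in>F. u \<cdot> \<iota> i = Zer C (Dom C (\<iota> i)) (Cod C u)"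
    \<comment> \<open>The test arrow is desuspended as well, since a support of \<open>y\<close> can
      be tested only on arrows out of \<open>R\<close>.\<close>
    obtain V c where c: "Dom C c = So C V" "Cod C c = Cod C u" "isom C c" by (rule desuspension)
    obtain w where w: "Dom C w = R" "Cod C w = V" "Sa C w = inverse_arrow C c \<cdot> (u \<cdot> k)"
      by (rule sus_full[of "inverse_arrow C c \<cdot> (u \<cdot> k)" R V]) (use c u k in simp_all)
    have "w \<cdot> \<kappa> i = Zer C (Dom C (\<kappa> i)) (Cod C w)" if i: "i \<in> F" for i
    proof (rule sus_faithful)
      have iI: "i \<in> I" using i F by auto
      have "Sa C (w \<cdot> \<kappa> i) = inverse_arrow C c \<cdot> (u \<cdot> (k \<cdot> Sa C (\<kappa> i)))"
        using w c u(1) k(1,2) R iI by (simp add: sus.F_comp assoc)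
      also have "\<dots> = inverse_arrow C c \<cdot> (u \<cdot> \<iota> i \<cdot> b i)"
        using c u(1) b P iI unfolding k(3)[OF iI] by (simp add: assoc)
      also have "\<dots> = Sa C (Zer C (Dom C (\<kappa> i)) (Cod C w))"
        using u(2) i c b R P iI w(2) by simp
      finally show "Sa C (w \<cdot> \<kappa> i) = Sa C (Zer C (Dom C (\<kappa> i)) (Cod C w))" .
    qed (use w(1) i F R in auto)
    then have "w \<cdot> y = Zer C K V"
      using F(3) w(1,2) y(1) unfolding supports_def by simp
    then have "Sa C w \<cdot> Sa C y = Zer C (So C K) (So C V)" using w(1,2) y(1,2) by (simp flip: sus.F_comp)
    then have "inverse_arrow C c \<cdot> (u \<cdot> (k \<cdot> (j \<cdot> x))) = Zer C (So C K) (So C V)"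
      using w(3) y(3) c u(1) k(1,2) j(1,2) x by (simp add: assoc)
    moreover have "k \<cdot> (j \<cdot> x) = x" using k(1,2) j(1,2) x kj by (simp flip: assoc)
    ultimately have "inverse_arrow C c \<cdot> (u \<cdot> x) = Zer C (So C K) (So C V)" by simp
    then have "c \<cdot> (inverse_arrow C c \<cdot> (u \<cdot> x)) = c \<cdot> Zer C (So C K) (So C V)" by (rule arg_cong)
    then show "u \<cdot> x = Zer C (Dom C x) (Cod C u)" using c u(1) x by simp
  qed
  then show "finite_support C I P \<iota> x" using F by (auto simp: finite_support_def)
qed

text \<open>If \<open>F\<close> supports \<open>z g\<close>, its partial identity \<open>e\<close>
  fixes \<open>z g\<close>, so \<open>z - e z\<close> factors as \<open>w h\<close> through the
  suspension of \<open>Dom C f\<close>. Enlarging \<open>F\<close> by a support of \<open>w\<close>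
  gives a support of \<open>z\<close>.\<close>

lemma small_object_cone:
  assumes T: "(f, g, h) \<in> Tri C" and X: "small_object U C (Dom C f)" and Y: "small_object U C (Cod C f)"
    and hc: "has_coproducts U C"
  shows "small_object U C (Cod C g)"
  unfolding small_object_def
proof (intro allI impI)
  note ty = tri_type[OF T]
  fix I Y P \<iota> z
  assume I: "I \<subseteq> U" "I \<prec> U" and P: "is_coproduct C I Y P \<iota>" and z: "Dom C z = Cod C g" "Cod C z = P"
  have "finite_support C I P \<iota> (z \<cdot> g)"
    using Y I P z ty unfolding small_object_def by simp
  then obtain F where F: "finite F" "F \<subseteq> I" "supports C F P \<iota> (z \<cdot> g)" by (auto simp: finite_support_def)
  obtain e where e: "Dom C e = P" "Cod C e = P" "\<And>i. i \<in> F \<Longrightarrow> i \<in> I \<Longrightarrow> e \<cdot> \<iota> i = \<iota> i"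
    "\<And>i. i \<in> I \<Longrightarrow> i \<notin> F \<Longrightarrow> e \<cdot> \<iota> i = Zer C (Y i) P"
    by (rule partial_identity[OF P, of F]) (rule that; blast)
  have "e \<cdot> (z \<cdot> g) = z \<cdot> g"
    by (rule supports_partial_identity[OF P F(2,3)]) (use e F(2) z ty in auto)
  then have "Sub C z (e \<cdot> z) \<cdot> g = Zer C (Dom C g) (Cod C (Sub C z (e \<cdot> z)))"
    using e(1,2) z ty by (simp add: sub_comp assoc)
  then obtain w where w: "Dom C w = So C (Dom C f)" "Cod C w = P" "w \<cdot> h = Sub C z (e \<cdot> z)"
    by (rule tri_extend2[OF T, rotated]) (use e(1,2) z ty in auto)
  have "finite_support C I P \<iota> w"
    using small_object_sus[OF X hc] I P w unfolding small_object_def by blast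
  then obtain F' where F': "finite F'" "F' \<subseteq> I" "supports C F' P \<iota> w" by (auto simp: finite_support_def)
  have "supports C (F \<union> F') P \<iota> z"
    unfolding supports_def
  proof (intro allI impI)
    fix u assume u: "Dom C u = P" "\<forall>i\<in>F \<union> F'. u \<cdot> \<iota> i = Zer C (Dom C (\<iota> i)) (Cod C u)"
    have "u \<cdot> w = Zer C (Dom C w) (Cod C u)"
      using F'(3) u unfolding supports_def by blast
    then have uz: "u \<cdot> Sub C z (e \<cdot> z) = Zer C (Dom C h) (Cod C u)"
      using w(1,2) u(1) ty by (simp flip: w(3) assoc)
    have "u \<cdot> e = Zer C P (Cod C u)"
    proof (rule coproduct_eqI[OF P])
      fix i assume i: "i \<in> I"
      show "u \<cdot> e \<cdot> \<iota> i = Zer C P (Cod C u) \<cdot> \<iota> i"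
        using u e i P by (cases "i \<in> F") (simp_all add: assoc)
    qed (use u e in simp_all)
    then have "u \<cdot> (e \<cdot> z) = Zer C (Dom C z) (Cod C u)"
      using u(1) e(1,2) z by (simp flip: assoc)
    then have "Sub C (u \<cdot> z) (Zer C (Dom C z) (Cod C u)) = Zer C (Dom C h) (Cod C u)"
      using uz u(1) e(1,2) z ty by (simp add: comp_sub)
    then show "u \<cdot> z = Zer C (Dom C z) (Cod C u)"
      using u(1) z ty by simp
  qed
  then show "finite_support C I P \<iota> z" using F F' unfolding finite_support_def
    by (intro exI[of _ "F \<union> F'"]) simp
qed

end

section \<open>Generation by compact objects\<close>

definition coproduct_closed :: "'u set \<Rightarrow> ('o, 'm, 'z) cat_scheme \<Rightarrow> ('o \<Rightarrow> bool) \<Rightarrow> bool" where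
  "coproduct_closed U C S \<longleftrightarrow> (\<forall>I Y P \<iota>. I \<subseteq> U \<longrightarrow> I \<prec> U \<longrightarrow> is_coproduct C I Y P \<iota>
     \<longrightarrow> (\<forall>i\<in>I. S (Y i)) \<longrightarrow> S P)"

lemma (in category) coproduct_closedD:
  assumes "coproduct_closed U C S" "J \<prec> U" and P: "is_coproduct C J Y P \<iota>" and Y: "\<And>j. j \<in> J \<Longrightarrow> S (Y j)"
  shows "S P"
proof -
  obtain k where k: "inj_on k J" "k ` J \<subseteq> U"
    using lesspoll_imp_lepoll[OF assms(2)] by (auto simp: lepoll_def)
  then have bij: "bij_betw (inv_into J k) (k ` J) J"
    by (intro bij_betw_inv_into) (simp add: bij_betw_def)
  have "k ` J \<prec> U"
    using lesspoll_trans1[OF image_lepoll assms(2)] .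
  moreover have "\<forall>i\<in>k ` J. S (Y (inv_into J k i))"
    using Y by (auto simp: inv_into_into)
  ultimately show ?thesis
    using assms(1) k(2) coproduct_reindex[OF bij P] unfolding coproduct_closed_def by blast
qed

text \<open>Collects what the tower and factorization arguments take from compact generation,
  without the tensor structure. It is instantiated for the source as well as for the target of
  \<open>f_*\<close>.\<close>

locale generated_triangulated_category = triangulated_category C
  for C :: "('o, 'm, 'z) tcat_scheme" (structure) +
  fixes U :: "'u set" and G :: "'o set"
  assumes nat_small: "(UNIV :: nat set) \<prec> U"
    and coproducts: "has_coproducts U C"
    and generators_small: "G \<prec> U"
    and hom_small: "X \<in> G \<Longrightarrow> Mor C X Y \<prec> U"
    and generators_small_object: "X \<in> G \<Longrightarrow> small_object U C X"
    and detect: "(\<And>X. X \<in> G \<Longrightarrow> bij_betw (\<lambda>h. g \<cdot> h) (Mor C X (Dom C g)) (Mor C X (Cod C g))) \<Longrightarrow> isom C g"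
begin

text \<open>The maps on Hom groups are additive, so injectivity may be tested on arrows sent to
  zero.\<close>

lemma detect_isom:
  assumes inj: "\<And>v. Dom C v \<in> G \<Longrightarrow> Cod C v = Dom C g \<Longrightarrow> g \<cdot> v = Zer C (Dom C v) (Cod C g)
      \<Longrightarrow> v = Zer C (Dom C v) (Dom C g)"
    and surj: "\<And>v. Dom C v \<in> G \<Longrightarrow> Cod C v = Cod C g \<Longrightarrow> \<exists>w. Dom C w = Dom C v \<and> Cod C w = Dom C g \<and> g \<cdot> w = v"
  shows "isom C g"
proof (rule detect)
  fix X assume X: "X \<in> G"
  show "bij_betw (\<lambda>h. g \<cdot> h) (Mor C X (Dom C g)) (Mor C X (Cod C g))"
  proof (rule bij_betwI')
    fix v w assume "v \<in> Mor C X (Dom C g)" "w \<in> Mor C X (Dom C g)"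
    then have vw: "Dom C v = X" "Cod C v = Dom C g" "Dom C w = X" "Cod C w = Dom C g" by (simp_all add: Mor_iff)
    show "(g \<cdot> v = g \<cdot> w) = (v = w)"
    proof
      assume eq: "g \<cdot> v = g \<cdot> w"
      have "g \<cdot> Sub C v w = Sub C (g \<cdot> w) (g \<cdot> w)" using vw by (simp add: comp_sub eq)
      then have s: "Sub C v w = Zer C X (Dom C g)" using vw X inj[of "Sub C v w"] by simp
      show "v = w" by (rule sub_eq_zeroD) (use vw s in simp_all)
    qed simp
  next
    fix v assume "v \<in> Mor C X (Dom C g)"
    then show "g \<cdot> v \<in> Mor C X (Cod C g)" by (simp add: Mor_iff)
  next
    fix v assume "v \<in> Mor C X (Cod C g)"
    then have v: "Dom C v = X" "Cod C v = Cod C g" by (simp_all add: Mor_iff)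
    then obtain w where "Dom C w = X" "Cod C w = Dom C g" "g \<cdot> w = v"
      using surj[of v] X by blast
    then show "\<exists>w\<in>Mor C X (Dom C g). v = g \<cdot> w" by (intro bexI[of _ w]) (simp_all add: Mor_iff)
  qed
qed

text \<open>\<open>k\<close> bundles all arrows from generators into \<open>Dom C f\<close> that
  \<open>f\<close> kills; their coproduct exists because Hom sets out of generators are small. It is
  formed in two stages, over \<open>J X\<close> and then over \<open>G\<close>, so that the size of
  the union need not be bounded.\<close>

lemma kernel_cover:
  assumes S: "\<And>X. X \<in> G \<Longrightarrow> S X" "coproduct_closed U C S"
  obtains k where "S (Dom C k)" "Cod C k = Dom C f" "f \<cdot> k = Zer C (Dom C k) (Cod C f)"
    "\<And>g. Dom C g \<in> G \<Longrightarrow> Cod C g = Dom C f \<Longrightarrow> f \<cdot> g = Zer C (Dom C g) (Cod C f)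
      \<Longrightarrow> \<exists>w. Dom C w = Dom C g \<and> Cod C w = Dom C k \<and> k \<cdot> w = g"
proof -
  define J where "J X = {g \<in> Mor C X (Dom C f). f \<cdot> g = Zer C X (Cod C f)}" for X
  have J: "J X \<prec> U" if "X \<in> G" for X
    by (rule lesspoll_trans1[OF subset_imp_lepoll hom_small[OF that]]) (auto simp: J_def)
  have Jm: "Dom C g = X" "Cod C g = Dom C f" "f \<cdot> g = Zer C X (Cod C f)" if "g \<in> J X" for g X
    using that by (auto simp: J_def Mor_iff)
  have "\<exists>P \<iota> a. is_coproduct C (J X) (\<lambda>_. X) P \<iota> \<and> Dom C a = P \<and> Cod C a = Dom C f \<and> (\<forall>g\<in>J X. a \<cdot> \<iota> g = g)"
    if X: "X \<in> G" for X
  proof -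
    obtain P \<iota> where P: "is_coproduct C (J X) (\<lambda>_. X) P \<iota>"
      using coproduct_exists[OF coproducts J[OF X]] by blast
    obtain a where "Dom C a = P" "Cod C a = Dom C f" "\<And>g. g \<in> J X \<Longrightarrow> a \<cdot> \<iota> g = g"
      by (rule coproduct_extend[OF P, of "\<lambda>g. g" "Dom C f"]) (use Jm in auto)
    then show ?thesis using P by blast
  qed
  then have "\<forall>X. \<exists>P \<iota> a. X \<in> G \<longrightarrow> is_coproduct C (J X) (\<lambda>_. X) P \<iota> \<and> Dom C a = P \<and> Cod C a = Dom C f
      \<and> (\<forall>g\<in>J X. a \<cdot> \<iota> g = g)"
    by blast
  then obtain P \<iota> a where P: "\<And>X. X \<in> G \<Longrightarrow> is_coproduct C (J X) (\<lambda>_. X) (P X) (\<iota> X)"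
    and a: "\<And>X. X \<in> G \<Longrightarrow> Dom C (a X) = P X" "\<And>X. X \<in> G \<Longrightarrow> Cod C (a X) = Dom C f"
      "\<And>X g. X \<in> G \<Longrightarrow> g \<in> J X \<Longrightarrow> a X \<cdot> \<iota> X g = g"
    by metis
  obtain Q \<kappa> where Q: "is_coproduct C G P Q \<kappa>"
    using coproduct_exists[OF coproducts generators_small] by blast
  obtain k where k: "Dom C k = Q" "Cod C k = Dom C f" "\<And>X. X \<in> G \<Longrightarrow> k \<cdot> \<kappa> X = a X"
    by (rule coproduct_extend[OF Q, of a "Dom C f"]) (use a in auto)
  have "S (P X)" if "X \<in> G" for X
    by (rule coproduct_closedD[OF S(2) J[OF that] P[OF that]]) (rule S(1)[OF that])
  then have "S Q" by (rule coproduct_closedD[OF S(2) generators_small Q])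
  moreover have "f \<cdot> k = Zer C Q (Cod C f)"
  proof (rule coproduct_eqI[OF Q])
    fix X assume X: "X \<in> G"
    have "f \<cdot> a X = Zer C (P X) (Cod C f)"
    proof (rule coproduct_eqI[OF P[OF X]])
      fix g assume g: "g \<in> J X"
      show "f \<cdot> a X \<cdot> \<iota> X g = Zer C (P X) (Cod C f) \<cdot> \<iota> X g"
        using a(1,2)[OF X] P[OF X] g a(3)[OF X g] Jm(3)[OF g] by (simp add: assoc)
    qed (use a X in simp_all)
    then show "f \<cdot> k \<cdot> \<kappa> X = Zer C Q (Cod C f) \<cdot> \<kappa> X"
      using k(1,2) k(3)[OF X] Q X by (simp add: assoc)
  qed (use k in simp_all)
  moreover have "\<exists>w. Dom C w = Dom C g \<and> Cod C w = Dom C k \<and> k \<cdot> w = g"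
    if g: "Dom C g \<in> G" "Cod C g = Dom C f" "f \<cdot> g = Zer C (Dom C g) (Cod C f)" for g
  proof -
    have gJ: "g \<in> J (Dom C g)" using g by (simp add: J_def Mor_iff)
    have \<iota>: "Dom C (\<iota> (Dom C g) g) = Dom C g" "Cod C (\<iota> (Dom C g) g) = P (Dom C g)"
      using coproduct_dom[OF P[OF g(1)] gJ] coproduct_cod[OF P[OF g(1)] gJ] .
    have \<kappa>: "Dom C (\<kappa> (Dom C g)) = P (Dom C g)" "Cod C (\<kappa> (Dom C g)) = Q"
      using coproduct_dom[OF Q g(1)] coproduct_cod[OF Q g(1)] .
    have "k \<cdot> (\<kappa> (Dom C g) \<cdot> \<iota> (Dom C g) g) = k \<cdot> \<kappa> (Dom C g) \<cdot> \<iota> (Dom C g) g"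
      using \<iota> \<kappa> k(1) by (simp add: assoc)
    also have "\<dots> = g" by (simp only: k(3)[OF g(1)] a(3)[OF g(1) gJ])
    finally show ?thesis using \<iota> \<kappa> k(1) by (intro exI[of _ "\<kappa> (Dom C g) \<cdot> \<iota> (Dom C g) g"]) simp
  qed
  ultimately show thesis using that[of k] k(1,2) by simp
qed

end

section \<open>Towers and their homotopy colimits\<close>

context additive_category begin

text \<open>\<open>t\<close> is the identity minus the shift along the \<open>b n\<close>.
  Projecting \<open>t w = 0\<close> to the summands gives \<open>p 0 w = 0\<close> and
  \<open>p (Suc n) w = b n p n w\<close>, so all components of \<open>w\<close> vanish by induction;
  finite support turns this into \<open>w = 0\<close>.\<close>

lemma shift_injective:
  assumes P: "is_coproduct C (UNIV :: nat set) Y P \<iota>" and t: "Dom C t = P" "Cod C t = P"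
    and b: "\<And>n. Dom C (b n) = Y n" "\<And>n. Cod C (b n) = Y (Suc n)"
    and shift: "\<And>n. t \<cdot> \<iota> n = Sub C (\<iota> n) (\<iota> (Suc n) \<cdot> b n)"
    and w: "finite_support C UNIV P \<iota> w" "Cod C w = P" and tw: "t \<cdot> w = Zer C (Dom C w) P"
  shows "w = Zer C (Dom C w) P"
proof -
  have \<iota> [simp]: "Dom C (\<iota> n) = Y n" "Cod C (\<iota> n) = P" for n using P by simp_all
  have "\<exists>p. Dom C p = P \<and> Cod C p = Y n \<and> (\<forall>m. p \<cdot> \<iota> m = (if m = n then Idt C (Y n) else Zer C (Y m) (Y n)))" for n
    by (rule coproduct_projection[OF P UNIV_I, of n]) (auto intro!: exI)
  then obtain p where p: "\<And>n. Dom C (p n) = P" "\<And>n. Cod C (p n) = Y n"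
      "\<And>n m. p n \<cdot> \<iota> m = (if m = n then Idt C (Y n) else Zer C (Y m) (Y n))"
    by metis
  have pt: "p n \<cdot> t \<cdot> \<iota> m = Sub C (p n \<cdot> \<iota> m) (p n \<cdot> \<iota> (Suc m) \<cdot> b m)" for n m
    using t p(1,2) b by (simp add: assoc shift comp_sub)
  have pt0: "p 0 \<cdot> t = p 0"
  proof (rule coproduct_eqI[OF P])
    fix m show "p 0 \<cdot> t \<cdot> \<iota> m = p 0 \<cdot> \<iota> m"
      unfolding pt using p b by simp
  qed (use t p in simp_all)
  have ptS: "p (Suc n) \<cdot> t = Sub C (p (Suc n)) (b n \<cdot> p n)" for n
  proof (rule coproduct_eqI[OF P])
    fix m show "p (Suc n) \<cdot> t \<cdot> \<iota> m = Sub C (p (Suc n)) (b n \<cdot> p n) \<cdot> \<iota> m"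
      unfolding pt using p b by (cases "m = n") (simp_all add: sub_comp assoc)
  qed (use t p b in simp_all)
  have pw: "p n \<cdot> w = Zer C (Dom C w) (Y n)" for n
  proof (induction n)
    case 0
    have "p 0 \<cdot> w = p 0 \<cdot> (t \<cdot> w)" using t p(1) w(2) by (simp add: pt0 flip: assoc)
    then show ?case using p(1,2) by (simp add: tw)
  next
    case (Suc n)
    have "Sub C (p (Suc n)) (b n \<cdot> p n) \<cdot> w = p (Suc n) \<cdot> (t \<cdot> w)"
      unfolding ptS[symmetric] using t p(1) w(2) by (simp add: assoc)
    then have "Sub C (p (Suc n) \<cdot> w) (b n \<cdot> (p n \<cdot> w)) = Zer C (Dom C w) (Y (Suc n))"
      using p(1,2) b w(2) by (simp add: tw sub_comp assoc)
    then show ?case using p(1,2) b w(2) by (simp add: Suc)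
  qed
  show ?thesis
  proof (rule finite_support_induct[OF P w, where Q = "\<lambda>a. a = Zer C (Dom C w) P"])
    fix i q assume q: "Dom C q = P" "Cod C q = Y i" "q \<cdot> \<iota> i = Idt C (Y i)"
      "\<And>j. j \<in> UNIV \<Longrightarrow> j \<noteq> i \<Longrightarrow> q \<cdot> \<iota> j = Zer C (Y j) (Y i)"
    have "q = p i"
      by (rule coproduct_eqI[OF P]) (use q p in auto)
    then show "\<iota> i \<cdot> (q \<cdot> w) = Zer C (Dom C w) P" by (simp add: pw)
  qed simp_all
qed

end

context generated_triangulated_category begin

text \<open>
  Every object \<open>X\<close> is the homotopy colimit of a tower in \<open>S\<close>: the first stage covers all arrows from
  generators into \<open>X\<close>, and each step kills the arrows from generators that vanish in \<open>X\<close>.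
\<close>

theorem generators_generate:
  assumes gen: "\<And>X. X \<in> G \<Longrightarrow> S X" and cop: "coproduct_closed U C S"
    and cone: "\<And>f g h. (f, g, h) \<in> Tri C \<Longrightarrow> S (Dom C f) \<Longrightarrow> S (Cod C f) \<Longrightarrow> S (Cod C g)"
    and iso: "\<And>f. isom C f \<Longrightarrow> S (Dom C f) \<Longrightarrow> S (Cod C f)"
  shows "S X"
proof -
  define step where "step \<phi> \<phi>' a \<longleftrightarrow> Dom C a = Dom C \<phi> \<and> Cod C a = Dom C \<phi>' \<and> \<phi>' \<cdot> a = \<phi>
      \<and> (\<forall>g. Dom C g \<in> G \<longrightarrow> Cod C g = Dom C \<phi> \<longrightarrow> \<phi> \<cdot> g = Zer C (Dom C g) X
          \<longrightarrow> a \<cdot> g = Zer C (Dom C g) (Cod C a))" for \<phi> \<phi>' a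
  \<comment> \<open>Covering is demanded of stage 0 alone, which already makes the final comparison
    arrow surjective on arrows from generators.\<close>
  define good where "good (n :: nat) \<phi> \<longleftrightarrow> Cod C \<phi> = X \<and> S (Dom C \<phi>)
      \<and> (n = 0 \<longrightarrow> (\<forall>g. Dom C g \<in> G \<longrightarrow> Cod C g = X
            \<longrightarrow> (\<exists>w. Dom C w = Dom C g \<and> Cod C w = Dom C \<phi> \<and> \<phi> \<cdot> w = g)))" for n \<phi>
  have "\<exists>\<phi>. \<forall>n. good n (\<phi> n) \<and> (\<exists>a. step (\<phi> n) (\<phi> (Suc n)) a)"
  proof (rule dependent_nat_choice)
    \<comment> \<open>Every arrow into \<open>X\<close> is killed by \<open>Zer C X X\<close>, so a
      kernel cover of this zero arrow covers all arrows from generators into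
      \<open>X\<close>.\<close>
    obtain k where "S (Dom C k)" "Cod C k = Dom C (Zer C X X)"
        "\<And>g. Dom C g \<in> G \<Longrightarrow> Cod C g = Dom C (Zer C X X) \<Longrightarrow> Zer C X X \<cdot> g = Zer C (Dom C g) (Cod C (Zer C X X))
      \<Longrightarrow> \<exists>w. Dom C w = Dom C g \<and> Cod C w = Dom C k \<and> k \<cdot> w = g"
      by (rule kernel_cover[OF gen cop, of "Zer C X X", rotated]) (rule that; blast)
    then show "\<exists>\<phi>. good 0 \<phi>" by (auto simp: good_def)
  next
    fix \<phi> n assume "good n \<phi>"
    then have \<phi>: "Cod C \<phi> = X" "S (Dom C \<phi>)" by (simp_all add: good_def)
    obtain k where k: "S (Dom C k)" "Cod C k = Dom C \<phi>" "\<phi> \<cdot> k = Zer C (Dom C k) (Cod C \<phi>)"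
      and lift: "\<And>g. Dom C g \<in> G \<Longrightarrow> Cod C g = Dom C \<phi> \<Longrightarrow> \<phi> \<cdot> g = Zer C (Dom C g) (Cod C \<phi>)
      \<Longrightarrow> \<exists>w. Dom C w = Dom C g \<and> Cod C w = Dom C k \<and> k \<cdot> w = g"
      by (rule kernel_cover[OF gen cop, of \<phi>, rotated]) (rule that; blast)
    \<comment> \<open>The next stage is the cone of \<open>k\<close>. The arrow \<phi> extends over
      it because it kills \<open>k\<close>, and an arrow from a generator killed by \<phi> factors
      through \<open>k\<close>, hence dies in the cone.\<close>
    obtain a b where T: "(k, a, b) \<in> Tri C" using tri_exists by blast
    have a: "Dom C a = Dom C \<phi>" using tri_type[OF T] k by simp
    obtain \<phi>' where \<phi>': "Dom C \<phi>' = Cod C a" "Cod C \<phi>' = Cod C \<phi>" "\<phi>' \<cdot> a = \<phi>"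
      by (rule tri_extend[OF T _ k(3)]) (use k(2) in simp)
    have "S (Cod C a)" by (rule cone[OF T]) (use k \<phi> in simp_all)
    moreover have "a \<cdot> g = Zer C (Dom C g) (Cod C a)"
      if g: "Dom C g \<in> G" "Cod C g = Dom C \<phi>" "\<phi> \<cdot> g = Zer C (Dom C g) X" for g
    proof -
      obtain w where w: "Dom C w = Dom C g" "Cod C w = Dom C k" "k \<cdot> w = g"
        using lift[OF g(1,2)] g(3) \<phi>(1) by auto
      have "a \<cdot> (k \<cdot> w) = a \<cdot> k \<cdot> w" using w a k by (simp add: assoc)
      then show ?thesis using w tri_comp_zero[OF T] by simp
    qed
    ultimately have "good (Suc n) \<phi>'" "step \<phi> \<phi>' a"
      using \<phi> \<phi>' a by (simp_all add: good_def step_def)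
    then show "\<exists>\<phi>'. good (Suc n) \<phi>' \<and> (\<exists>a. step \<phi> \<phi>' a)" by blast
  qed
  then obtain \<phi> a where good: "\<And>n. good n (\<phi> n)" and step: "\<And>n. step (\<phi> n) (\<phi> (Suc n)) (a n)"
    by metis
  define Y where "Y n = Dom C (\<phi> n)" for n
  have \<phi> [simp]: "Dom C (\<phi> n) = Y n" "Cod C (\<phi> n) = X" and SY: "S (Y n)" for n
    using good[of n] by (simp_all add: good_def Y_def)
  have a [simp]: "Dom C (a n) = Y n" "Cod C (a n) = Y (Suc n)" and \<phi>a: "\<phi> (Suc n) \<cdot> a n = \<phi> n" for n
    using step[of n] by (simp_all add: step_def)
  have kill: "a n \<cdot> g = Zer C (Dom C g) (Y (Suc n))"
    if "Dom C g \<in> G" "Cod C g = Y n" "\<phi> n \<cdot> g = Zer C (Dom C g) X" for n g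
    using step[of n] that by (simp add: step_def)
  have cover: "\<exists>w. Dom C w = Dom C g \<and> Cod C w = Y 0 \<and> \<phi> 0 \<cdot> w = g" if "Dom C g \<in> G" "Cod C g = X" for g
    using good[of 0] that by (simp add: good_def)
  obtain P \<iota> where P: "is_coproduct C (UNIV :: nat set) Y P \<iota>"
    using coproduct_exists[OF coproducts nat_small] by blast
  have \<iota> [simp]: "Dom C (\<iota> n) = Y n" "Cod C (\<iota> n) = P" for n using P by simp_all
  have SP: "S P" by (rule coproduct_closedD[OF cop nat_small P]) (rule SY)
  obtain t where t: "Dom C t = P" "Cod C t = P" "\<And>n. t \<cdot> \<iota> n = Sub C (\<iota> n) (\<iota> (Suc n) \<cdot> a n)"
    by (rule coproduct_extend[OF P, of "\<lambda>n. Sub C (\<iota> n) (\<iota> (Suc n) \<cdot> a n)" P]) auto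
  \<comment> \<open>The cone of \<open>t\<close>, the identity minus the shift, is the homotopy
    colimit \<open>H\<close> of the tower.\<close>
  obtain q r where T: "(t, q, r) \<in> Tri C" using tri_exists by blast
  define H where "H = Cod C q"
  have qr [simp]: "Dom C q = P" "Cod C q = H" "Dom C r = H" "Cod C r = So C P"
    using tri_type[OF T] t by (simp_all add: H_def)
  have SH: "S H" unfolding H_def by (rule cone[OF T]) (use t SP in simp_all)
  obtain \<Phi> where \<Phi>: "Dom C \<Phi> = P" "Cod C \<Phi> = X" "\<And>n. \<Phi> \<cdot> \<iota> n = \<phi> n"
    by (rule coproduct_extend[OF P, of \<phi> X]) auto
  have "\<Phi> \<cdot> t = Zer C P X"
  proof (rule coproduct_eqI[OF P])
    fix n
    have "\<Phi> \<cdot> t \<cdot> \<iota> n = \<Phi> \<cdot> (t \<cdot> \<iota> n)" using t(1,2) \<Phi>(1,2) by (simp add: assoc)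
    also have "\<dots> = Sub C (\<Phi> \<cdot> \<iota> n) (\<Phi> \<cdot> \<iota> (Suc n) \<cdot> a n)"
      unfolding t(3) using \<Phi>(1,2) by (simp add: comp_sub assoc)
    also have "\<dots> = Zer C P X \<cdot> \<iota> n" unfolding \<Phi>(3) by (simp add: \<phi>a)
    finally show "\<Phi> \<cdot> t \<cdot> \<iota> n = Zer C P X \<cdot> \<iota> n" .
  qed (use t(1,2) \<Phi>(1,2) in simp_all)
  then have "\<Phi> \<cdot> t = Zer C (Dom C t) (Cod C \<Phi>)" using t(1) \<Phi>(2) by simp
  then obtain \<psi> where \<psi>: "Dom C \<psi> = H" "Cod C \<psi> = X" "\<psi> \<cdot> q = \<Phi>"
    by (rule tri_extend[OF T, rotated]) (use t(1,2) \<Phi>(1,2) in auto)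
  have q\<iota>: "q \<cdot> \<iota> n = q \<cdot> \<iota> (Suc n) \<cdot> a n" for n
  proof (rule sub_eq_zeroD)
    have "Sub C (q \<cdot> \<iota> n) (q \<cdot> \<iota> (Suc n) \<cdot> a n) = q \<cdot> (t \<cdot> \<iota> n)"
      unfolding t(3) by (simp add: comp_sub assoc)
    also have "\<dots> = q \<cdot> t \<cdot> \<iota> n" using t(1,2) by (simp add: assoc)
    also have "\<dots> = Zer C (Y n) H" using tri_comp_zero[OF T] t(1) by simp
    finally show "Sub C (q \<cdot> \<iota> n) (q \<cdot> \<iota> (Suc n) \<cdot> a n)
        = Zer C (Dom C (q \<cdot> \<iota> (Suc n) \<cdot> a n)) (Cod C (q \<cdot> \<iota> (Suc n) \<cdot> a n))" by simp
  qed simp_all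
  \<comment> \<open>\<open>c\<close> pushes the summands 0 to \<open>N\<close> along the tower into
    stage \<open>N\<close>, and neither \<open>q\<close> nor the arrows to \<open>X\<close> see the
    difference on them. It turns an arrow of finite support into an arrow to a single stage.\<close>
  have collapse: "\<exists>c. Dom C c = P \<and> Cod C c = Y N
      \<and> (\<forall>n\<le>N. q \<cdot> \<iota> N \<cdot> c \<cdot> \<iota> n = q \<cdot> \<iota> n \<and> \<phi> N \<cdot> c \<cdot> \<iota> n = \<phi> n)" for N
  proof (induction N)
    case 0
    obtain c where "Dom C c = P" "Cod C c = Y 0" "c \<cdot> \<iota> 0 = Idt C (Y 0)"
      using coproduct_projection[OF P UNIV_I, of 0] by metis
    then show ?case by (intro exI[of _ c]) (simp add: assoc)
  next
    case (Suc N)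
    then obtain c where c: "Dom C c = P" "Cod C c = Y N"
        "\<And>n. n \<le> N \<Longrightarrow> q \<cdot> \<iota> N \<cdot> c \<cdot> \<iota> n = q \<cdot> \<iota> n" "\<And>n. n \<le> N \<Longrightarrow> \<phi> N \<cdot> c \<cdot> \<iota> n = \<phi> n"
      by blast
    define f where "f n = (if n \<le> N then a N \<cdot> c \<cdot> \<iota> n else if n = Suc N then Idt C (Y (Suc N))
      else Zer C (Y n) (Y (Suc N)))" for n
    obtain d where d: "Dom C d = P" "Cod C d = Y (Suc N)" "\<And>n. d \<cdot> \<iota> n = f n"
      by (rule coproduct_extend[OF P, of f "Y (Suc N)"]) (use c(1,2) in \<open>auto simp: f_def\<close>)
    have "q \<cdot> \<iota> (Suc N) \<cdot> d \<cdot> \<iota> n = q \<cdot> \<iota> n \<and> \<phi> (Suc N) \<cdot> d \<cdot> \<iota> n = \<phi> n" if "n \<le> Suc N" for n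
    proof (cases "n = Suc N")
      case True
      then show ?thesis using d by (simp add: assoc f_def)
    next
      case False
      then have n: "n \<le> N" using that by simp
      have "q \<cdot> \<iota> (Suc N) \<cdot> d \<cdot> \<iota> n = q \<cdot> \<iota> (Suc N) \<cdot> a N \<cdot> c \<cdot> \<iota> n"
        using d c(1,2) n by (simp add: assoc f_def)
      also have "\<dots> = q \<cdot> \<iota> n" unfolding q\<iota>[symmetric] by (rule c(3)[OF n])
      finally have 1: "q \<cdot> \<iota> (Suc N) \<cdot> d \<cdot> \<iota> n = q \<cdot> \<iota> n" .
      have "\<phi> (Suc N) \<cdot> d \<cdot> \<iota> n = \<phi> (Suc N) \<cdot> a N \<cdot> c \<cdot> \<iota> n"
        using d c(1,2) n by (simp add: assoc f_def)
      also have "\<dots> = \<phi> n" unfolding \<phi>a by (rule c(4)[OF n])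
      finally show ?thesis using 1 by simp
    qed
    then show ?case using d(1,2) by blast
  qed
  have "isom C \<psi>"
  proof (rule detect_isom)
    fix v assume v: "Dom C v \<in> G" "Cod C v = Dom C \<psi>" "\<psi> \<cdot> v = Zer C (Dom C v) (Cod C \<psi>)"
    have SP': "is_coproduct C UNIV (\<lambda>n. So C (Y n)) (So C P) (\<lambda>n. Sa C (\<iota> n))"
      by (rule sus_coproduct[OF P])
    \<comment> \<open>\<open>r v\<close> is killed by \<open>Sa C t\<close>, the identity minus the
      shift of the suspended tower, and has finite support because its domain is a generator. Hence
      it is zero and \<open>v\<close> lifts along \<open>q\<close>.\<close>
    have "r \<cdot> v = Zer C (Dom C (r \<cdot> v)) (So C P)"
    proof (rule shift_injective[OF SP', of "Sa C t" "\<lambda>n. Sa C (a n)"])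
      show "Sa C t \<cdot> Sa C (\<iota> n) = Sub C (Sa C (\<iota> n)) (Sa C (\<iota> (Suc n)) \<cdot> Sa C (a n))" for n
      proof -
        have "Sa C t \<cdot> Sa C (\<iota> n) = Sa C (t \<cdot> \<iota> n)" using t(1,2) by (simp add: sus.F_comp)
        then show ?thesis unfolding t(3) by (simp add: sus.F_sub sus.F_comp)
      qed
      show "finite_support C UNIV (So C P) (\<lambda>n. Sa C (\<iota> n)) (r \<cdot> v)"
        by (rule small_object_finite_support[OF generators_small_object[OF v(1)] nat_small SP'])
          (use v \<psi>(1) in simp_all)
      have "Sa C t \<cdot> (r \<cdot> v) = Sa C t \<cdot> r \<cdot> v" using t(1,2) v(2) \<psi>(1) by (simp add: assoc)
      then show "Sa C t \<cdot> (r \<cdot> v) = Zer C (Dom C (r \<cdot> v)) (So C P)"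
        using tri_comp_zero3[OF T] t(2) v(2) \<psi>(1) by simp
    qed (use t(1,2) v(2) \<psi>(1) in simp_all)
    then have "r \<cdot> v = Zer C (Dom C v) (Cod C r)" using v(2) \<psi>(1) by simp
    then obtain x where x: "Dom C x = Dom C v" "Cod C x = P" "q \<cdot> x = v"
      by (rule tri_lift2[OF T, rotated]) (use v(2) \<psi>(1) in auto)
    have "finite_support C UNIV P \<iota> x"
      by (rule small_object_finite_support[OF generators_small_object[OF v(1)] nat_small P]) (use x in simp_all)
    then obtain F where F: "finite F" "supports C F P \<iota> x" by (auto simp: finite_support_def)
    \<comment> \<open>\<open>insert 0\<close> keeps \<open>Max\<close> meaningful for an empty
      support.\<close>
    define N where "N = Max (insert 0 F)"
    have N: "n \<le> N" if "n \<in> F" for n using that F(1) by (simp add: N_def)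
    obtain c where c: "Dom C c = P" "Cod C c = Y N"
        "\<And>n. n \<le> N \<Longrightarrow> q \<cdot> \<iota> N \<cdot> c \<cdot> \<iota> n = q \<cdot> \<iota> n" "\<And>n. n \<le> N \<Longrightarrow> \<phi> N \<cdot> c \<cdot> \<iota> n = \<phi> n"
      using collapse[of N] by blast
    have qx: "q \<cdot> \<iota> N \<cdot> c \<cdot> x = q \<cdot> x"
      by (rule supports_eq[OF F(2) x(2)]) (use c N in simp_all)
    have "\<phi> N \<cdot> c \<cdot> x = \<Phi> \<cdot> x"
      by (rule supports_eq[OF F(2) x(2)]) (use c N \<Phi> in simp_all)
    also have "\<dots> = Zer C (Dom C x) X"
      using v(3) \<psi> x by (metis \<psi>(3) assoc qr(1,2))
    finally have "\<phi> N \<cdot> (c \<cdot> x) = Zer C (Dom C (c \<cdot> x)) X" using c(1,2) x(2) by (simp add: assoc)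
    \<comment> \<open>\<open>c x\<close> becomes zero in \<open>X\<close>, so the next transition
      arrow kills it. By \<open>q\<iota>\<close>, passing to stage \<open>Suc N\<close> does not
      change \<open>q x\<close>, which is therefore zero.\<close>
    then have acx: "a N \<cdot> (c \<cdot> x) = Zer C (Dom C x) (Y (Suc N))"
      using kill[of "c \<cdot> x" N] v(1) x(1,2) c(1,2) by simp
    have "q \<cdot> x = q \<cdot> \<iota> (Suc N) \<cdot> (a N \<cdot> (c \<cdot> x))"
      unfolding qx[symmetric] q\<iota>[of N] using c(1,2) x(2) by (simp add: assoc)
    then show "v = Zer C (Dom C v) (Dom C \<psi>)" unfolding acx x(3) using x(1) \<psi>(1) by simp
  next
    fix v assume v: "Dom C v \<in> G" "Cod C v = Cod C \<psi>"
    then obtain w where w: "Dom C w = Dom C v" "Cod C w = Y 0" "\<phi> 0 \<cdot> w = v"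
      using cover[of v] \<psi>(2) by auto
    have "\<psi> \<cdot> (q \<cdot> \<iota> 0 \<cdot> w) = \<psi> \<cdot> q \<cdot> \<iota> 0 \<cdot> w" using \<psi>(1,2) w(2) by (simp add: assoc)
    also have "\<dots> = v" unfolding \<psi>(3) \<Phi>(3) by (rule w(3))
    finally show "\<exists>w. Dom C w = Dom C v \<and> Cod C w = Dom C \<psi> \<and> \<psi> \<cdot> w = v"
      using w(1,2) \<psi>(1) by (intro exI[of _ "q \<cdot> \<iota> 0 \<cdot> w"]) simp
  qed
  then show ?thesis using iso[of \<psi>] SH \<psi>(1,2) by simp
qed

section \<open>Factoring arrows out of compact objects\<close>

definition factors_through :: "('o \<Rightarrow> bool) \<Rightarrow> 'm \<Rightarrow> bool" where
  "factors_through T x \<longleftrightarrow> (\<exists>a b. Dom C a = Dom C x \<and> Cod C a = Dom C b \<and> Cod C b = Cod C x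
     \<and> T (Dom C b) \<and> b \<cdot> a = x)"

lemma factors_throughI:
  "Cod C a = Dom C b \<Longrightarrow> T (Dom C b) \<Longrightarrow> factors_through T (b \<cdot> a)"
  unfolding factors_through_def by (intro exI[of _ a] exI[of _ b]) simp

lemma factors_throughE:
  assumes "factors_through T x"
  obtains a b where "Dom C a = Dom C x" "Cod C a = Dom C b" "Cod C b = Cod C x" "T (Dom C b)" "b \<cdot> a = x"
  using assms by (auto simp: factors_through_def)

lemma factors_through_comp:
  assumes "factors_through T x" "Cod C x = Dom C g"
  shows "factors_through T (g \<cdot> x)"
proof -
  obtain a b where ab: "Dom C a = Dom C x" "Cod C a = Dom C b" "Cod C b = Cod C x" "T (Dom C b)" "b \<cdot> a = x"
    by (rule factors_throughE[OF assms(1)])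
  have "g \<cdot> x = (g \<cdot> b) \<cdot> a" using ab(1-3) assms(2) by (simp add: assoc flip: ab(5))
  then show ?thesis using ab(1-4) assms(2) factors_throughI[of a "g \<cdot> b" T] by simp
qed

text \<open>With \<open>x = b a\<close> and \<open>y = d c\<close>, the sum factors through a
  biproduct of the two middle objects, as \<open>i a + j c\<close> followed by
  \<open>b p + d q\<close>.\<close>

lemma factors_through_add:
  assumes x: "factors_through T x" and y: "factors_through T y"
    and xy: "Dom C x = Dom C y" "Cod C x = Cod C y"
    and T: "\<And>X Y i j p q. T X \<Longrightarrow> T Y \<Longrightarrow> Dom C i = X \<Longrightarrow> Dom C j = Y \<Longrightarrow> Cod C i = Dom C p \<Longrightarrow> Cod C j = Dom C p
      \<Longrightarrow> Dom C q = Dom C p \<Longrightarrow> Cod C p = X \<Longrightarrow> Cod C q = Y \<Longrightarrow> i \<cdot> p \<^bold>+ j \<cdot> q = Idt C (Dom C p) \<Longrightarrow> T (Dom C p)"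
  shows "factors_through T (x \<^bold>+ y)"
proof -
  obtain a b where ab: "Dom C a = Dom C x" "Cod C a = Dom C b" "Cod C b = Cod C x" "T (Dom C b)" "b \<cdot> a = x"
    by (rule factors_throughE[OF x])
  obtain c d where cd: "Dom C c = Dom C y" "Cod C c = Dom C d" "Cod C d = Cod C y" "T (Dom C d)" "d \<cdot> c = y"
    by (rule factors_throughE[OF y])
  obtain P i j p q where P: "Dom C i = Dom C b" "Cod C i = P" "Dom C j = Dom C d" "Cod C j = P"
      "Dom C p = P" "Cod C p = Dom C b" "Dom C q = P" "Cod C q = Dom C d"
    and eq: "p \<cdot> i = Idt C (Dom C b)" "q \<cdot> j = Idt C (Dom C d)" "q \<cdot> i = Zer C (Dom C b) (Dom C d)"
      "p \<cdot> j = Zer C (Dom C d) (Dom C b)" "i \<cdot> p \<^bold>+ j \<cdot> q = Idt C P"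
    using biproduct_exists[of "Dom C b" "Dom C d"] unfolding Mor_iff by blast
  have TP: "T P" using T[OF ab(4) cd(4), of i j p q] P eq(5) by simp
  note ty = ab(1-3) cd(1-3) P xy
  have l: "p \<cdot> (i \<cdot> a) = a" "q \<cdot> (j \<cdot> c) = c" "q \<cdot> (i \<cdot> a) = Zer C (Dom C a) (Dom C d)"
      "p \<cdot> (j \<cdot> c) = Zer C (Dom C c) (Dom C b)"
    using ty by (simp_all add: eq flip: assoc)
  have "(b \<cdot> p \<^bold>+ d \<cdot> q) \<cdot> (i \<cdot> a \<^bold>+ j \<cdot> c) = x \<^bold>+ y"
    using ty ab(5) cd(5) by (simp add: add_distrib_comp comp_distrib_add assoc l)
  then show ?thesis
    using factors_throughI[of "i \<cdot> a \<^bold>+ j \<cdot> c" "b \<cdot> p \<^bold>+ d \<cdot> q" T] TP ty by simp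
qed

text \<open>
  If \<open>T\<close> consists of compact objects and is closed under the triangulated structure, the objects \<open>A\<close>
  for which every arrow \<open>K \<rightarrow> A\<close> with \<open>K\<close> compact factors through \<open>T\<close> form a localizing class.
  Applied to the identity of a compact \<open>A\<close>, this exhibits \<open>A\<close> as a retract of an object of \<open>T\<close>.
\<close>

theorem small_object_factors:
  assumes gen: "\<And>X. X \<in> G \<Longrightarrow> T X" and zero: "\<And>Z. Idt C Z = Zer C Z Z \<Longrightarrow> T Z" and comp: "\<And>X. T X \<Longrightarrow> small_object U C X"
    and cone: "\<And>f g h. (f, g, h) \<in> Tri C \<Longrightarrow> T (Dom C f) \<Longrightarrow> T (Cod C f) \<Longrightarrow> T (Cod C g)"
    and iso: "\<And>f. isom C f \<Longrightarrow> T (Dom C f) \<Longrightarrow> T (Cod C f)"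
    and sus: "\<And>X. T X \<Longrightarrow> T (So C X)" and desus: "\<And>X. T (So C X) \<Longrightarrow> T X"
    and biprod: "\<And>X Y i j p q. T X \<Longrightarrow> T Y \<Longrightarrow> Dom C i = X \<Longrightarrow> Dom C j = Y \<Longrightarrow> Cod C i = Dom C p \<Longrightarrow> Cod C j = Dom C p
      \<Longrightarrow> Dom C q = Dom C p \<Longrightarrow> Cod C p = X \<Longrightarrow> Cod C q = Y \<Longrightarrow> i \<cdot> p \<^bold>+ j \<cdot> q = Idt C (Dom C p) \<Longrightarrow> T (Dom C p)"
    and x: "small_object U C (Dom C x)"
  shows "factors_through T x"
proof -
  define S where "S A \<longleftrightarrow> (\<forall>x. small_object U C (Dom C x) \<longrightarrow> Cod C x = A \<longrightarrow> factors_through T x)" for A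
  have SD: "factors_through T x" if "S A" "small_object U C (Dom C x)" "Cod C x = A" for A x
    using that by (simp add: S_def)
  have add: "factors_through T (a \<^bold>+ b)" if "factors_through T a" "factors_through T b"
      "Dom C a = Dom C b" "Cod C a = Cod C b" for a b
    by (rule factors_through_add[OF that]) (rule biprod)
  \<comment> \<open>The cone step meets arrows into the suspensions of \<open>Dom C f\<close> and
    \<open>Cod C f\<close>. A compact domain is, up to isomorphism, the suspension of a compact
    \<open>K\<close>, so such an arrow can be desuspended before \<open>S\<close> is
    applied.\<close>
  have S_sus: "S (So C A)" if A: "S A" for A
    unfolding S_def
  proof (intro allI impI)
    fix x assume x: "small_object U C (Dom C x)" "Cod C x = So C A"
    obtain K b where b: "Dom C b = So C K" "Cod C b = Dom C x" "isom C b" by (rule desuspension)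
    have "small_object U C (So C K)" by (rule small_object_isom[OF x(1) isom_inverse[OF b(3)]]) (use b in simp_all)
    then have K: "small_object U C K" by (rule small_object_desus)
    obtain y where y: "Dom C y = K" "Cod C y = A" "Sa C y = x \<cdot> b"
      by (rule sus_full[of "x \<cdot> b" K A]) (use x b in simp_all)
    obtain c d where cd: "Dom C c = Dom C y" "Cod C c = Dom C d" "Cod C d = Cod C y" "T (Dom C d)" "d \<cdot> c = y"
      by (rule factors_throughE[OF SD[OF A, of y]]) (use K y in auto)
    have "Sa C d \<cdot> (Sa C c \<cdot> inverse_arrow C b) = Sa C (d \<cdot> c) \<cdot> inverse_arrow C b"
      using cd(1-3) b y(1,2) by (simp add: sus.F_comp assoc)
    also have "\<dots> = x" using x b unfolding cd(5) y(3) by (simp add: assoc)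
    finally have "factors_through T (Sa C d \<cdot> (Sa C c \<cdot> inverse_arrow C b)) = factors_through T x" by simp
    then show "factors_through T x"
      using factors_throughI[of "Sa C c \<cdot> inverse_arrow C b" "Sa C d" T] sus[OF cd(4)] cd(1-3) b y(1) by simp
  qed
  have "S A" for A
  proof (rule generators_generate[of S])
    show "S X" if "X \<in> G" for X
      unfolding S_def
    proof (intro allI impI)
      fix x assume "Cod C x = X"
      then show "factors_through T x" using factors_throughI[of x "Idt C X" T] gen[OF that] by simp
    qed
  next
    show "coproduct_closed U C S"
      unfolding coproduct_closed_def
    proof (intro allI impI)
      fix I Y P \<iota> assume I: "I \<subseteq> U" "I \<prec> U" and P: "is_coproduct C I Y P \<iota>" and Y: "\<forall>i\<in>I. S (Y i)"
      show "S P"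
        unfolding S_def
      proof (intro allI impI)
        fix x assume x: "small_object U C (Dom C x)" "Cod C x = P"
        have fs: "finite_support C I P \<iota> x" using x I P unfolding small_object_def by blast
        show "factors_through T x"
        proof (rule finite_support_induct[OF P fs x(2)])
          obtain Z where "Idt C Z = Zer C Z Z" by (rule zero_obj)
          then have "factors_through T (Zer C Z P \<cdot> Zer C (Dom C x) Z)"
            by (intro factors_throughI) (simp_all add: zero)
          then show "factors_through T (Zer C (Dom C x) P)" by simp
        next
          fix a b assume "Dom C a = Dom C x" "Cod C a = P" "Dom C b = Dom C x" "Cod C b = P"
            and "factors_through T a" "factors_through T b"
          then show "factors_through T (a \<^bold>+ b)" by (intro add) auto
        next
          fix i p assume i: "i \<in> I" and p: "Dom C p = P" "Cod C p = Y i"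
          show "factors_through T (\<iota> i \<cdot> (p \<cdot> x))"
            by (rule factors_through_comp[OF SD[of "Y i"]]) (use i p x P Y in auto)
        qed
      qed
    qed
  next
    show "S (Cod C g)" if Tr: "(f, g, h) \<in> Tri C" and X: "S (Dom C f)" and Y: "S (Cod C f)" for f g h
      unfolding S_def
    proof (intro allI impI)
      note ty = tri_type[OF Tr]
      fix x assume x: "small_object U C (Dom C x)" "Cod C x = Cod C g"
      have SX: "S (So C (Dom C f))" and SY: "S (So C (Cod C f))" using S_sus[OF X] S_sus[OF Y] .
      obtain a b where ab: "Dom C a = Dom C x" "Cod C a = Dom C b" "Cod C b = Cod C h" "T (Dom C b)" "b \<cdot> a = h \<cdot> x"
        using factors_throughE[OF SD[OF SX, of "h \<cdot> x"]] x ty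
        by (metis cod_comp dom_comp)
      \<comment> \<open>\<open>d\<close> is the obstruction to lifting \<open>b\<close> along
        \<open>h\<close>, and it vanishes only after composition with \<open>a\<close>. The aim is
        an object of \<open>T\<close> over \<open>Dom C b\<close> through which \<open>a\<close>
        still passes and on which \<open>d\<close> vanishes.\<close>
      define d where "d = Sa C f \<cdot> b"
      have d: "Dom C d = Dom C b" "Cod C d = So C (Cod C f)" using ab ty by (simp_all add: d_def)
      have "d \<cdot> a = Sa C f \<cdot> h \<cdot> x" using ab x ty by (simp add: d_def assoc)
      then have da: "d \<cdot> a = Zer C (Dom C a) (Cod C d)"
        unfolding tri_comp_zero3[OF Tr] using d ab x ty by simp
      \<comment> \<open>Since \<open>d\<close> kills \<open>a\<close>, it extends to
        \<open>d'\<close> on the cone of \<open>a\<close>. This cone is compact, so \<open>S\<close>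
        at the suspension of \<open>Cod C f\<close> factors \<open>d'\<close> through an object of
        \<open>T\<close>.\<close>
      obtain a' a'' where TQ: "(a, a', a'') \<in> Tri C" using tri_exists by blast
      note tyQ = tri_type[OF TQ]
      have Q: "small_object U C (Cod C a')"
        by (rule small_object_cone[OF TQ _ _ coproducts]) (use ab x comp[OF ab(4)] in simp_all)
      obtain d' where d': "Dom C d' = Cod C a'" "Cod C d' = Cod C d" "d' \<cdot> a' = d"
        by (rule tri_extend[OF TQ _ da]) (use ab d in simp)
      obtain q r where qr: "Dom C q = Dom C d'" "Cod C q = Dom C r" "Cod C r = Cod C d'" "T (Dom C r)" "r \<cdot> q = d'"
        by (rule factors_throughE[OF SD[OF SY, of d']]) (use Q d d' in auto)
      define t where "t = q \<cdot> a'"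
      have t: "Dom C t = Dom C b" "Cod C t = Dom C r" using qr d' tyQ ab by (simp_all add: t_def)
      have rt: "r \<cdot> t = d" using qr(1-3) d' tyQ by (simp add: t_def qr(5) flip: assoc)
      have ta: "t \<cdot> a = Zer C (Dom C a) (Cod C t)"
        using qr(1-3) d'(1) tyQ tri_comp_zero[OF TQ] by (simp add: t_def assoc)
      \<comment> \<open>Both ends of \<open>t\<close> lie in \<open>T\<close>, hence so does its
        fibre, by rotation and desuspension. It is the object sought: \<open>a\<close> lifts to it
        because \<open>t a = 0\<close>, and \<open>d e = r t e = 0\<close>.\<close>
      obtain e s where TE: "(e, t, s) \<in> Tri C" by (rule fibre_exists)
      note tyE = tri_type[OF TE]
      have "T (Cod C s)"
        by (rule cone[OF tri_rotated[OF TE]]) (use t tyE ab(4) qr(4) in simp_all)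
      then have E: "T (Dom C e)" using desus tyE by simp
      have "d \<cdot> e = r \<cdot> (t \<cdot> e)" using t tyE by (simp add: assoc flip: rt)
      also have "\<dots> = Zer C (Dom C e) (So C (Cod C f))"
        unfolding tri_comp_zero[OF TE] using t qr(3) d' d by simp
      finally have "Sa C f \<cdot> (b \<cdot> e) = Zer C (Dom C (b \<cdot> e)) (So C (Cod C f))"
        using ab tyE t ty by (simp add: d_def assoc)
      then obtain z where z: "Dom C z = Dom C (b \<cdot> e)" "Cod C z = Dom C h" "h \<cdot> z = b \<cdot> e"
        by (rule tri_lift3[OF Tr, rotated]) (use ab tyE t in auto)
      obtain c where c: "Dom C c = Dom C a" "Cod C c = Dom C e" "e \<cdot> c = a"
        by (rule tri_lift[OF TE _ ta]) (use ab t tyE in auto)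
      have z': "Dom C z = Dom C e" "Cod C z = Cod C g" using z(1,2) ab tyE t ty by simp_all
      have "h \<cdot> (z \<cdot> c) = h \<cdot> z \<cdot> c" using z' c ty by (simp add: assoc)
      also have "\<dots> = b \<cdot> a" unfolding z(3) using c ab t tyE by (simp add: assoc)
      \<comment> \<open>\<open>x\<close> and \<open>z c\<close> agree after \<open>h\<close>, so
        their difference comes along \<open>g\<close> from \<open>Cod C f\<close>, where
        \<open>S\<close> applies. Thus \<open>x = g y + z c\<close>, and both terms factor through
        \<open>T\<close>.\<close>
      finally have "h \<cdot> Sub C x (z \<cdot> c) = Zer C (Dom C (Sub C x (z \<cdot> c))) (Cod C h)"
        using ab(1,5) x z' c(1,2) ty by (simp add: comp_sub)
      then obtain y where y: "Dom C y = Dom C (Sub C x (z \<cdot> c))" "Cod C y = Dom C g" "g \<cdot> y = Sub C x (z \<cdot> c)"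
        by (rule tri_lift2[OF Tr, rotated]) (use x z' c(1,2) ab(1) in auto)
      have y': "Dom C y = Dom C x" using y(1) z' c(1,2) x ab(1) by simp
      have "factors_through T (z \<cdot> c)" by (rule factors_throughI) (use z' c E in simp_all)
      moreover have "factors_through T (g \<cdot> y)"
        by (rule factors_through_comp[OF SD[OF Y]]) (use y y' x ty in simp_all)
      ultimately have "factors_through T (g \<cdot> y \<^bold>+ z \<cdot> c)"
        by (intro add) (use y(2) y' x z' c(1,2) ab(1) in auto)
      moreover have "g \<cdot> y \<^bold>+ z \<cdot> c = x"
        unfolding y(3) by (rule sub_add_cancel) (use x z' c(1,2) ab(1) in simp_all)
      ultimately show "factors_through T x" by simp
    qed
  next
    show "S (Cod C f)" if f: "isom C f" and X: "S (Dom C f)" for f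
      unfolding S_def
    proof (intro allI impI)
      fix x assume x: "small_object U C (Dom C x)" "Cod C x = Cod C f"
      have "factors_through T (f \<cdot> (inverse_arrow C f \<cdot> x))"
        by (rule factors_through_comp[OF SD[OF X]]) (use f x in simp_all)
      then show "factors_through T x" using f x by simp
    qed
  qed
  then show ?thesis using SD[OF _ x] by blast
qed

end

section \<open>Exactness and adjoint functors\<close>

text \<open>Exactness of \<open>Hom(V, F _)\<close> at the middle of every distinguished triangle;
  the other places are reached by rotating. Unlike preservation of triangles, it passes to both
  adjoints of an exact functor by transposition.\<close>

definition hom_exact ::
  "('o, 'm, 'y) tcat_scheme \<Rightarrow> ('p, 'n, 'z) acat_scheme \<Rightarrow> ('o, 'm, 'p, 'n) fctr \<Rightarrow> bool" where
  "hom_exact A B F \<longleftrightarrow> (\<forall>f g h v. (f, g, h) \<in> Tri A \<longrightarrow> Cod B v = Fo F (Cod A f)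
     \<longrightarrow> Fa F g \<cdot>\<^bsub>B\<^esub> v = Zer B (Dom B v) (Fo F (Cod A g))
     \<longrightarrow> (\<exists>x. Dom B x = Dom B v \<and> Cod B x = Fo F (Dom A f) \<and> Fa F f \<cdot>\<^bsub>B\<^esub> x = v))"

lemma hom_exactD:
  assumes "hom_exact A B F" "(f, g, h) \<in> Tri A" "Cod B v = Fo F (Cod A f)"
    "Fa F g \<cdot>\<^bsub>B\<^esub> v = Zer B (Dom B v) (Fo F (Cod A g))"
  obtains x where "Dom B x = Dom B v" "Cod B x = Fo F (Dom A f)" "Fa F f \<cdot>\<^bsub>B\<^esub> x = v"
  using assms unfolding hom_exact_def by blast

text \<open>The five lemma for \<open>Hom(V, F _) \<rightarrow> Hom(V, K _)\<close>.\<close>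

lemma isom_cone:
  assumes "triangulated_category A"
    and F: "additive_category_functor A B F" "hom_exact A B F"
    and K: "additive_category_functor A B K" "hom_exact A B K"
    and t: "natural A B F K t" and T: "(f, g, h) \<in> Tri A"
    and iso: "isom B (t (Dom A f))" "isom B (t (Cod A f))"
      "isom B (t (So A (Dom A f)))" "isom B (t (So A (Cod A f)))"
  shows "isom B (t (Cod A g))"
proof -
  interpret A: triangulated_category A by fact
  interpret F: additive_category_functor A B F by fact
  interpret K: additive_category_functor A B K by fact
  have tm [simp]: "Dom B (t X) = Fo F X" "Cod B (t X) = Fo K X" for X
    using t by (auto simp: natural_def F.B.Mor_iff)
  have nat: "t (Cod A f) \<cdot>\<^bsub>B\<^esub> Fa F f = Fa K f \<cdot>\<^bsub>B\<^esub> t (Dom A f)" for f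
    using t by (auto simp: natural_def A.Mor_iff)
  note ty [simp] = A.tri_type[OF T]
  note T2 = A.tri_rotated[OF T]
  note T3 = A.tri_rotated[OF T2]
  define X Y Z where "X = Dom A f" and "Y = Cod A f" and "Z = Cod A g"
  have d [simp]: "Dom A f = X" "Cod A f = Y" "Dom A g = Y" "Cod A g = Z" "Dom A h = Z" "Cod A h = So A X"
    by (simp_all add: X_def Y_def Z_def)
  have nf: "t Y \<cdot>\<^bsub>B\<^esub> Fa F f = Fa K f \<cdot>\<^bsub>B\<^esub> t X" and ng: "t Z \<cdot>\<^bsub>B\<^esub> Fa F g = Fa K g \<cdot>\<^bsub>B\<^esub> t Y"
    and nh: "t (So A X) \<cdot>\<^bsub>B\<^esub> Fa F h = Fa K h \<cdot>\<^bsub>B\<^esub> t Z"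
    and ns: "t (So A Y) \<cdot>\<^bsub>B\<^esub> Fa F (Sa A f) = Fa K (Sa A f) \<cdot>\<^bsub>B\<^esub> t (So A X)"
    using nat[of f] nat[of g] nat[of h] nat[of "Sa A f"] by simp_all
  have iso': "isom B (t X)" "isom B (t Y)" "isom B (t (So A X))" "isom B (t (So A Y))" using iso by simp_all
  have gf: "Fa F g \<cdot>\<^bsub>B\<^esub> Fa F f = Zer B (Fo F X) (Fo F Z)"
    using A.tri_comp_zero[OF T] by (simp flip: F.F_comp)
  have sh: "Fa K (Sa A f) \<cdot>\<^bsub>B\<^esub> Fa K h = Zer B (Fo K Z) (Fo K (So A Y))"
    using A.tri_comp_zero3[OF T] by (simp flip: K.F_comp)
  have cancel: "v = Zer B (Dom B v) (Fo F V)"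
    if "isom B (t V)" "Cod B v = Fo F V" "t V \<cdot>\<^bsub>B\<^esub> v = Zer B (Dom B v) (Fo K V)" for V v
    by (rule F.B.isom_cancel_left[OF that(1)]) (simp_all add: that)
  have "isom B (t Z)"
  proof (rule F.B.isom_yoneda_additive)
    fix v assume "Cod B v = Dom B (t Z)" and z: "t Z \<cdot>\<^bsub>B\<^esub> v = Zer B (Dom B v) (Cod B (t Z))"
    then have v: "Cod B v = Fo F Z" by simp
    have "t (So A X) \<cdot>\<^bsub>B\<^esub> (Fa F h \<cdot>\<^bsub>B\<^esub> v) = t (So A X) \<cdot>\<^bsub>B\<^esub> Fa F h \<cdot>\<^bsub>B\<^esub> v" using v by (simp add: F.B.assoc)
    also have "\<dots> = Zer B (Dom B v) (Fo K (So A X))" unfolding nh using v z by (simp add: F.B.assoc)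
    finally have "Fa F h \<cdot>\<^bsub>B\<^esub> v = Zer B (Dom B v) (Fo F (So A X))"
      using cancel[OF iso'(3), of "Fa F h \<cdot>\<^bsub>B\<^esub> v"] v by simp
    then obtain y where y: "Dom B y = Dom B v" "Cod B y = Fo F Y" "Fa F g \<cdot>\<^bsub>B\<^esub> y = v"
      using hom_exactD[OF F(2) T2, of v] v by auto
    have "Fa K g \<cdot>\<^bsub>B\<^esub> (t Y \<cdot>\<^bsub>B\<^esub> y) = Fa K g \<cdot>\<^bsub>B\<^esub> t Y \<cdot>\<^bsub>B\<^esub> y" using y(2) by (simp add: F.B.assoc)
    also have "\<dots> = Zer B (Dom B v) (Fo K Z)" unfolding ng[symmetric] using y z by (simp add: F.B.assoc)
    finally obtain x' where x': "Dom B x' = Dom B v" "Cod B x' = Fo K X" "Fa K f \<cdot>\<^bsub>B\<^esub> x' = t Y \<cdot>\<^bsub>B\<^esub> y"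
      using hom_exactD[OF K(2) T, of "t Y \<cdot>\<^bsub>B\<^esub> y"] y(1,2) by auto
    define x where "x = inverse_arrow B (t X) \<cdot>\<^bsub>B\<^esub> x'"
    have x: "Dom B x = Dom B v" "Cod B x = Fo F X" "t X \<cdot>\<^bsub>B\<^esub> x = x'" using iso'(1) x' by (simp_all add: x_def)
    have "t Y \<cdot>\<^bsub>B\<^esub> (Fa F f \<cdot>\<^bsub>B\<^esub> x) = t Y \<cdot>\<^bsub>B\<^esub> Fa F f \<cdot>\<^bsub>B\<^esub> x" using x(2) by (simp add: F.B.assoc)
    also have "\<dots> = t Y \<cdot>\<^bsub>B\<^esub> y" unfolding nf using x x' by (simp add: F.B.assoc)
    finally have "Fa F f \<cdot>\<^bsub>B\<^esub> x = y" by (rule F.B.isom_cancel_left[OF iso'(2)]) (use x y in simp_all)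
    then have "v = Fa F g \<cdot>\<^bsub>B\<^esub> Fa F f \<cdot>\<^bsub>B\<^esub> x" using x(2) by (simp add: F.B.assoc y(3))
    then show "v = Zer B (Dom B v) (Dom B (t Z))" unfolding gf using x(1,2) by simp
  next
    fix v assume "Cod B v = Cod B (t Z)"
    then have v: "Cod B v = Fo K Z" by simp
    define x where "x = inverse_arrow B (t (So A X)) \<cdot>\<^bsub>B\<^esub> (Fa K h \<cdot>\<^bsub>B\<^esub> v)"
    have x: "Dom B x = Dom B v" "Cod B x = Fo F (So A X)" "t (So A X) \<cdot>\<^bsub>B\<^esub> x = Fa K h \<cdot>\<^bsub>B\<^esub> v"
      using iso'(3) v by (simp_all add: x_def)
    have "t (So A Y) \<cdot>\<^bsub>B\<^esub> (Fa F (Sa A f) \<cdot>\<^bsub>B\<^esub> x) = t (So A Y) \<cdot>\<^bsub>B\<^esub> Fa F (Sa A f) \<cdot>\<^bsub>B\<^esub> x"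
      using x(2) by (simp add: F.B.assoc)
    also have "\<dots> = Fa K (Sa A f) \<cdot>\<^bsub>B\<^esub> Fa K h \<cdot>\<^bsub>B\<^esub> v" unfolding ns using x v by (simp add: F.B.assoc)
    also have "\<dots> = Zer B (Dom B v) (Fo K (So A Y))" unfolding sh using v by simp
    finally have "Fa F (Sa A f) \<cdot>\<^bsub>B\<^esub> x = Zer B (Dom B x) (Fo F (So A Y))"
      using cancel[OF iso'(4), of "Fa F (Sa A f) \<cdot>\<^bsub>B\<^esub> x"] x(1,2) by simp
    \<comment> \<open>The second arrow of \<open>T3\<close> carries the sign that rotation
      introduces.\<close>
    then have "Fa F (Neg A (Sa A f)) \<cdot>\<^bsub>B\<^esub> x = Zer B (Dom B x) (Fo F (So A Y))"
      using x(2) by (simp add: F.F_neg F.B.neg_comp)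
    then obtain z where z: "Dom B z = Dom B v" "Cod B z = Fo F Z" "Fa F h \<cdot>\<^bsub>B\<^esub> z = x"
      using hom_exactD[OF F(2) T3, of x] x(1,2) by auto
    have "Fa K h \<cdot>\<^bsub>B\<^esub> (t Z \<cdot>\<^bsub>B\<^esub> z) = Fa K h \<cdot>\<^bsub>B\<^esub> t Z \<cdot>\<^bsub>B\<^esub> z" using z(2) by (simp add: F.B.assoc)
    also have "\<dots> = Fa K h \<cdot>\<^bsub>B\<^esub> v" unfolding nh[symmetric] using z x(3) by (simp add: F.B.assoc)
    \<comment> \<open>\<open>z\<close> hits \<open>v\<close> up to an error that
      \<open>Fa K h\<close> kills; the error comes from an arrow \<open>y\<close> along
      \<open>g\<close>, which corrects \<open>z\<close>.\<close>
    finally have "Fa K h \<cdot>\<^bsub>B\<^esub> Sub B v (t Z \<cdot>\<^bsub>B\<^esub> z) = Zer B (Dom B v) (Fo K (So A X))"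
      using v z(1,2) by (simp add: F.B.comp_sub)
    then obtain y' where y': "Dom B y' = Dom B v" "Cod B y' = Fo K Y" "Fa K g \<cdot>\<^bsub>B\<^esub> y' = Sub B v (t Z \<cdot>\<^bsub>B\<^esub> z)"
      using hom_exactD[OF K(2) T2, of "Sub B v (t Z \<cdot>\<^bsub>B\<^esub> z)"] v z(1,2) by auto
    define y where "y = inverse_arrow B (t Y) \<cdot>\<^bsub>B\<^esub> y'"
    have y: "Dom B y = Dom B v" "Cod B y = Fo F Y" "t Y \<cdot>\<^bsub>B\<^esub> y = y'" using iso'(2) y' by (simp_all add: y_def)
    have "t Z \<cdot>\<^bsub>B\<^esub> (Fa F g \<cdot>\<^bsub>B\<^esub> y) = t Z \<cdot>\<^bsub>B\<^esub> Fa F g \<cdot>\<^bsub>B\<^esub> y" using y(2) by (simp add: F.B.assoc)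
    also have "\<dots> = Sub B v (t Z \<cdot>\<^bsub>B\<^esub> z)" unfolding ng using y y' by (simp add: F.B.assoc)
    finally have "t Z \<cdot>\<^bsub>B\<^esub> (Fa F g \<cdot>\<^bsub>B\<^esub> y \<^bold>+\<^bsub>B\<^esub> z) = v"
      using y(1,2) z(1,2) v by (simp add: F.B.comp_distrib_add F.B.sub_add_cancel)
    then show "\<exists>w. Dom B w = Dom B v \<and> Cod B w = Dom B (t Z) \<and> t Z \<cdot>\<^bsub>B\<^esub> w = v"
      using y(1,2) z(1,2) by (intro exI[of _ "Fa F g \<cdot>\<^bsub>B\<^esub> y \<^bold>+\<^bsub>B\<^esub> z"]) simp
  qed
  then show ?thesis by simp
qed

text \<open>The two sides are compared through their transposes, where naturality of the unit
  reduces the claim to additivity of \<open>R\<close> and bilinearity of composition.\<close>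

lemma additive_left_adjoint:
  assumes "adjoint_pair A B L R unit counit" and R: "additive_category_functor B A R"
  shows "additive_category_functor A B L"
proof -
  interpret adjoint_pair A B L R unit counit by fact
  interpret R: additive_category_functor B A R by fact
  show ?thesis
  proof unfold_locales
    have "Fa L (f \<^bold>+\<^bsub>A\<^esub> g) = Fa L f \<^bold>+\<^bsub>B\<^esub> Fa L g" if fg: "Dom A f = Dom A g" "Cod A f = Cod A g" for f g
    proof (rule unit_cancel[of _ "Dom A g"])
      have "Fa R (Fa L f \<^bold>+\<^bsub>B\<^esub> Fa L g) \<cdot>\<^bsub>A\<^esub> unit (Dom A g)
          = Fa R (Fa L f) \<cdot>\<^bsub>A\<^esub> unit (Dom A g) \<^bold>+\<^bsub>A\<^esub> Fa R (Fa L g) \<cdot>\<^bsub>A\<^esub> unit (Dom A g)"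
        using fg by (simp add: R.F_add R.B.add_distrib_comp)
      also have "\<dots> = unit (Cod A g) \<cdot>\<^bsub>A\<^esub> f \<^bold>+\<^bsub>A\<^esub> unit (Cod A g) \<cdot>\<^bsub>A\<^esub> g"
        using unit_natural[of f] unit_natural[of g] fg by simp
      also have "\<dots> = unit (Cod A g) \<cdot>\<^bsub>A\<^esub> (f \<^bold>+\<^bsub>A\<^esub> g)"
        using fg by (simp add: R.B.comp_distrib_add)
      also have "\<dots> = Fa R (Fa L (f \<^bold>+\<^bsub>A\<^esub> g)) \<cdot>\<^bsub>A\<^esub> unit (Dom A g)"
        using unit_natural[of "f \<^bold>+\<^bsub>A\<^esub> g"] fg by simp
      finally show "Fa R (Fa L (f \<^bold>+\<^bsub>A\<^esub> g)) \<cdot>\<^bsub>A\<^esub> unit (Dom A g)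
        = Fa R (Fa L f \<^bold>+\<^bsub>B\<^esub> Fa L g) \<cdot>\<^bsub>A\<^esub> unit (Dom A g)" ..
    qed (use fg in simp_all)
    then show "additive_functor A B L"
      using L.F_functor by (auto simp: additive_functor_def A.Mor_iff)
  qed
qed

lemma additive_right_adjoint:
  assumes "adjoint_pair A B L R unit counit" and L: "additive_category_functor A B L"
  shows "additive_category_functor B A R"
proof -
  interpret adjoint_pair A B L R unit counit by fact
  interpret L: additive_category_functor A B L by fact
  show ?thesis
  proof unfold_locales
    have "Fa R (f \<^bold>+\<^bsub>B\<^esub> g) = Fa R f \<^bold>+\<^bsub>A\<^esub> Fa R g" if fg: "Dom B f = Dom B g" "Cod B f = Cod B g" for f g
    proof (rule counit_cancel[of _ "Cod B g"])
      have "counit (Cod B g) \<cdot>\<^bsub>B\<^esub> Fa L (Fa R f \<^bold>+\<^bsub>A\<^esub> Fa R g)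
          = counit (Cod B g) \<cdot>\<^bsub>B\<^esub> Fa L (Fa R f) \<^bold>+\<^bsub>B\<^esub> counit (Cod B g) \<cdot>\<^bsub>B\<^esub> Fa L (Fa R g)"
        using fg by (simp add: L.F_add L.B.comp_distrib_add)
      also have "\<dots> = f \<cdot>\<^bsub>B\<^esub> counit (Dom B g) \<^bold>+\<^bsub>B\<^esub> g \<cdot>\<^bsub>B\<^esub> counit (Dom B g)"
        using counit_natural[of f] counit_natural[of g] fg by simp
      also have "\<dots> = (f \<^bold>+\<^bsub>B\<^esub> g) \<cdot>\<^bsub>B\<^esub> counit (Dom B g)"
        using fg by (simp add: L.B.add_distrib_comp)
      also have "\<dots> = counit (Cod B g) \<cdot>\<^bsub>B\<^esub> Fa L (Fa R (f \<^bold>+\<^bsub>B\<^esub> g))"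
        using counit_natural[of "f \<^bold>+\<^bsub>B\<^esub> g"] fg by simp
      finally show "counit (Cod B g) \<cdot>\<^bsub>B\<^esub> Fa L (Fa R (f \<^bold>+\<^bsub>B\<^esub> g))
        = counit (Cod B g) \<cdot>\<^bsub>B\<^esub> Fa L (Fa R f \<^bold>+\<^bsub>A\<^esub> Fa R g)" ..
    qed (use fg in simp_all)
    then show "additive_functor B A R"
      using R.F_functor by (auto simp: additive_functor_def B.Mor_iff)
  qed
qed

locale exact_category_functor = A: triangulated_category A + B: triangulated_category B
  for A :: "('o, 'm, 'y) tcat_scheme" and B :: "('p, 'n, 'z) tcat_scheme" +
  fixes F :: "('o, 'm, 'p, 'n) fctr" and s
  assumes F_exact: "exact_functor A B F s"
begin

sublocale additive_category_functor A B F
  using F_exact by unfold_locales (simp add: exact_functor_def)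

lemma sus_iso_dom [simp]: "Dom B (s X) = Fo F (So A X)" and sus_iso_cod [simp]: "Cod B (s X) = So B (Fo F X)"
  and sus_iso_isom [simp]: "isom B (s X)"
  using F_exact by (auto simp: exact_functor_def natural_def functor_comp_def B.Mor_iff)

lemma sus_iso_natural: "s (Cod A f) \<cdot>\<^bsub>B\<^esub> Fa F (Sa A f) = Sa B (Fa F f) \<cdot>\<^bsub>B\<^esub> s (Dom A f)"
  using F_exact by (auto simp: exact_functor_def natural_def functor_comp_def A.Mor_iff)

lemma F_tri: "(f, g, h) \<in> Tri A \<Longrightarrow> (Fa F f, Fa F g, s (Dom A f) \<cdot>\<^bsub>B\<^esub> Fa F h) \<in> Tri B"
  using F_exact by (auto simp: exact_functor_def)

lemma hom_exact: "hom_exact A B F"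
  unfolding hom_exact_def
proof (intro allI impI)
  fix f g h v
  assume T: "(f, g, h) \<in> Tri A" and v: "Cod B v = Fo F (Cod A f)"
    "Fa F g \<cdot>\<^bsub>B\<^esub> v = Zer B (Dom B v) (Fo F (Cod A g))"
  obtain x where "Dom B x = Dom B v" "Cod B x = Dom B (Fa F f)" "Fa F f \<cdot>\<^bsub>B\<^esub> x = v"
    by (rule B.tri_lift[OF F_tri[OF T], of v]) (use v in simp_all)
  then show "\<exists>x. Dom B x = Dom B v \<and> Cod B x = Fo F (Dom A f) \<and> Fa F f \<cdot>\<^bsub>B\<^esub> x = v" by auto
qed

end

lemma hom_exact_comp:
  assumes F: "exact_category_functor A B F s" and K: "hom_exact B E K"
  shows "hom_exact A E (K \<circ>\<^sub>F F)"
proof -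
  interpret exact_category_functor A B F s by fact
  show ?thesis
    unfolding hom_exact_def
  proof (intro allI impI)
    fix f g h v
    assume T: "(f, g, h) \<in> Tri A" and v: "Cod E v = Fo (K \<circ>\<^sub>F F) (Cod A f)"
      "Fa (K \<circ>\<^sub>F F) g \<cdot>\<^bsub>E\<^esub> v = Zer E (Dom E v) (Fo (K \<circ>\<^sub>F F) (Cod A g))"
    show "\<exists>x. Dom E x = Dom E v \<and> Cod E x = Fo (K \<circ>\<^sub>F F) (Dom A f) \<and> Fa (K \<circ>\<^sub>F F) f \<cdot>\<^bsub>E\<^esub> x = v"
      by (rule hom_exactD[OF K F_tri[OF T], of v]) (use v in \<open>auto simp: functor_comp_def\<close>)
  qed
qed

text \<open>Transposing \<open>v\<close> turns the lifting problem along \<open>Fa R f\<close> into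
  one along \<open>f\<close>, which \<open>tri_lift\<close> solves.\<close>

lemma hom_exact_right_adjoint:
  assumes "adjoint_pair A B L R unit counit" and L: "additive_category_functor A B L"
    and "triangulated_category B"
  shows "hom_exact B A R"
  unfolding hom_exact_def
proof (intro allI impI)
  interpret adjoint_pair A B L R unit counit by fact
  interpret L: additive_category_functor A B L by fact
  interpret B: triangulated_category B by fact
  fix f g h v
  assume T: "(f, g, h) \<in> Tri B" and v: "Cod A v = Fo R (Cod B f)"
    "Fa R g \<cdot>\<^bsub>A\<^esub> v = Zer A (Dom A v) (Fo R (Cod B g))"
  note ty = B.tri_type[OF T]
  have "g \<cdot>\<^bsub>B\<^esub> (counit (Cod B f) \<cdot>\<^bsub>B\<^esub> Fa L v) = g \<cdot>\<^bsub>B\<^esub> counit (Dom B g) \<cdot>\<^bsub>B\<^esub> Fa L v"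
    using v(1) ty by (simp add: B.assoc)
  also have "\<dots> = counit (Cod B g) \<cdot>\<^bsub>B\<^esub> Fa L (Fa R g) \<cdot>\<^bsub>B\<^esub> Fa L v"
    by (simp only: counit_natural)
  also have "\<dots> = counit (Cod B g) \<cdot>\<^bsub>B\<^esub> Fa L (Fa R g \<cdot>\<^bsub>A\<^esub> v)"
    using v(1) ty by (simp add: L.F_comp B.assoc)
  also have "\<dots> = Zer B (Fo L (Dom A v)) (Cod B g)" unfolding v(2) by simp
  finally have 0: "g \<cdot>\<^bsub>B\<^esub> (counit (Cod B f) \<cdot>\<^bsub>B\<^esub> Fa L v)
      = Zer B (Dom B (counit (Cod B f) \<cdot>\<^bsub>B\<^esub> Fa L v)) (Cod B g)" using v(1) by simp
  obtain x where x: "Dom B x = Dom B (counit (Cod B f) \<cdot>\<^bsub>B\<^esub> Fa L v)" "Cod B x = Dom B f"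
      "f \<cdot>\<^bsub>B\<^esub> x = counit (Cod B f) \<cdot>\<^bsub>B\<^esub> Fa L v"
    by (rule B.tri_lift[OF T _ 0]) (use v(1) in simp_all)
  have x1: "Dom B x = Fo L (Dom A v)" using x(1) v(1) by simp
  have "Fa R f \<cdot>\<^bsub>A\<^esub> (Fa R x \<cdot>\<^bsub>A\<^esub> unit (Dom A v)) = Fa R (f \<cdot>\<^bsub>B\<^esub> x) \<cdot>\<^bsub>A\<^esub> unit (Dom A v)"
    using x1 x(2) by (simp add: R.F_comp A.assoc)
  also have "\<dots> = v" unfolding x(3) by (rule transpose_left[OF v(1)])
  finally show "\<exists>x. Dom A x = Dom A v \<and> Cod A x = Fo R (Dom B f) \<and> Fa R f \<cdot>\<^bsub>A\<^esub> x = v"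
    using x1 x(2) by (intro exI[of _ "Fa R x \<cdot>\<^bsub>A\<^esub> unit (Dom A v)"]) simp
qed

text \<open>
  It suffices that the arrow \<open>g'\<close> of the triangle on \<open>L f\<close> factors through \<open>L g\<close>; the factorization is
  the transpose of a filler into the image of that triangle under \<open>R\<close>.
\<close>

lemma hom_exact_left_adjoint:
  assumes "adjoint_pair A B L R unit counit" and R: "exact_category_functor B A R s"
  shows "hom_exact A B L"
  unfolding hom_exact_def
proof (intro allI impI)
  interpret adjoint_pair A B L R unit counit by fact
  interpret R: exact_category_functor B A R s by fact
  fix f g h v
  assume T: "(f, g, h) \<in> Tri A" and v: "Cod B v = Fo L (Cod A f)"
    "Fa L g \<cdot>\<^bsub>B\<^esub> v = Zer B (Dom B v) (Fo L (Cod A g))"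
  note ty = R.B.tri_type[OF T]
  obtain g' h' where T': "(Fa L f, g', h') \<in> Tri B" using R.A.tri_exists by blast
  note ty' = R.A.tri_type[OF T']
  obtain c where c: "Dom A c = Cod A g" "Cod A c = Cod A (Fa R g')"
      "c \<cdot>\<^bsub>A\<^esub> g = Fa R g' \<cdot>\<^bsub>A\<^esub> unit (Cod A f)"
    by (rule R.B.tri_fill[OF T R.F_tri[OF T'], of "unit (Cod A f)" "unit (Dom A f)"])
      (use unit_natural[of f] in simp_all)
  define k where "k = counit (Cod B g') \<cdot>\<^bsub>B\<^esub> Fa L c"
  have k: "Dom B k = Fo L (Cod A g)" "Cod B k = Cod B g'" using c(1,2) by (simp_all add: k_def)
  have "k \<cdot>\<^bsub>B\<^esub> Fa L g = counit (Cod B g') \<cdot>\<^bsub>B\<^esub> Fa L (c \<cdot>\<^bsub>A\<^esub> g)"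
    using c(1,2) ty by (simp add: k_def L.F_comp B.assoc)
  also have "\<dots> = g'" unfolding c(3) by (rule transpose_right) (simp add: ty')
  finally have kg: "k \<cdot>\<^bsub>B\<^esub> Fa L g = g'" .
  have "g' \<cdot>\<^bsub>B\<^esub> v = k \<cdot>\<^bsub>B\<^esub> (Fa L g \<cdot>\<^bsub>B\<^esub> v)"
    using k v(1) ty by (simp add: B.assoc flip: kg)
  then have 0: "g' \<cdot>\<^bsub>B\<^esub> v = Zer B (Dom B v) (Cod B g')" unfolding v(2) using k by simp
  obtain x where "Dom B x = Dom B v" "Cod B x = Dom B (Fa L f)" "Fa L f \<cdot>\<^bsub>B\<^esub> x = v"
    by (rule R.A.tri_lift[OF T' _ 0]) (use v(1) in simp_all)
  then show "\<exists>x. Dom B x = Dom B v \<and> Cod B x = Fo L (Dom A f) \<and> Fa L f \<cdot>\<^bsub>B\<^esub> x = v" by auto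
qed

text \<open>Precomposition with the mate is the chain of bijections Hom(\<Sigma> L X, V) = Hom(L X,
  V') = Hom(X, R V') = Hom(\<Sigma> X, \<Sigma> R V') = Hom(\<Sigma> X, R \<Sigma> V') = Hom(L
  \<Sigma> X, V), where \<open>b\<close> identifies \<open>V\<close> with the suspension of
  \<open>V'\<close>. The equation \<open>eq\<close> records this.\<close>

lemma sus_mate_left_isom:
  assumes "adjoint_pair A B L R unit counit" and R: "exact_category_functor B A R s"
  shows "isom B (counit (So B (Fo L X)) \<cdot>\<^bsub>B\<^esub> Fa L (inverse_arrow A (s (Fo L X)) \<cdot>\<^bsub>A\<^esub> Sa A (unit X)))"
    (is "isom B ?m")
proof -
  interpret adjoint_pair A B L R unit counit by fact
  interpret R: exact_category_functor B A R s by fact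
  define w where "w = inverse_arrow A (s (Fo L X)) \<cdot>\<^bsub>A\<^esub> Sa A (unit X)"
  have w: "Dom A w = So A X" "Cod A w = Fo R (So B (Fo L X))" by (simp_all add: w_def)
  have m: "Dom B ?m = Fo L (So A X)" "Cod B ?m = So B (Fo L X)" by simp_all
  have mu: "Fa R ?m \<cdot>\<^bsub>A\<^esub> unit (So A X) = w"
    using transpose_left[OF w(2)] by (simp add: w_def)
  have eq: "s V' \<cdot>\<^bsub>A\<^esub> (Fa R (inverse_arrow B b) \<cdot>\<^bsub>A\<^esub> (Fa R (g \<cdot>\<^bsub>B\<^esub> ?m) \<cdot>\<^bsub>A\<^esub> unit (So A X)))
      = Sa A (Fa R k \<cdot>\<^bsub>A\<^esub> unit X)"
    if g: "Dom B g = So B (Fo L X)" "Cod B g = V" and b: "Dom B b = So B V'" "Cod B b = V" "isom B b"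
      and k: "Dom B k = Fo L X" "Cod B k = V'" "Sa B k = inverse_arrow B b \<cdot>\<^bsub>B\<^esub> g" for g b V V' k
  proof -
    have "Fa R (g \<cdot>\<^bsub>B\<^esub> ?m) \<cdot>\<^bsub>A\<^esub> unit (So A X) = Fa R g \<cdot>\<^bsub>A\<^esub> (Fa R ?m \<cdot>\<^bsub>A\<^esub> unit (So A X))"
      using g(1) by (simp add: R.F_comp A.assoc)
    then have "Fa R (inverse_arrow B b) \<cdot>\<^bsub>A\<^esub> (Fa R (g \<cdot>\<^bsub>B\<^esub> ?m) \<cdot>\<^bsub>A\<^esub> unit (So A X)) = Fa R (Sa B k) \<cdot>\<^bsub>A\<^esub> w"
      unfolding mu k(3) using g b w by (simp add: R.F_comp A.assoc)
    then have "s V' \<cdot>\<^bsub>A\<^esub> (Fa R (inverse_arrow B b) \<cdot>\<^bsub>A\<^esub> (Fa R (g \<cdot>\<^bsub>B\<^esub> ?m) \<cdot>\<^bsub>A\<^esub> unit (So A X)))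
        = s V' \<cdot>\<^bsub>A\<^esub> Fa R (Sa B k) \<cdot>\<^bsub>A\<^esub> w"
      using k(1,2) w by (simp add: A.assoc)
    also have "\<dots> = Sa A (Fa R k) \<cdot>\<^bsub>A\<^esub> s (Fo L X) \<cdot>\<^bsub>A\<^esub> w"
      using R.sus_iso_natural[of k] k(1,2) by simp
    also have "\<dots> = Sa A (Fa R k \<cdot>\<^bsub>A\<^esub> unit X)"
      using k(1,2) by (simp add: w_def A.assoc R.B.sus.F_comp)
    finally show ?thesis .
  qed
  show ?thesis
  proof (rule B.isom_coyoneda)
    fix g g' assume gg': "Cod B g = Cod B g'" "Dom B g = Cod B ?m" "Dom B g' = Cod B ?m" "g \<cdot>\<^bsub>B\<^esub> ?m = g' \<cdot>\<^bsub>B\<^esub> ?m"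
    obtain V' b where b: "Dom B b = So B V'" "Cod B b = Cod B g'" "isom B b"
      by (rule R.A.desuspension)
    obtain k where k: "Dom B k = Fo L X" "Cod B k = V'" "Sa B k = inverse_arrow B b \<cdot>\<^bsub>B\<^esub> g"
      by (rule R.A.sus_full[of "inverse_arrow B b \<cdot>\<^bsub>B\<^esub> g" "Fo L X" V']) (use gg'(1-3) b in simp_all)
    obtain k' where k': "Dom B k' = Fo L X" "Cod B k' = V'" "Sa B k' = inverse_arrow B b \<cdot>\<^bsub>B\<^esub> g'"
      by (rule R.A.sus_full[of "inverse_arrow B b \<cdot>\<^bsub>B\<^esub> g'" "Fo L X" V']) (use gg'(1-3) b in simp_all)
    have "Sa A (Fa R k \<cdot>\<^bsub>A\<^esub> unit X) = Sa A (Fa R k' \<cdot>\<^bsub>A\<^esub> unit X)"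
      unfolding eq[OF gg'(2)[unfolded m] gg'(1) b k, symmetric] eq[OF gg'(3)[unfolded m] refl b k', symmetric] gg'(4) ..
    then have "Fa R k \<cdot>\<^bsub>A\<^esub> unit X = Fa R k' \<cdot>\<^bsub>A\<^esub> unit X"
      by (rule R.B.sus_faithful[rotated 2]) (use k k' in simp_all)
    then have "k = k'" by (rule unit_cancel[rotated 3]) (use k k' in simp_all)
    then have "inverse_arrow B b \<cdot>\<^bsub>B\<^esub> g = inverse_arrow B b \<cdot>\<^bsub>B\<^esub> g'" using k(3) k'(3) by simp
    then show "g = g'"
      by (rule B.isom_cancel_left[OF B.isom_inverse[OF b(3)]]) (use b gg'(1) in simp_all)
  next
    fix v assume v': "Dom B v = Dom B ?m"
    then have v: "Dom B v = Fo L (So A X)" by simp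
    obtain V' b where b: "Dom B b = So B V'" "Cod B b = Cod B v" "isom B b"
      by (rule R.A.desuspension)
    define y where "y = s V' \<cdot>\<^bsub>A\<^esub> (Fa R (inverse_arrow B b) \<cdot>\<^bsub>A\<^esub> (Fa R v \<cdot>\<^bsub>A\<^esub> unit (So A X)))"
    have y: "Dom A y = So A X" "Cod A y = So A (Fo R V')" using v b by (simp_all add: y_def)
    obtain x where x: "Dom A x = X" "Cod A x = Fo R V'" "Sa A x = y" by (rule R.B.sus_full[OF y])
    define k where "k = counit V' \<cdot>\<^bsub>B\<^esub> Fa L x"
    have k: "Dom B k = Fo L X" "Cod B k = V'" "Fa R k \<cdot>\<^bsub>A\<^esub> unit X = x"
      using x transpose_left[OF x(2)] by (simp_all add: k_def)
    define g where "g = b \<cdot>\<^bsub>B\<^esub> Sa B k"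
    have g: "Dom B g = So B (Fo L X)" "Cod B g = Cod B v" "Sa B k = inverse_arrow B b \<cdot>\<^bsub>B\<^esub> g"
      using k b by (simp_all add: g_def)
    have "s V' \<cdot>\<^bsub>A\<^esub> (Fa R (inverse_arrow B b) \<cdot>\<^bsub>A\<^esub> (Fa R (g \<cdot>\<^bsub>B\<^esub> ?m) \<cdot>\<^bsub>A\<^esub> unit (So A X))) = y"
      unfolding eq[OF g(1,2) b k(1,2) g(3)] k(3) by (rule x(3))
    then have "Fa R (inverse_arrow B b) \<cdot>\<^bsub>A\<^esub> (Fa R (g \<cdot>\<^bsub>B\<^esub> ?m) \<cdot>\<^bsub>A\<^esub> unit (So A X))
        = Fa R (inverse_arrow B b) \<cdot>\<^bsub>A\<^esub> (Fa R v \<cdot>\<^bsub>A\<^esub> unit (So A X))"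
      unfolding y_def by (rule A.isom_cancel_left[OF R.sus_iso_isom]) (use g(1,2) b v in simp_all)
    then have "Fa R (g \<cdot>\<^bsub>B\<^esub> ?m) \<cdot>\<^bsub>A\<^esub> unit (So A X) = Fa R v \<cdot>\<^bsub>A\<^esub> unit (So A X)"
      by (rule A.isom_cancel_left[OF R.F_isom[OF B.isom_inverse[OF b(3)]]]) (use g(1,2) b v in simp_all)
    then have "g \<cdot>\<^bsub>B\<^esub> ?m = v" by (rule unit_cancel[rotated 3]) (use g(1,2) v in simp_all)
    then show "\<exists>w. Cod B w = Cod B v \<and> Dom B w = Cod B ?m \<and> w \<cdot>\<^bsub>B\<^esub> ?m = v"
      by (intro exI[of _ g] conjI) (simp_all only: g(1,2) m)
  qed
qed

text \<open>Dual to the previous chain: Hom(V, \<Sigma> R X) = Hom(V', R X) = Hom(L V', X) =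
  Hom(\<Sigma> L V', \<Sigma> X) = Hom(L \<Sigma> V', \<Sigma> X) = Hom(V, R \<Sigma> X), now
  desuspending the source \<open>V\<close>.\<close>

lemma sus_mate_right_isom:
  assumes "adjoint_pair A B L R unit counit" and L: "exact_category_functor A B L s"
  shows "isom A (Fa R (Sa B (counit X) \<cdot>\<^bsub>B\<^esub> s (Fo R X)) \<cdot>\<^bsub>A\<^esub> unit (So A (Fo R X)))"
    (is "isom A ?n")
proof -
  interpret adjoint_pair A B L R unit counit by fact
  interpret L: exact_category_functor A B L s by fact
  define w where "w = Sa B (counit X) \<cdot>\<^bsub>B\<^esub> s (Fo R X)"
  have w: "Dom B w = Fo L (So A (Fo R X))" "Cod B w = So B X" by (simp_all add: w_def)
  have n: "Dom A ?n = So A (Fo R X)" "Cod A ?n = Fo R (So B X)" by simp_all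
  have cn: "counit (So B X) \<cdot>\<^bsub>B\<^esub> Fa L ?n = w"
    using transpose_right[OF w(1)] by (simp add: w_def)
  have eq: "counit (So B X) \<cdot>\<^bsub>B\<^esub> Fa L (?n \<cdot>\<^bsub>A\<^esub> v) \<cdot>\<^bsub>B\<^esub> Fa L b
      = Sa B (counit X \<cdot>\<^bsub>B\<^esub> Fa L k) \<cdot>\<^bsub>B\<^esub> s V'"
    if v: "Dom A v = V" "Cod A v = So A (Fo R X)" and b: "Dom A b = So A V'" "Cod A b = V" "isom A b"
      and k: "Dom A k = V'" "Cod A k = Fo R X" "Sa A k = v \<cdot>\<^bsub>A\<^esub> b" for v b V V' k
  proof -
    have "counit (So B X) \<cdot>\<^bsub>B\<^esub> Fa L (?n \<cdot>\<^bsub>A\<^esub> v) \<cdot>\<^bsub>B\<^esub> Fa L b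
        = counit (So B X) \<cdot>\<^bsub>B\<^esub> Fa L ?n \<cdot>\<^bsub>B\<^esub> Fa L (v \<cdot>\<^bsub>A\<^esub> b)"
      using v b by (simp add: L.F_comp B.assoc)
    also have "\<dots> = w \<cdot>\<^bsub>B\<^esub> Fa L (Sa A k)" unfolding cn k(3) ..
    also have "\<dots> = Sa B (counit X) \<cdot>\<^bsub>B\<^esub> (s (Cod A k) \<cdot>\<^bsub>B\<^esub> Fa L (Sa A k))"
      using k(1,2) by (simp add: w_def B.assoc)
    also have "\<dots> = Sa B (counit X) \<cdot>\<^bsub>B\<^esub> (Sa B (Fa L k) \<cdot>\<^bsub>B\<^esub> s (Dom A k))"
      by (simp only: L.sus_iso_natural)
    also have "\<dots> = Sa B (counit X \<cdot>\<^bsub>B\<^esub> Fa L k) \<cdot>\<^bsub>B\<^esub> s V'"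
      using k(1,2) by (simp add: L.B.sus.F_comp B.assoc)
    finally show ?thesis .
  qed
  show ?thesis
  proof (rule A.isom_yoneda)
    fix v v' assume vv': "Dom A v = Dom A v'" "Cod A v = Dom A ?n" "Cod A v' = Dom A ?n" "?n \<cdot>\<^bsub>A\<^esub> v = ?n \<cdot>\<^bsub>A\<^esub> v'"
    obtain V' b where b: "Dom A b = So A V'" "Cod A b = Dom A v'" "isom A b"
      by (rule L.A.desuspension)
    obtain k where k: "Dom A k = V'" "Cod A k = Fo R X" "Sa A k = v \<cdot>\<^bsub>A\<^esub> b"
      by (rule L.A.sus_full[of "v \<cdot>\<^bsub>A\<^esub> b" V' "Fo R X"]) (use vv'(1-3) b in simp_all)
    obtain k' where k': "Dom A k' = V'" "Cod A k' = Fo R X" "Sa A k' = v' \<cdot>\<^bsub>A\<^esub> b"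
      by (rule L.A.sus_full[of "v' \<cdot>\<^bsub>A\<^esub> b" V' "Fo R X"]) (use vv'(1-3) b in simp_all)
    have "Sa B (counit X \<cdot>\<^bsub>B\<^esub> Fa L k) \<cdot>\<^bsub>B\<^esub> s V' = Sa B (counit X \<cdot>\<^bsub>B\<^esub> Fa L k') \<cdot>\<^bsub>B\<^esub> s V'"
      unfolding eq[OF vv'(1) vv'(2)[unfolded n] b k, symmetric] eq[OF refl vv'(3)[unfolded n] b k', symmetric] vv'(4) ..
    then have "Sa B (counit X \<cdot>\<^bsub>B\<^esub> Fa L k) = Sa B (counit X \<cdot>\<^bsub>B\<^esub> Fa L k')"
      by (rule B.isom_cancel_right[OF L.sus_iso_isom]) (use k k' in simp_all)
    then have "counit X \<cdot>\<^bsub>B\<^esub> Fa L k = counit X \<cdot>\<^bsub>B\<^esub> Fa L k'"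
      by (rule L.B.sus_faithful[rotated 2]) (use k k' in simp_all)
    then have "k = k'" by (rule counit_cancel[rotated 3]) (use k k' in simp_all)
    then have "v \<cdot>\<^bsub>A\<^esub> b = v' \<cdot>\<^bsub>A\<^esub> b" using k(3) k'(3) by simp
    then show "v = v'"
      by (rule A.isom_cancel_right[OF b(3)]) (use b vv'(1) in simp_all)
  next
    fix v assume v': "Cod A v = Cod A ?n"
    then have v: "Cod A v = Fo R (So B X)" by simp
    obtain V' b where b: "Dom A b = So A V'" "Cod A b = Dom A v" "isom A b"
      by (rule L.A.desuspension)
    define y where "y = counit (So B X) \<cdot>\<^bsub>B\<^esub> Fa L v \<cdot>\<^bsub>B\<^esub> Fa L b \<cdot>\<^bsub>B\<^esub> inverse_arrow B (s V')"
    have y: "Dom B y = So B (Fo L V')" "Cod B y = So B X" using v b by (simp_all add: y_def)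
    obtain x where x: "Dom B x = Fo L V'" "Cod B x = X" "Sa B x = y" by (rule L.B.sus_full[OF y])
    define k where "k = Fa R x \<cdot>\<^bsub>A\<^esub> unit V'"
    have k: "Dom A k = V'" "Cod A k = Fo R X" "counit X \<cdot>\<^bsub>B\<^esub> Fa L k = x"
      using x transpose_right[OF x(1)] by (simp_all add: k_def)
    define g where "g = Sa A k \<cdot>\<^bsub>A\<^esub> inverse_arrow A b"
    have g: "Dom A g = Dom A v" "Cod A g = So A (Fo R X)" "Sa A k = g \<cdot>\<^bsub>A\<^esub> b"
      using k b by (simp_all add: g_def A.assoc)
    have "counit (So B X) \<cdot>\<^bsub>B\<^esub> Fa L (?n \<cdot>\<^bsub>A\<^esub> g) \<cdot>\<^bsub>B\<^esub> Fa L b = y \<cdot>\<^bsub>B\<^esub> s V'"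
      unfolding eq[OF g(1,2) b k(1,2) g(3)] k(3) x(3) ..
    also have "\<dots> = counit (So B X) \<cdot>\<^bsub>B\<^esub> Fa L v \<cdot>\<^bsub>B\<^esub> Fa L b"
      using v b by (simp add: y_def B.assoc)
    finally have "counit (So B X) \<cdot>\<^bsub>B\<^esub> Fa L (?n \<cdot>\<^bsub>A\<^esub> g) = counit (So B X) \<cdot>\<^bsub>B\<^esub> Fa L v"
      by (rule B.isom_cancel_right[OF L.F_isom[OF b(3)]]) (use g(1,2) b v in simp_all)
    then have "?n \<cdot>\<^bsub>A\<^esub> g = v" by (rule counit_cancel[rotated 3]) (use g(1,2) v in simp_all)
    then show "\<exists>w. Dom A w = Dom A v \<and> Cod A w = Dom A ?n \<and> ?n \<cdot>\<^bsub>A\<^esub> w = v"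
      by (intro exI[of _ g] conjI) (simp_all only: g(1,2) n)
  qed
qed

section \<open>Closed symmetric monoidal categories\<close>

context closed_symmetric_monoidal_category begin

lemma dom_tensor [simp]: "Dom C (f \<otimes>\<^sub>a g) = Dom C f \<otimes>\<^sub>o Dom C g"
  and cod_tensor [simp]: "Cod C (f \<otimes>\<^sub>a g) = Cod C f \<otimes>\<^sub>o Cod C g"
  using tensor_in[of f "Dom C f" "Cod C f" g "Dom C g" "Cod C g"] by (auto simp: Mor_iff)

lemma tensor_interchange:
  "Cod C f = Dom C f' \<Longrightarrow> Cod C g = Dom C g' \<Longrightarrow> (f' \<otimes>\<^sub>a g') \<cdot> (f \<otimes>\<^sub>a g) = (f' \<cdot> f) \<otimes>\<^sub>a (g' \<cdot> g)"
  by (rule tensor_comp[symmetric]) (auto simp: Mor_iff)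

lemma structure_arrows [simp]:
  "Dom C (Assoc C X Y Z) = X \<otimes>\<^sub>o Y \<otimes>\<^sub>o Z" "Cod C (Assoc C X Y Z) = X \<otimes>\<^sub>o (Y \<otimes>\<^sub>o Z)"
  "Dom C (Lunit C X) = Unit C \<otimes>\<^sub>o X" "Cod C (Lunit C X) = X"
  "Dom C (Runit C X) = X \<otimes>\<^sub>o Unit C" "Cod C (Runit C X) = X"
  "Dom C (Symm C X Y) = X \<otimes>\<^sub>o Y" "Cod C (Symm C X Y) = Y \<otimes>\<^sub>o X"
  "Dom C (Eval C X Y) = Ihom C X Y \<otimes>\<^sub>o X" "Cod C (Eval C X Y) = Y"
  using assoc_in[of X Y Z] lunit_in[of X] runit_in[of X] symm_in[of X Y] eval_in[of X Y]
  by (auto simp: Mor_iff)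

lemmas tensor_ident_simp [simp] = tensor_ident
lemmas structure_isoms [simp] = assoc_isom lunit_isom runit_isom

lemma tensor_left_simps [simp]: "Fo (tensor_left C X) Y = X \<otimes>\<^sub>o Y" "Fa (tensor_left C X) f = Idt C X \<otimes>\<^sub>a f"
  by (simp_all add: tensor_left_def)

lemma tensor_right_simps [simp]: "Fo (tensor_right C X) Y = Y \<otimes>\<^sub>o X" "Fa (tensor_right C X) f = f \<otimes>\<^sub>a Idt C X"
  by (simp_all add: tensor_right_def)

lemma tensor_left_functor: "category_functor C C (tensor_left C X)"
  by unfold_locales (auto simp: is_functor_def Mor_iff tensor_interchange)

lemma tensor_right_functor: "category_functor C C (tensor_right C X)"
  by unfold_locales (auto simp: is_functor_def Mor_iff tensor_interchange)

lemma curry_arrow: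
  assumes "Dom C g = Z \<otimes>\<^sub>o X" "Cod C g = Y"
  shows "Dom C (curry_arrow C Z X Y g) = Z" "Cod C (curry_arrow C Z X Y g) = Ihom C X Y"
    "Eval C X Y \<cdot> (curry_arrow C Z X Y g \<otimes>\<^sub>a Idt C X) = g"
proof -
  have "\<exists>!h. h \<in> Mor C Z (Ihom C X Y) \<and> Eval C X Y \<cdot> (h \<otimes>\<^sub>a Idt C X) = g"
    by (rule eval_universal) (simp add: Mor_iff assms)
  from theI'[OF this]
  show "Dom C (curry_arrow C Z X Y g) = Z" "Cod C (curry_arrow C Z X Y g) = Ihom C X Y"
    "Eval C X Y \<cdot> (curry_arrow C Z X Y g \<otimes>\<^sub>a Idt C X) = g"
    by (simp_all add: curry_arrow_def Mor_iff)
qed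

lemma eval_lift:
  assumes "Dom C g = Z \<otimes>\<^sub>o X" "Cod C g = Y"
  obtains h where "Dom C h = Z" "Cod C h = Ihom C X Y" "Eval C X Y \<cdot> (h \<otimes>\<^sub>a Idt C X) = g"
  by (rule that[OF curry_arrow[OF assms]])

lemma eval_cancel:
  assumes "Dom C h = Dom C h'" "Cod C h = Ihom C X Y" "Cod C h' = Ihom C X Y"
    "Eval C X Y \<cdot> (h \<otimes>\<^sub>a Idt C X) = Eval C X Y \<cdot> (h' \<otimes>\<^sub>a Idt C X)"
  shows "h = h'"
proof -
  have "\<exists>!k. k \<in> Mor C (Dom C h') (Ihom C X Y) \<and> Eval C X Y \<cdot> (k \<otimes>\<^sub>a Idt C X) = Eval C X Y \<cdot> (h' \<otimes>\<^sub>a Idt C X)"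
    by (rule eval_universal) (simp add: Mor_iff assms(3))
  moreover have "h \<in> Mor C (Dom C h') (Ihom C X Y)" "h' \<in> Mor C (Dom C h') (Ihom C X Y)"
    using assms(1-3) by (simp_all add: Mor_iff)
  ultimately show ?thesis using assms(4) by blast
qed

lemma tensor_right_left_adjoint: "left_adjoint C C (tensor_right C X)"
proof (rule left_adjointI)
  fix V
  have "\<exists>h. Dom C h = Z \<and> Cod C h = Ihom C X V \<and> Eval C X V \<cdot> (h \<otimes>\<^sub>a Idt C X) = g"
    if "Dom C g = Z \<otimes>\<^sub>o X" "Cod C g = V" for g Z
    using curry_arrow[OF that] by blast
  then show "\<exists>Q e. Dom C e = Fo (tensor_right C X) Q \<and> Cod C e = V
      \<and> (\<forall>g Z. Dom C g = Fo (tensor_right C X) Z \<longrightarrow> Cod C g = V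
          \<longrightarrow> (\<exists>h. Dom C h = Z \<and> Cod C h = Q \<and> e \<cdot> Fa (tensor_right C X) h = g))
      \<and> (\<forall>h h'. Dom C h = Dom C h' \<longrightarrow> Cod C h = Q \<longrightarrow> Cod C h' = Q
          \<longrightarrow> e \<cdot> Fa (tensor_right C X) h = e \<cdot> Fa (tensor_right C X) h' \<longrightarrow> h = h')"
    using eval_cancel by (intro exI[of _ "Ihom C X V"] exI[of _ "Eval C X V"]) auto
qed

lemma symm_natural': "Symm C (Cod C f) (Cod C g) \<cdot> (f \<otimes>\<^sub>a g) = (g \<otimes>\<^sub>a f) \<cdot> Symm C (Dom C f) (Dom C g)"
  by (rule symm_natural) (simp_all add: Mor_iff)

lemma symm_isom [simp]: "isom C (Symm C X Y)"
  by (rule isomI[of "Symm C Y X"]) (simp_all add: symm_symm)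

text \<open>The couniversal arrow is evaluation after the symmetry, and moving the symmetry across
  reduces both conditions to those for tensoring on the right.\<close>

lemma tensor_left_left_adjoint: "left_adjoint C C (tensor_left C X)"
proof (rule left_adjointI)
  fix V
  have eq: "Eval C X V \<cdot> Symm C X (Ihom C X V) \<cdot> (Idt C X \<otimes>\<^sub>a h)
      = Eval C X V \<cdot> (h \<otimes>\<^sub>a Idt C X) \<cdot> Symm C X (Dom C h)" if "Cod C h = Ihom C X V" for h
    using symm_natural'[of "Idt C X" h] that by (simp add: assoc)
  have "\<exists>h. Dom C h = Z \<and> Cod C h = Ihom C X V \<and> Eval C X V \<cdot> Symm C X (Ihom C X V) \<cdot> (Idt C X \<otimes>\<^sub>a h) = g"
    if g: "Dom C g = X \<otimes>\<^sub>o Z" "Cod C g = V" for g Z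
  proof -
    obtain h where h: "Dom C h = Z" "Cod C h = Ihom C X V" "Eval C X V \<cdot> (h \<otimes>\<^sub>a Idt C X) = g \<cdot> Symm C Z X"
      by (rule eval_lift[of "g \<cdot> Symm C Z X" Z X V]) (use g in simp_all)
    have "g \<cdot> Symm C Z X \<cdot> Symm C X Z = g" using g by (simp add: assoc symm_symm)
    then show ?thesis using h eq[OF h(2)] by auto
  qed
  moreover have "h = h'" if h: "Dom C h = Dom C h'" "Cod C h = Ihom C X V" "Cod C h' = Ihom C X V"
    "Eval C X V \<cdot> Symm C X (Ihom C X V) \<cdot> (Idt C X \<otimes>\<^sub>a h)
      = Eval C X V \<cdot> Symm C X (Ihom C X V) \<cdot> (Idt C X \<otimes>\<^sub>a h')" for h h'
  proof (rule eval_cancel[OF h(1-3)])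
    show "Eval C X V \<cdot> (h \<otimes>\<^sub>a Idt C X) = Eval C X V \<cdot> (h' \<otimes>\<^sub>a Idt C X)"
      by (rule isom_cancel_right[OF symm_isom h(4)[unfolded eq[OF h(2)] eq[OF h(3)] h(1)]])
        (use h(1-3) in simp_all)
  qed
  ultimately show "\<exists>Q e. Dom C e = Fo (tensor_left C X) Q \<and> Cod C e = V
      \<and> (\<forall>g Z. Dom C g = Fo (tensor_left C X) Z \<longrightarrow> Cod C g = V
          \<longrightarrow> (\<exists>h. Dom C h = Z \<and> Cod C h = Q \<and> e \<cdot> Fa (tensor_left C X) h = g))
      \<and> (\<forall>h h'. Dom C h = Dom C h' \<longrightarrow> Cod C h = Q \<longrightarrow> Cod C h' = Q
          \<longrightarrow> e \<cdot> Fa (tensor_left C X) h = e \<cdot> Fa (tensor_left C X) h' \<longrightarrow> h = h')"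
    by (intro exI[of _ "Ihom C X V"] exI[of _ "Eval C X V \<cdot> Symm C X (Ihom C X V)"]) simp
qed

text \<open>For \<open>Y = X\<close> this is \<open>dual_eval C X\<close>; the extra variable makes it natural in \<open>Y\<close>.\<close>

definition contract :: "'o \<Rightarrow> 'o \<Rightarrow> 'm" where
  "contract X Y = Lunit C Y \<cdot> (Eval C X (Unit C) \<otimes>\<^sub>a Idt C Y) \<cdot> inverse_arrow C (Assoc C (dual C X) X Y)
     \<cdot> (Idt C (dual C X) \<otimes>\<^sub>a Symm C Y X) \<cdot> Assoc C (dual C X) Y X"

lemma contract_dom [simp]: "Dom C (contract X Y) = dual C X \<otimes>\<^sub>o Y \<otimes>\<^sub>o X"
  and contract_cod [simp]: "Cod C (contract X Y) = Y"
  by (simp_all add: contract_def dual_def)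

text \<open>\<open>y\<close> is carried through the five factors of \<open>contract\<close> one at a
  time; the equations 1 to 5 are the squares used.\<close>

lemma contract_natural:
  "contract X (Cod C y) \<cdot> (Idt C (dual C X) \<otimes>\<^sub>a y \<otimes>\<^sub>a Idt C X) = y \<cdot> contract X (Dom C y)"
proof -
  define A where "A = dual C X"
  define Y Z where "Y = Dom C y" and "Z = Cod C y"
  note d [simp] = Y_def[symmetric] Z_def[symmetric]
  have 1: "Assoc C A Z X \<cdot> (Idt C A \<otimes>\<^sub>a y \<otimes>\<^sub>a Idt C X) = (Idt C A \<otimes>\<^sub>a (y \<otimes>\<^sub>a Idt C X)) \<cdot> Assoc C A Y X"
    by (rule assoc_natural) (simp_all add: Mor_iff)
  have 2: "(Idt C A \<otimes>\<^sub>a Symm C Z X) \<cdot> (Idt C A \<otimes>\<^sub>a (y \<otimes>\<^sub>a Idt C X))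
      = (Idt C A \<otimes>\<^sub>a (Idt C X \<otimes>\<^sub>a y)) \<cdot> (Idt C A \<otimes>\<^sub>a Symm C Y X)"
    using symm_natural'[of y "Idt C X"] by (simp add: tensor_interchange)
  have 3: "inverse_arrow C (Assoc C A X Z) \<cdot> (Idt C A \<otimes>\<^sub>a (Idt C X \<otimes>\<^sub>a y))
      = (Idt C A \<otimes>\<^sub>a Idt C X \<otimes>\<^sub>a y) \<cdot> inverse_arrow C (Assoc C A X Y)"
    by (rule inverse_natural[OF _ _ assoc_natural]) (simp_all add: Mor_iff)
  have 4: "(Eval C X (Unit C) \<otimes>\<^sub>a Idt C Z) \<cdot> (Idt C A \<otimes>\<^sub>a Idt C X \<otimes>\<^sub>a y)
      = (Idt C (Unit C) \<otimes>\<^sub>a y) \<cdot> (Eval C X (Unit C) \<otimes>\<^sub>a Idt C Y)"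
    by (simp add: tensor_interchange A_def dual_def)
  have 5: "Lunit C Z \<cdot> (Idt C (Unit C) \<otimes>\<^sub>a y) = y \<cdot> Lunit C Y"
    by (rule lunit_natural) (simp add: Mor_iff)
  have "Lunit C Z \<cdot> (Eval C X (Unit C) \<otimes>\<^sub>a Idt C Z) \<cdot> inverse_arrow C (Assoc C A X Z)
     \<cdot> (Idt C A \<otimes>\<^sub>a Symm C Z X) \<cdot> Assoc C A Z X \<cdot> (Idt C A \<otimes>\<^sub>a y \<otimes>\<^sub>a Idt C X)
    = Lunit C Z \<cdot> ((Eval C X (Unit C) \<otimes>\<^sub>a Idt C Z) \<cdot> (inverse_arrow C (Assoc C A X Z)
     \<cdot> ((Idt C A \<otimes>\<^sub>a Symm C Z X) \<cdot> (Assoc C A Z X \<cdot> (Idt C A \<otimes>\<^sub>a y \<otimes>\<^sub>a Idt C X)))))"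
    by (simp add: assoc A_def dual_def del: tensor_ident_simp)
  also have "\<dots> = Lunit C Z \<cdot> ((Eval C X (Unit C) \<otimes>\<^sub>a Idt C Z) \<cdot> (inverse_arrow C (Assoc C A X Z)
     \<cdot> ((Idt C A \<otimes>\<^sub>a (Idt C X \<otimes>\<^sub>a y)) \<cdot> ((Idt C A \<otimes>\<^sub>a Symm C Y X) \<cdot> Assoc C A Y X))))"
    unfolding 1 by (subst comp_push[OF 2]) simp_all
  also have "\<dots> = Lunit C Z \<cdot> ((Eval C X (Unit C) \<otimes>\<^sub>a Idt C Z) \<cdot> ((Idt C A \<otimes>\<^sub>a Idt C X \<otimes>\<^sub>a y)
     \<cdot> (inverse_arrow C (Assoc C A X Y) \<cdot> ((Idt C A \<otimes>\<^sub>a Symm C Y X) \<cdot> Assoc C A Y X))))"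
    by (subst comp_push[OF 3]) simp_all
  also have "\<dots> = Lunit C Z \<cdot> ((Idt C (Unit C) \<otimes>\<^sub>a y) \<cdot> ((Eval C X (Unit C) \<otimes>\<^sub>a Idt C Y)
     \<cdot> (inverse_arrow C (Assoc C A X Y) \<cdot> ((Idt C A \<otimes>\<^sub>a Symm C Y X) \<cdot> Assoc C A Y X))))"
    by (subst comp_push[OF 4]) (simp_all add: A_def dual_def)
  also have "\<dots> = y \<cdot> (Lunit C Y \<cdot> ((Eval C X (Unit C) \<otimes>\<^sub>a Idt C Y)
     \<cdot> (inverse_arrow C (Assoc C A X Y) \<cdot> ((Idt C A \<otimes>\<^sub>a Symm C Y X) \<cdot> Assoc C A Y X))))"
    by (subst comp_push[OF 5]) (simp_all add: A_def dual_def)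
  also have "\<dots> = y \<cdot> (Lunit C Y \<cdot> (Eval C X (Unit C) \<otimes>\<^sub>a Idt C Y) \<cdot> inverse_arrow C (Assoc C A X Y)
     \<cdot> (Idt C A \<otimes>\<^sub>a Symm C Y X) \<cdot> Assoc C A Y X)"
    by (simp add: assoc A_def dual_def)
  finally show ?thesis by (simp add: contract_def A_def del: tensor_ident_simp)
qed

end

context compatible_triangulation begin

lemma tensor_left_exact_functor: "exact_category_functor C C (tensor_left C X) (\<lambda>Y. SusR C X Y)"
  by unfold_locales (rule tensor_left_exact)

lemma tensor_right_exact_functor: "exact_category_functor C C (tensor_right C X) (\<lambda>Y. SusL C Y X)"
  by unfold_locales (rule tensor_right_exact)

text \<open>
  For the coevaluation \<open>c : S \<rightarrow> DX \<otimes> X\<close> obtained from \<open>\<nu>\<^sup>-\<^sup>1\<close>, the map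
  \<open>Hom(X, Y) \<rightarrow> Hom(S, DX \<otimes> Y)\<close>, \<open>g \<mapsto> (1 \<otimes> g) c\<close>, has a left inverse natural in \<open>Y\<close>.
\<close>

lemma dualizable_small_object:
  assumes S: "small_object U C (Unit C)" and X: "dualizable C X"
  shows "small_object U C X"
  unfolding small_object_def
proof (intro allI impI)
  define A where "A = dual C X"
  interpret TL: exact_category_functor C C "tensor_left C A" "\<lambda>Y. SusR C A Y" by (rule tensor_left_exact_functor)
  interpret TR: exact_category_functor C C "tensor_right C X" "\<lambda>Y. SusL C Y X" by (rule tensor_right_exact_functor)
  have de: "dual_eval C X = contract X X" by (simp add: dual_eval_def contract_def)
  have nu: "Dom C (nu C X) = A \<otimes>\<^sub>o X" "Cod C (nu C X) = Ihom C X X"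
      "Eval C X X \<cdot> (nu C X \<otimes>\<^sub>a Idt C X) = contract X X"
    unfolding nu_def de A_def by (rule curry_arrow; simp)+
  have nu_iso: "isom C (nu C X)" using X by (simp add: dualizable_def)
  \<comment> \<open>\<open>j\<close> names the identity of \<open>X\<close>: its transpose is the
    unit isomorphism.\<close>
  obtain j where j: "Dom C j = Unit C" "Cod C j = Ihom C X X" "Eval C X X \<cdot> (j \<otimes>\<^sub>a Idt C X) = Lunit C X"
    by (rule eval_lift[of "Lunit C X" "Unit C" X X]) simp_all
  define c where "c = inverse_arrow C (nu C X) \<cdot> j"
  have c: "Dom C c = Unit C" "Cod C c = A \<otimes>\<^sub>o X" "nu C X \<cdot> c = j"
    using nu(1,2) nu_iso j(1,2) by (simp_all add: c_def)
  \<comment> \<open>A duality identity for the coevaluation \<open>c\<close>: inserting it and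
    contracting gives back \<open>X\<close>.\<close>
  have "contract X X \<cdot> (c \<otimes>\<^sub>a Idt C X) = Eval C X X \<cdot> ((nu C X \<cdot> c) \<otimes>\<^sub>a Idt C X)"
    unfolding nu(3)[symmetric] using nu(1,2) c(1,2) by (simp add: assoc tensor_interchange)
  then have cc: "contract X X \<cdot> (c \<otimes>\<^sub>a Idt C X) = Lunit C X" unfolding c(3) j(3) .
  fix I Y P \<iota> x
  assume I: "I \<subseteq> U" "I \<prec> U" and P: "is_coproduct C I Y P \<iota>" and x: "Dom C x = X" "Cod C x = P"
  have AP: "is_coproduct C I (\<lambda>i. A \<otimes>\<^sub>o Y i) (A \<otimes>\<^sub>o P) (\<lambda>i. Idt C A \<otimes>\<^sub>a \<iota> i)"
    using left_adjoint_coproduct[OF tensor_left_functor tensor_left_left_adjoint P, of A] by simp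
  have "finite_support C I (A \<otimes>\<^sub>o P) (\<lambda>i. Idt C A \<otimes>\<^sub>a \<iota> i) ((Idt C A \<otimes>\<^sub>a x) \<cdot> c)"
    using S I AP c(1,2) x unfolding small_object_def by simp
  then obtain F where F: "finite F" "F \<subseteq> I"
      "supports C F (A \<otimes>\<^sub>o P) (\<lambda>i. Idt C A \<otimes>\<^sub>a \<iota> i) ((Idt C A \<otimes>\<^sub>a x) \<cdot> c)"
    by (auto simp: finite_support_def)
  have "supports C F P \<iota> x"
    unfolding supports_def
  proof (intro allI impI)
    fix u assume u: "Dom C u = P" "\<forall>i\<in>F. u \<cdot> \<iota> i = Zer C (Dom C (\<iota> i)) (Cod C u)"
    have "(Idt C A \<otimes>\<^sub>a u) \<cdot> (Idt C A \<otimes>\<^sub>a \<iota> i) = Zer C (Dom C (Idt C A \<otimes>\<^sub>a \<iota> i)) (Cod C (Idt C A \<otimes>\<^sub>a u))"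
      if "i \<in> F" for i
    proof -
      have "(Idt C A \<otimes>\<^sub>a u) \<cdot> (Idt C A \<otimes>\<^sub>a \<iota> i) = Idt C A \<otimes>\<^sub>a (u \<cdot> \<iota> i)"
        using that F(2) P u(1) by (subst tensor_interchange) auto
      then show ?thesis
        using that u(2) TL.F_zero[of "Dom C (\<iota> i)" "Cod C u"] by simp
    qed
    then have "(Idt C A \<otimes>\<^sub>a u) \<cdot> ((Idt C A \<otimes>\<^sub>a x) \<cdot> c) = Zer C (Unit C) (A \<otimes>\<^sub>o Cod C u)"
      using F(3) u(1) x c(1,2) unfolding supports_def by simp
    then have 0: "(Idt C A \<otimes>\<^sub>a (u \<cdot> x)) \<cdot> c = Zer C (Unit C) (A \<otimes>\<^sub>o Cod C u)"
      using u(1) x c(2) by (simp add: tensor_interchange flip: assoc)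
    \<comment> \<open>Naturality of \<open>contract\<close> in its second variable recovers
      \<open>u x\<close> from \<open>(1 \<otimes> u x) c\<close>, which the support has already made
      zero.\<close>
    have "u \<cdot> x \<cdot> Lunit C X = (u \<cdot> x) \<cdot> contract X X \<cdot> (c \<otimes>\<^sub>a Idt C X)"
      unfolding cc[symmetric] using u(1) x c(1,2) by (simp add: assoc A_def)
    also have "\<dots> = contract X (Cod C (u \<cdot> x)) \<cdot> (Idt C A \<otimes>\<^sub>a (u \<cdot> x) \<otimes>\<^sub>a Idt C X) \<cdot> (c \<otimes>\<^sub>a Idt C X)"
      unfolding A_def contract_natural using x u(1) by simp
    also have "\<dots> = contract X (Cod C u) \<cdot> (((Idt C A \<otimes>\<^sub>a (u \<cdot> x)) \<cdot> c) \<otimes>\<^sub>a Idt C X)"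
      using u(1) x c(2) by (simp add: assoc tensor_interchange A_def)
    also have "\<dots> = Zer C (Unit C \<otimes>\<^sub>o X) (Cod C u)"
      unfolding 0 using TR.F_zero[of "Unit C" "A \<otimes>\<^sub>o Cod C u"] by (simp add: A_def)
    finally have "u \<cdot> x \<cdot> Lunit C X = Zer C X (Cod C u) \<cdot> Lunit C X" by simp
    then have "u \<cdot> x = Zer C X (Cod C u)"
      by (rule isom_cancel_right[OF lunit_isom]) (use u(1) x in simp_all)
    then show "u \<cdot> x = Zer C (Dom C x) (Cod C u)" using x by simp
  qed
  then show "finite_support C I P \<iota> x" using F by (auto simp: finite_support_def)
qed

text \<open>Compact generation asks for isomorphisms of Hom groups; bijectivity is enough to detect
  because composition is additive.\<close>

lemma generated_triangulated_category:
  assumes U: "smallness_bound U" and G: "compactly_generated U C G"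
  shows "generated_triangulated_category C U G"
proof unfold_locales
  show "(UNIV :: nat set) \<prec> U" using U by (simp add: smallness_bound_def)
  show "has_coproducts U C" "G \<prec> U" "\<And>X Y. X \<in> G \<Longrightarrow> Mor C X Y \<prec> U"
    "\<And>X. X \<in> G \<Longrightarrow> small_object U C X"
    using G unfolding compactly_generated_def by (blast intro: compact_object_small_object)+
  fix g assume bij: "\<And>X. X \<in> G \<Longrightarrow> bij_betw (\<lambda>h. g \<cdot> h) (Mor C X (Dom C g)) (Mor C X (Cod C g))"
  have "(\<lambda>h. g \<cdot> h) \<in> iso (homgrp C X (Dom C g)) (homgrp C X (Cod C g))" if "X \<in> G" for X
    using bij[OF that] by (auto simp: iso_def hom_def Mor_iff comp_distrib_add)
  moreover have "g \<in> Mor C (Dom C g) (Cod C g)" by (simp add: Mor_iff)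
  ultimately show "isom C g" using G unfolding compactly_generated_def by blast
qed

lemma unit_small_object: "compactly_generated U C G \<Longrightarrow> small_object U C (Unit C)"
  by (intro compact_object_small_object) (simp add: compactly_generated_def)

end

section \<open>The canonical maps\<close>

context adjoint_context begin

sublocale C: compatible_triangulation "CC W" by (rule C_triangulation)
sublocale D: compatible_triangulation "DD W" by (rule D_triangulation)

sublocale shriek: adjoint_pair "CC W" "DD W" "low_shriek W" "up_star W" "zeta W" "sigma W"
  by unfold_locales (rule low_shriek_adjunction)

sublocale star: adjoint_pair "DD W" "CC W" "up_star W" "low_star W" "eta W" "eps W"
  by unfold_locales (rule low_star_adjunction)

sublocale up: exact_category_functor "DD W" "CC W" "up_star W" "sus_up W"
  by unfold_locales (rule up_star_exact)

sublocale mon: strong_symmetric_monoidal_functor "DD W" "CC W" "up_star W" "mon_unit W" "mon_prod W"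
  by (rule up_star_monoidal)

abbreviation compC (infixl "\<cdot>\<^sub>C" 75) where "g \<cdot>\<^sub>C f \<equiv> g \<cdot>\<^bsub>CC W\<^esub> f"
abbreviation compD (infixl "\<cdot>\<^sub>D" 75) where "g \<cdot>\<^sub>D f \<equiv> g \<cdot>\<^bsub>DD W\<^esub> f"
abbreviation tensC (infixl "\<otimes>\<^sub>C" 80) where "f \<otimes>\<^sub>C g \<equiv> f \<otimes>\<^sub>a\<^bsub>CC W\<^esub> g"
abbreviation tensD (infixl "\<otimes>\<^sub>D" 80) where "f \<otimes>\<^sub>D g \<equiv> f \<otimes>\<^sub>a\<^bsub>DD W\<^esub> g"
abbreviation idC where "idC X \<equiv> Idt (CC W) X"
abbreviation idD where "idD X \<equiv> Idt (DD W) X"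
abbreviation invC where "invC f \<equiv> inverse_arrow (CC W) f"
abbreviation invD where "invD f \<equiv> inverse_arrow (DD W) f"
abbreviation star_o ("f\<^sup>*\<^sub>o") where "f\<^sup>*\<^sub>o Y \<equiv> Fo (up_star W) Y"
abbreviation star_a ("f\<^sup>*\<^sub>a") where "f\<^sup>*\<^sub>a y \<equiv> Fa (up_star W) y"
abbreviation low_o ("f\<^sub>*\<^sub>o") where "f\<^sub>*\<^sub>o X \<equiv> Fo (low_star W) X"
abbreviation low_a ("f\<^sub>*\<^sub>a") where "f\<^sub>*\<^sub>a x \<equiv> Fa (low_star W) x"
abbreviation shriek_o ("f\<^sub>!\<^sub>o") where "f\<^sub>!\<^sub>o X \<equiv> Fo (low_shriek W) X"
abbreviation shriek_a ("f\<^sub>!\<^sub>a") where "f\<^sub>!\<^sub>a x \<equiv> Fa (low_shriek W) x"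

section \<open>The map \<open>pibar\<close>\<close>

lemma mon_prod_simps [simp]:
  "Dom (CC W) (mon_prod W X Y) = f\<^sup>*\<^sub>o (X \<otimes>\<^sub>o\<^bsub>DD W\<^esub> Y)"
  "Cod (CC W) (mon_prod W X Y) = f\<^sup>*\<^sub>o X \<otimes>\<^sub>o\<^bsub>CC W\<^esub> f\<^sup>*\<^sub>o Y"
  "isom (CC W) (mon_prod W X Y)"
  using mon.prod_in[of X Y] mon.prod_isom by (auto simp: C.Mor_iff)

lemma shriek_prod_simps [simp]:
  "Dom (DD W) (shriek_prod W V X) = f\<^sub>!\<^sub>o (V \<otimes>\<^sub>o\<^bsub>CC W\<^esub> X)"
  "Cod (DD W) (shriek_prod W V X) = f\<^sub>!\<^sub>o V \<otimes>\<^sub>o\<^bsub>DD W\<^esub> f\<^sub>!\<^sub>o X"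
  by (simp_all add: shriek_prod_def Let_def)

text \<open>Three squares are pasted: naturality of the counit \<open>sigma\<close>, of the inverse
  of \<open>mon_prod\<close>, and of the unit \<open>zeta\<close> in both tensor factors.\<close>

lemma shriek_prod_natural:
  "(f\<^sub>!\<^sub>a v \<otimes>\<^sub>D f\<^sub>!\<^sub>a x) \<cdot>\<^sub>D shriek_prod W (Dom (CC W) v) (Dom (CC W) x)
    = shriek_prod W (Cod (CC W) v) (Cod (CC W) x) \<cdot>\<^sub>D f\<^sub>!\<^sub>a (v \<otimes>\<^sub>C x)"
proof -
  define V V' X X' where "V = Dom (CC W) v" and "V' = Cod (CC W) v" and "X = Dom (CC W) x" and "X' = Cod (CC W) x"
  note d [simp] = V_def[symmetric] V'_def[symmetric] X_def[symmetric] X'_def[symmetric]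
  define s s' where "s = sigma W (f\<^sub>!\<^sub>o V \<otimes>\<^sub>o\<^bsub>DD W\<^esub> f\<^sub>!\<^sub>o X)" and "s' = sigma W (f\<^sub>!\<^sub>o V' \<otimes>\<^sub>o\<^bsub>DD W\<^esub> f\<^sub>!\<^sub>o X')"
  define m m' where "m = invC (mon_prod W (f\<^sub>!\<^sub>o V) (f\<^sub>!\<^sub>o X))" and "m' = invC (mon_prod W (f\<^sub>!\<^sub>o V') (f\<^sub>!\<^sub>o X'))"
  define z z' where "z = zeta W V \<otimes>\<^sub>C zeta W X" and "z' = zeta W V' \<otimes>\<^sub>C zeta W X'"
  have ty [simp]: "Dom (CC W) m = f\<^sup>*\<^sub>o (f\<^sub>!\<^sub>o V) \<otimes>\<^sub>o\<^bsub>CC W\<^esub> f\<^sup>*\<^sub>o (f\<^sub>!\<^sub>o X)" "Cod (CC W) m = f\<^sup>*\<^sub>o (f\<^sub>!\<^sub>o V \<otimes>\<^sub>o\<^bsub>DD W\<^esub> f\<^sub>!\<^sub>o X)"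
    "Dom (CC W) m' = f\<^sup>*\<^sub>o (f\<^sub>!\<^sub>o V') \<otimes>\<^sub>o\<^bsub>CC W\<^esub> f\<^sup>*\<^sub>o (f\<^sub>!\<^sub>o X')" "Cod (CC W) m' = f\<^sup>*\<^sub>o (f\<^sub>!\<^sub>o V' \<otimes>\<^sub>o\<^bsub>DD W\<^esub> f\<^sub>!\<^sub>o X')"
    "Dom (CC W) z = V \<otimes>\<^sub>o\<^bsub>CC W\<^esub> X" "Cod (CC W) z = f\<^sup>*\<^sub>o (f\<^sub>!\<^sub>o V) \<otimes>\<^sub>o\<^bsub>CC W\<^esub> f\<^sup>*\<^sub>o (f\<^sub>!\<^sub>o X)"
    "Dom (CC W) z' = V' \<otimes>\<^sub>o\<^bsub>CC W\<^esub> X'" "Cod (CC W) z' = f\<^sup>*\<^sub>o (f\<^sub>!\<^sub>o V') \<otimes>\<^sub>o\<^bsub>CC W\<^esub> f\<^sup>*\<^sub>o (f\<^sub>!\<^sub>o X')"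
    "Dom (DD W) s = f\<^sub>!\<^sub>o (f\<^sup>*\<^sub>o (f\<^sub>!\<^sub>o V \<otimes>\<^sub>o\<^bsub>DD W\<^esub> f\<^sub>!\<^sub>o X))" "Cod (DD W) s = f\<^sub>!\<^sub>o V \<otimes>\<^sub>o\<^bsub>DD W\<^esub> f\<^sub>!\<^sub>o X"
    "Dom (DD W) s' = f\<^sub>!\<^sub>o (f\<^sup>*\<^sub>o (f\<^sub>!\<^sub>o V' \<otimes>\<^sub>o\<^bsub>DD W\<^esub> f\<^sub>!\<^sub>o X'))" "Cod (DD W) s' = f\<^sub>!\<^sub>o V' \<otimes>\<^sub>o\<^bsub>DD W\<^esub> f\<^sub>!\<^sub>o X'"
    by (simp_all add: m_def m'_def z_def z'_def s_def s'_def)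
  have 1: "(f\<^sub>!\<^sub>a v \<otimes>\<^sub>D f\<^sub>!\<^sub>a x) \<cdot>\<^sub>D s = s' \<cdot>\<^sub>D f\<^sub>!\<^sub>a (f\<^sup>*\<^sub>a (f\<^sub>!\<^sub>a v \<otimes>\<^sub>D f\<^sub>!\<^sub>a x))"
    using shriek.counit_natural[of "f\<^sub>!\<^sub>a v \<otimes>\<^sub>D f\<^sub>!\<^sub>a x"] by (simp add: s_def s'_def)
  have 2: "f\<^sup>*\<^sub>a (f\<^sub>!\<^sub>a v \<otimes>\<^sub>D f\<^sub>!\<^sub>a x) \<cdot>\<^sub>C m = m' \<cdot>\<^sub>C (f\<^sup>*\<^sub>a (f\<^sub>!\<^sub>a v) \<otimes>\<^sub>C f\<^sup>*\<^sub>a (f\<^sub>!\<^sub>a x))"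
    unfolding m_def m'_def
    by (rule C.inverse_natural[OF _ _ mon.prod_natural, symmetric]) (simp_all add: D.Mor_iff)
  have 3: "(f\<^sup>*\<^sub>a (f\<^sub>!\<^sub>a v) \<otimes>\<^sub>C f\<^sup>*\<^sub>a (f\<^sub>!\<^sub>a x)) \<cdot>\<^sub>C z = z' \<cdot>\<^sub>C (v \<otimes>\<^sub>C x)"
    using shriek.unit_natural[of v] shriek.unit_natural[of x] by (simp add: z_def z'_def C.tensor_interchange)
  have "(f\<^sub>!\<^sub>a v \<otimes>\<^sub>D f\<^sub>!\<^sub>a x) \<cdot>\<^sub>D (s \<cdot>\<^sub>D f\<^sub>!\<^sub>a (m \<cdot>\<^sub>C z)) = s' \<cdot>\<^sub>D (f\<^sub>!\<^sub>a (f\<^sup>*\<^sub>a (f\<^sub>!\<^sub>a v \<otimes>\<^sub>D f\<^sub>!\<^sub>a x)) \<cdot>\<^sub>D f\<^sub>!\<^sub>a (m \<cdot>\<^sub>C z))"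
    by (rule D.comp_push[OF 1]) simp_all
  also have "\<dots> = s' \<cdot>\<^sub>D f\<^sub>!\<^sub>a (f\<^sup>*\<^sub>a (f\<^sub>!\<^sub>a v \<otimes>\<^sub>D f\<^sub>!\<^sub>a x) \<cdot>\<^sub>C (m \<cdot>\<^sub>C z))"
    by (subst shriek.L.F_comp[symmetric]) simp_all
  also have "f\<^sup>*\<^sub>a (f\<^sub>!\<^sub>a v \<otimes>\<^sub>D f\<^sub>!\<^sub>a x) \<cdot>\<^sub>C (m \<cdot>\<^sub>C z) = m' \<cdot>\<^sub>C ((f\<^sup>*\<^sub>a (f\<^sub>!\<^sub>a v) \<otimes>\<^sub>C f\<^sup>*\<^sub>a (f\<^sub>!\<^sub>a x)) \<cdot>\<^sub>C z)"
    by (rule C.comp_push[OF 2]) simp_all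
  also have "\<dots> = m' \<cdot>\<^sub>C z' \<cdot>\<^sub>C (v \<otimes>\<^sub>C x)" unfolding 3 by (simp add: C.assoc)
  also have "s' \<cdot>\<^sub>D f\<^sub>!\<^sub>a (m' \<cdot>\<^sub>C z' \<cdot>\<^sub>C (v \<otimes>\<^sub>C x)) = s' \<cdot>\<^sub>D f\<^sub>!\<^sub>a (m' \<cdot>\<^sub>C z') \<cdot>\<^sub>D f\<^sub>!\<^sub>a (v \<otimes>\<^sub>C x)"
    by (subst shriek.L.F_comp) (simp_all add: D.assoc)
  finally show ?thesis
    by (simp add: shriek_prod_def Let_def s_def s'_def m_def m'_def z_def z'_def)
qed

lemma pibar_simps [simp]:
  "Dom (DD W) (pibar W Y X) = f\<^sub>!\<^sub>o (f\<^sup>*\<^sub>o Y \<otimes>\<^sub>o\<^bsub>CC W\<^esub> X)"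
  "Cod (DD W) (pibar W Y X) = Y \<otimes>\<^sub>o\<^bsub>DD W\<^esub> f\<^sub>!\<^sub>o X"
  by (simp_all add: pibar_def)

lemma pibar_natural:
  "(y \<otimes>\<^sub>D f\<^sub>!\<^sub>a x) \<cdot>\<^sub>D pibar W (Dom (DD W) y) (Dom (CC W) x)
    = pibar W (Cod (DD W) y) (Cod (CC W) x) \<cdot>\<^sub>D f\<^sub>!\<^sub>a (f\<^sup>*\<^sub>a y \<otimes>\<^sub>C x)"
proof -
  define Y Y' X X' where "Y = Dom (DD W) y" and "Y' = Cod (DD W) y" and "X = Dom (CC W) x" and "X' = Cod (CC W) x"
  note d [simp] = Y_def[symmetric] Y'_def[symmetric] X_def[symmetric] X'_def[symmetric]
  have "y \<cdot>\<^sub>D sigma W Y = sigma W Y' \<cdot>\<^sub>D f\<^sub>!\<^sub>a (f\<^sup>*\<^sub>a y)"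
    using shriek.counit_natural[of y] by simp
  then have 1: "(y \<otimes>\<^sub>D f\<^sub>!\<^sub>a x) \<cdot>\<^sub>D (sigma W Y \<otimes>\<^sub>D idD (f\<^sub>!\<^sub>o X))
      = (sigma W Y' \<otimes>\<^sub>D idD (f\<^sub>!\<^sub>o X')) \<cdot>\<^sub>D (f\<^sub>!\<^sub>a (f\<^sup>*\<^sub>a y) \<otimes>\<^sub>D f\<^sub>!\<^sub>a x)"
    by (simp add: D.tensor_interchange)
  have "(y \<otimes>\<^sub>D f\<^sub>!\<^sub>a x) \<cdot>\<^sub>D pibar W Y X
      = (sigma W Y' \<otimes>\<^sub>D idD (f\<^sub>!\<^sub>o X')) \<cdot>\<^sub>D ((f\<^sub>!\<^sub>a (f\<^sup>*\<^sub>a y) \<otimes>\<^sub>D f\<^sub>!\<^sub>a x) \<cdot>\<^sub>D shriek_prod W (f\<^sup>*\<^sub>o Y) X)"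
    unfolding pibar_def by (rule D.comp_push[OF 1]) simp_all
  also have "(f\<^sub>!\<^sub>a (f\<^sup>*\<^sub>a y) \<otimes>\<^sub>D f\<^sub>!\<^sub>a x) \<cdot>\<^sub>D shriek_prod W (f\<^sup>*\<^sub>o Y) X
      = shriek_prod W (f\<^sup>*\<^sub>o Y') X' \<cdot>\<^sub>D f\<^sub>!\<^sub>a (f\<^sup>*\<^sub>a y \<otimes>\<^sub>C x)"
    using shriek_prod_natural[of "f\<^sup>*\<^sub>a y" x] by simp
  finally show ?thesis by (simp add: pibar_def D.assoc)
qed

text \<open>Tensoring with a fixed object has a right adjoint because both categories are closed,
  and \<open>f_!\<close> has one by hypothesis; this is what \<open>isom_of_left_adjoints\<close>
  requires of the two composites.\<close>

lemma pibar_isom_of_generators: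
  assumes "generated_triangulated_category (CC W) U G" and "\<And>X. X \<in> G \<Longrightarrow> isom (DD W) (pibar W Y X)"
  shows "isom (DD W) (pibar W Y X)"
proof (rule isom_of_left_adjoints[of "CC W" "DD W" _ _ "\<lambda>X. pibar W Y X" G])
  interpret G: generated_triangulated_category "CC W" U G by fact
  show L: "category_functor (CC W) (DD W) (low_shriek W \<circ>\<^sub>F tensor_left (CC W) (f\<^sup>*\<^sub>o Y))"
    by (rule is_functor_comp[OF C.tensor_left_functor shriek.L.category_functor_axioms])
  show "left_adjoint (CC W) (DD W) (low_shriek W \<circ>\<^sub>F tensor_left (CC W) (f\<^sup>*\<^sub>o Y))"
    by (rule left_adjoint_comp[OF C.tensor_left_functor shriek.L.category_functor_axioms
          C.tensor_left_left_adjoint shriek.left_adjoint])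
  show K: "category_functor (CC W) (DD W) (tensor_left (DD W) Y \<circ>\<^sub>F low_shriek W)"
    by (rule is_functor_comp[OF shriek.L.category_functor_axioms D.tensor_left_functor])
  show "left_adjoint (CC W) (DD W) (tensor_left (DD W) Y \<circ>\<^sub>F low_shriek W)"
    by (rule left_adjoint_comp[OF shriek.L.category_functor_axioms D.tensor_left_functor
          shriek.left_adjoint D.tensor_left_left_adjoint])
  show "natural (CC W) (DD W) (low_shriek W \<circ>\<^sub>F tensor_left (CC W) (f\<^sup>*\<^sub>o Y))
      (tensor_left (DD W) Y \<circ>\<^sub>F low_shriek W) (pibar W Y)"
    unfolding natural_def
  proof (intro conjI allI impI)
    fix X X' x assume "x \<in> Mor (CC W) X X'"
    then show "pibar W Y X' \<cdot>\<^sub>D Fa (low_shriek W \<circ>\<^sub>F tensor_left (CC W) (f\<^sup>*\<^sub>o Y)) x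
        = Fa (tensor_left (DD W) Y \<circ>\<^sub>F low_shriek W) x \<cdot>\<^sub>D pibar W Y X"
      using pibar_natural[of "idD Y" x] by (auto simp: functor_comp_def C.Mor_iff)
  qed (simp add: functor_comp_def D.Mor_iff)
  show "isom (CC W) g" if "\<forall>X\<in>G. bij_betw (\<lambda>h. g \<cdot>\<^sub>C h) (Mor (CC W) X (Dom (CC W) g)) (Mor (CC W) X (Cod (CC W) g))" for g
    by (rule G.detect) (use that in blast)
qed (rule assms(2))

lemma tau_simps [simp]:
  "Dom (DD W) (tau W) = Unit (DD W)" "Cod (DD W) (tau W) = f\<^sub>!\<^sub>o (CObj W)"
  using theta_in mon.unit_in by (simp_all add: tau_def C.Mor_iff D.Mor_iff)

lemma fsharp_simps [simp]:
  "Fo (fsharp W) X = f\<^sub>!\<^sub>o (X \<otimes>\<^sub>o\<^bsub>CC W\<^esub> CObj W)" "Fa (fsharp W) x = f\<^sub>!\<^sub>a (x \<otimes>\<^sub>C idC (CObj W))"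
  by (simp_all add: fsharp_def functor_comp_def)

section \<open>Exactness of \<open>low_star\<close> and \<open>fsharp\<close>, and coproducts under
  \<open>fsharp\<close>\<close>

lemma low_star_additive: "additive_category_functor (CC W) (DD W) (low_star W)"
  by (rule additive_right_adjoint[OF star.adjoint_pair_axioms up.additive_category_functor_axioms])

lemma low_star_hom_exact: "hom_exact (CC W) (DD W) (low_star W)"
  by (rule hom_exact_right_adjoint[OF star.adjoint_pair_axioms up.additive_category_functor_axioms
        C.triangulated_category_axioms])

lemma fsharp_additive: "additive_category_functor (CC W) (DD W) (fsharp W)"
proof -
  interpret S: additive_category_functor "CC W" "DD W" "low_shriek W"
    by (rule additive_left_adjoint[OF shriek.adjoint_pair_axioms up.additive_category_functor_axioms])
  interpret T: exact_category_functor "CC W" "CC W" "tensor_right (CC W) (CObj W)" "\<lambda>X. SusL (CC W) X (CObj W)"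
    by (rule C.tensor_right_exact_functor)
  interpret F: category_functor "CC W" "DD W" "fsharp W"
    unfolding fsharp_def by (rule is_functor_comp[OF C.tensor_right_functor shriek.L.category_functor_axioms])
  show ?thesis
  proof unfold_locales
    have "Fa (fsharp W) (f \<^bold>+\<^bsub>CC W\<^esub> g) = Fa (fsharp W) f \<^bold>+\<^bsub>DD W\<^esub> Fa (fsharp W) g"
      if fg: "Dom (CC W) f = Dom (CC W) g" "Cod (CC W) f = Cod (CC W) g" for f g
      using T.F_add[OF fg] fg by (simp add: S.F_add)
    then show "additive_functor (CC W) (DD W) (fsharp W)"
      using F.F_functor by (auto simp: additive_functor_def C.Mor_iff simp del: fsharp_simps)
  qed
qed

lemma fsharp_hom_exact: "hom_exact (CC W) (DD W) (fsharp W)"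
  unfolding fsharp_def
  by (rule hom_exact_comp[OF C.tensor_right_exact_functor
        hom_exact_left_adjoint[OF shriek.adjoint_pair_axioms up.exact_category_functor_axioms]])

lemma fsharp_coproduct:
  assumes "is_coproduct (CC W) I Y P \<iota>"
  shows "is_coproduct (DD W) I (\<lambda>i. Fo (fsharp W) (Y i)) (Fo (fsharp W) P) (\<lambda>i. Fa (fsharp W) (\<iota> i))"
  unfolding fsharp_def
  by (rule left_adjoint_coproduct[OF is_functor_comp[OF C.tensor_right_functor shriek.L.category_functor_axioms]
        left_adjoint_comp[OF C.tensor_right_functor shriek.L.category_functor_axioms
          C.tensor_right_left_adjoint shriek.left_adjoint] assms])

end

text \<open>Under this assumption the description operator in \<open>inverse_arrow\<close> returns a
  genuine inverse of \<open>pibar\<close>, so that \<open>tau_at\<close> and \<open>omega\<close>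
  have their intended meaning.\<close>

locale pibar_context = adjoint_context W for W :: "('c, 'k, 'd, 'l) adjoint_data" +
  assumes pibar_isom [simp]: "isom (DD W) (pibar W Y X)"
begin

sublocale low: additive_category_functor "CC W" "DD W" "low_star W" by (rule low_star_additive)
sublocale sharp: additive_category_functor "CC W" "DD W" "fsharp W" by (rule fsharp_additive)

lemma tau_at_simps [simp]:
  "Dom (DD W) (tau_at W Y) = Y" "Cod (DD W) (tau_at W Y) = f\<^sub>!\<^sub>o (f\<^sup>*\<^sub>o Y \<otimes>\<^sub>o\<^bsub>CC W\<^esub> CObj W)"
  by (simp_all add: tau_at_def)

lemma tau_at_natural:
  "tau_at W (Cod (DD W) y) \<cdot>\<^sub>D y = Fa (fsharp W) (f\<^sup>*\<^sub>a y) \<cdot>\<^sub>D tau_at W (Dom (DD W) y)"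
proof -
  define Y Y' where "Y = Dom (DD W) y" and "Y' = Cod (DD W) y"
  note d [simp] = Y_def[symmetric] Y'_def[symmetric]
  have 1: "invD (Runit (DD W) Y') \<cdot>\<^sub>D y = (y \<otimes>\<^sub>D idD (Unit (DD W))) \<cdot>\<^sub>D invD (Runit (DD W) Y)"
    by (rule D.inverse_natural[OF _ _ D.runit_natural]) (simp_all add: D.Mor_iff)
  have 2: "(idD Y' \<otimes>\<^sub>D tau W) \<cdot>\<^sub>D (y \<otimes>\<^sub>D idD (Unit (DD W))) = (y \<otimes>\<^sub>D idD (f\<^sub>!\<^sub>o (CObj W))) \<cdot>\<^sub>D (idD Y \<otimes>\<^sub>D tau W)"
    by (simp add: D.tensor_interchange)
  have "pibar W Y' (CObj W) \<cdot>\<^sub>D f\<^sub>!\<^sub>a (f\<^sup>*\<^sub>a y \<otimes>\<^sub>C idC (CObj W))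
      = (y \<otimes>\<^sub>D idD (f\<^sub>!\<^sub>o (CObj W))) \<cdot>\<^sub>D pibar W Y (CObj W)"
    using pibar_natural[of y "idC (CObj W)"] by simp
  then have 3: "invD (pibar W Y' (CObj W)) \<cdot>\<^sub>D (y \<otimes>\<^sub>D idD (f\<^sub>!\<^sub>o (CObj W)))
      = f\<^sub>!\<^sub>a (f\<^sup>*\<^sub>a y \<otimes>\<^sub>C idC (CObj W)) \<cdot>\<^sub>D invD (pibar W Y (CObj W))"
    by (rule D.inverse_natural[OF pibar_isom pibar_isom]) simp_all
  have "tau_at W Y' \<cdot>\<^sub>D y = invD (pibar W Y' (CObj W)) \<cdot>\<^sub>D ((idD Y' \<otimes>\<^sub>D tau W) \<cdot>\<^sub>D (invD (Runit (DD W) Y') \<cdot>\<^sub>D y))"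
    by (simp add: tau_at_def D.assoc)
  also have "\<dots> = invD (pibar W Y' (CObj W)) \<cdot>\<^sub>D ((y \<otimes>\<^sub>D idD (f\<^sub>!\<^sub>o (CObj W)))
      \<cdot>\<^sub>D ((idD Y \<otimes>\<^sub>D tau W) \<cdot>\<^sub>D invD (Runit (DD W) Y)))"
    unfolding 1 by (subst D.comp_push[OF 2]) simp_all
  also have "\<dots> = f\<^sub>!\<^sub>a (f\<^sup>*\<^sub>a y \<otimes>\<^sub>C idC (CObj W)) \<cdot>\<^sub>D (invD (pibar W Y (CObj W))
      \<cdot>\<^sub>D ((idD Y \<otimes>\<^sub>D tau W) \<cdot>\<^sub>D invD (Runit (DD W) Y)))"
    by (rule D.comp_push[OF 3]) simp_all
  finally show ?thesis by (simp add: tau_at_def D.assoc)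
qed

lemma omega_simps [simp]:
  "Dom (DD W) (omega W X) = f\<^sub>*\<^sub>o X" "Cod (DD W) (omega W X) = Fo (fsharp W) X"
  by (simp_all add: omega_def)

declare fsharp_simps [simp del]

text \<open>Naturality of \<open>tau_at\<close> at the arrow \<open>f_* x\<close>, followed by
  naturality of the counit \<open>eps\<close>.\<close>

lemma omega_natural:
  "omega W (Cod (CC W) x) \<cdot>\<^sub>D f\<^sub>*\<^sub>a x = Fa (fsharp W) x \<cdot>\<^sub>D omega W (Dom (CC W) x)"
proof -
  define X X' where "X = Dom (CC W) x" and "X' = Cod (CC W) x"
  note d [simp] = X_def[symmetric] X'_def[symmetric]
  have ts: "Cod (DD W) (tau_at W Y) = Fo (fsharp W) (f\<^sup>*\<^sub>o Y)" for Y by (simp add: fsharp_simps)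
  have 1: "tau_at W (f\<^sub>*\<^sub>o X') \<cdot>\<^sub>D f\<^sub>*\<^sub>a x = Fa (fsharp W) (f\<^sup>*\<^sub>a (f\<^sub>*\<^sub>a x)) \<cdot>\<^sub>D tau_at W (f\<^sub>*\<^sub>o X)"
    using tau_at_natural[of "f\<^sub>*\<^sub>a x"] by simp
  have "omega W X' \<cdot>\<^sub>D f\<^sub>*\<^sub>a x = Fa (fsharp W) (eps W X') \<cdot>\<^sub>D (tau_at W (f\<^sub>*\<^sub>o X') \<cdot>\<^sub>D f\<^sub>*\<^sub>a x)"
    by (simp add: omega_def D.assoc ts del: tau_at_simps(2))
  also have "\<dots> = Fa (fsharp W) (eps W X' \<cdot>\<^sub>C f\<^sup>*\<^sub>a (f\<^sub>*\<^sub>a x)) \<cdot>\<^sub>D tau_at W (f\<^sub>*\<^sub>o X)"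
    unfolding 1 by (simp add: sharp.F_comp D.assoc ts del: tau_at_simps(2))
  also have "eps W X' \<cdot>\<^sub>C f\<^sup>*\<^sub>a (f\<^sub>*\<^sub>a x) = x \<cdot>\<^sub>C eps W X"
    using star.counit_natural[of x] by simp
  also have "Fa (fsharp W) (x \<cdot>\<^sub>C eps W X) \<cdot>\<^sub>D tau_at W (f\<^sub>*\<^sub>o X) = Fa (fsharp W) x \<cdot>\<^sub>D omega W X"
    by (simp add: omega_def sharp.F_comp D.assoc ts del: tau_at_simps(2))
  finally show ?thesis by simp
qed

lemma omega_natural_transformation: "natural (CC W) (DD W) (low_star W) (fsharp W) (omega W)"
  using omega_natural by (auto simp: natural_def C.Mor_iff D.Mor_iff)

text \<open>\<open>omega_sus\<close> writes the suspension of \<open>omega W X\<close> as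
  \<open>omega W (So (CC W) X)\<close> between two invertible comparison arrows, obtained from mates
  of \<open>sus_up\<close> and from \<open>SusL\<close>, and the suspension reflects isomorphisms.
  This supplies the outer terms of the five lemma.\<close>

lemma omega_sus_isom_iff: "isom (DD W) (omega W (So (CC W) X)) \<longleftrightarrow> isom (DD W) (omega W X)"
proof -
  have l: "isom (DD W) (sus_low_star W X)"
    using sus_mate_right_isom[OF star.adjoint_pair_axioms up.exact_category_functor_axioms, of X]
    by (simp add: sus_low_star_def Let_def)
  have ld: "Dom (DD W) (sus_low_star W X) = So (DD W) (f\<^sub>*\<^sub>o X)" "Cod (DD W) (sus_low_star W X) = f\<^sub>*\<^sub>o (So (CC W) X)"
    by (simp_all add: sus_low_star_def Let_def)
  have s: "isom (DD W) (sus_shriek W Z)" for Z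
    using sus_mate_left_isom[OF shriek.adjoint_pair_axioms up.exact_category_functor_axioms, of Z]
    by (simp add: sus_shriek_def Let_def)
  have sd: "Dom (DD W) (sus_shriek W Z) = f\<^sub>!\<^sub>o (So (CC W) Z)" for Z
    by (simp add: sus_shriek_def Let_def)
  interpret T: exact_category_functor "CC W" "CC W" "tensor_right (CC W) (CObj W)" "\<lambda>X. SusL (CC W) X (CObj W)"
    by (rule C.tensor_right_exact_functor)
  have t: "isom (CC W) (SusL (CC W) X (CObj W))"
      "Dom (CC W) (SusL (CC W) X (CObj W)) = So (CC W) X \<otimes>\<^sub>o\<^bsub>CC W\<^esub> CObj W"
      "Cod (CC W) (SusL (CC W) X (CObj W)) = So (CC W) (X \<otimes>\<^sub>o\<^bsub>CC W\<^esub> CObj W)"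
    using T.sus_iso_isom T.sus_iso_dom[of X] T.sus_iso_cod[of X] by simp_all
  have f: "isom (DD W) (sus_fsharp W X)" "Dom (DD W) (sus_fsharp W X) = Fo (fsharp W) (So (CC W) X)"
    using s t sd by (simp_all add: sus_fsharp_def fsharp_simps)
  have eq: "sus_fsharp W X \<cdot>\<^sub>D omega W (So (CC W) X) \<cdot>\<^sub>D sus_low_star W X = Sa (DD W) (omega W X)"
    by (rule omega_sus[OF pibar_isom])
  show ?thesis
  proof
    assume "isom (DD W) (omega W (So (CC W) X))"
    then have "isom (DD W) (sus_fsharp W X \<cdot>\<^sub>D omega W (So (CC W) X) \<cdot>\<^sub>D sus_low_star W X)"
      using f l ld by simp
    then show "isom (DD W) (omega W X)" unfolding eq by (rule D.sus_reflects_isom)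
  next
    assume "isom (DD W) (omega W X)"
    then have "isom (DD W) (sus_fsharp W X \<cdot>\<^sub>D omega W (So (CC W) X) \<cdot>\<^sub>D sus_low_star W X)"
      unfolding eq by (rule D.sus.F_isom)
    then have "isom (DD W) (sus_fsharp W X \<cdot>\<^sub>D omega W (So (CC W) X))"
      by (rule D.isom_comp_cancel_right) (use f l ld in simp_all)
    then show "isom (DD W) (omega W (So (CC W) X))"
      by (rule D.isom_comp_cancel_left) (use f in simp_all)
  qed
qed

section \<open>Closure properties of the objects at which \<open>omega\<close> is invertible\<close>

lemma omega_isom_cone:
  assumes "(f, g, h) \<in> Tri (CC W)" "isom (DD W) (omega W (Dom (CC W) f))" "isom (DD W) (omega W (Cod (CC W) f))"
  shows "isom (DD W) (omega W (Cod (CC W) g))"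
  by (rule isom_cone[OF C.triangulated_category_axioms low_star_additive low_star_hom_exact fsharp_additive
        fsharp_hom_exact omega_natural_transformation assms(1)])
    (simp_all add: assms omega_sus_isom_iff)

lemma omega_isom_isom:
  assumes "isom (CC W) f" "isom (DD W) (omega W (Dom (CC W) f))"
  shows "isom (DD W) (omega W (Cod (CC W) f))"
proof -
  have "isom (DD W) (omega W (Cod (CC W) f) \<cdot>\<^sub>D f\<^sub>*\<^sub>a f)"
    unfolding omega_natural using assms by simp
  then show ?thesis by (rule D.isom_comp_cancel_right) (use assms in simp_all)
qed

text \<open>The inverse is \<open>i omega_X^-1 p + j omega_Y^-1 q\<close>, with \<open>i\<close> and
  \<open>j\<close> taken under \<open>f_*\<close> and with \<open>p\<close> and \<open>q\<close>
  taken under \<open>fsharp\<close>.\<close>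

lemma omega_isom_biproduct:
  assumes i: "Cod (CC W) i = Dom (CC W) p" and j: "Cod (CC W) j = Dom (CC W) p"
    and p: "Cod (CC W) p = Dom (CC W) i" and q: "Dom (CC W) q = Dom (CC W) p" "Cod (CC W) q = Dom (CC W) j"
    and eq: "i \<cdot>\<^sub>C p \<^bold>+\<^bsub>CC W\<^esub> j \<cdot>\<^sub>C q = idC (Dom (CC W) p)"
    and iso: "isom (DD W) (omega W (Dom (CC W) i))" "isom (DD W) (omega W (Dom (CC W) j))"
  shows "isom (DD W) (omega W (Dom (CC W) p))"
proof -
  define P X Y where "P = Dom (CC W) p" and "X = Dom (CC W) i" and "Y = Dom (CC W) j"
  have d [simp]: "Dom (CC W) p = P" "Dom (CC W) i = X" "Dom (CC W) j = Y" "Cod (CC W) i = P" "Cod (CC W) j = P"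
      "Cod (CC W) p = X" "Dom (CC W) q = P" "Cod (CC W) q = Y"
    using i j p q by (simp_all add: P_def X_def Y_def)
  have iso': "isom (DD W) (omega W X)" "isom (DD W) (omega W Y)" using iso by simp_all
  have n: "omega W P \<cdot>\<^sub>D f\<^sub>*\<^sub>a i = Fa (fsharp W) i \<cdot>\<^sub>D omega W X" "omega W P \<cdot>\<^sub>D f\<^sub>*\<^sub>a j = Fa (fsharp W) j \<cdot>\<^sub>D omega W Y"
    "omega W X \<cdot>\<^sub>D f\<^sub>*\<^sub>a p = Fa (fsharp W) p \<cdot>\<^sub>D omega W P" "omega W Y \<cdot>\<^sub>D f\<^sub>*\<^sub>a q = Fa (fsharp W) q \<cdot>\<^sub>D omega W P"
    using omega_natural[of i] omega_natural[of j] omega_natural[of p] omega_natural[of q] by simp_all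
  define a b where "a = invD (omega W X) \<cdot>\<^sub>D Fa (fsharp W) p" and "b = invD (omega W Y) \<cdot>\<^sub>D Fa (fsharp W) q"
  have ab: "Dom (DD W) a = Fo (fsharp W) P" "Cod (DD W) a = f\<^sub>*\<^sub>o X" "Dom (DD W) b = Fo (fsharp W) P" "Cod (DD W) b = f\<^sub>*\<^sub>o Y"
    using iso' by (simp_all add: a_def b_def)
  define w where "w = f\<^sub>*\<^sub>a i \<cdot>\<^sub>D a \<^bold>+\<^bsub>DD W\<^esub> f\<^sub>*\<^sub>a j \<cdot>\<^sub>D b"
  have w: "Dom (DD W) w = Fo (fsharp W) P" "Cod (DD W) w = f\<^sub>*\<^sub>o P" using ab by (simp_all add: w_def)
  have "omega W P \<cdot>\<^sub>D w = omega W P \<cdot>\<^sub>D f\<^sub>*\<^sub>a i \<cdot>\<^sub>D a \<^bold>+\<^bsub>DD W\<^esub> omega W P \<cdot>\<^sub>D f\<^sub>*\<^sub>a j \<cdot>\<^sub>D b"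
    using ab by (simp add: w_def D.comp_distrib_add D.assoc)
  also have "\<dots> = Fa (fsharp W) i \<cdot>\<^sub>D (omega W X \<cdot>\<^sub>D a) \<^bold>+\<^bsub>DD W\<^esub> Fa (fsharp W) j \<cdot>\<^sub>D (omega W Y \<cdot>\<^sub>D b)"
    unfolding n(1,2) using ab by (simp add: D.assoc)
  also have "\<dots> = Fa (fsharp W) (i \<cdot>\<^sub>C p \<^bold>+\<^bsub>CC W\<^esub> j \<cdot>\<^sub>C q)"
    using iso' by (simp add: a_def b_def sharp.F_add sharp.F_comp)
  also have "\<dots> = idD (Fo (fsharp W) P)" unfolding eq by simp
  finally have 1: "omega W P \<cdot>\<^sub>D w = idD (Fo (fsharp W) P)" .
  have "a \<cdot>\<^sub>D omega W P = invD (omega W X) \<cdot>\<^sub>D (Fa (fsharp W) p \<cdot>\<^sub>D omega W P)"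
    using iso' by (simp add: a_def D.assoc)
  then have aw: "a \<cdot>\<^sub>D omega W P = f\<^sub>*\<^sub>a p" unfolding n(3)[symmetric] using iso' by simp
  have "b \<cdot>\<^sub>D omega W P = invD (omega W Y) \<cdot>\<^sub>D (Fa (fsharp W) q \<cdot>\<^sub>D omega W P)"
    using iso' by (simp add: b_def D.assoc)
  then have bw: "b \<cdot>\<^sub>D omega W P = f\<^sub>*\<^sub>a q" unfolding n(4)[symmetric] using iso' by simp
  have "w \<cdot>\<^sub>D omega W P = f\<^sub>*\<^sub>a i \<cdot>\<^sub>D (a \<cdot>\<^sub>D omega W P) \<^bold>+\<^bsub>DD W\<^esub> f\<^sub>*\<^sub>a j \<cdot>\<^sub>D (b \<cdot>\<^sub>D omega W P)"
    using ab by (simp add: w_def D.add_distrib_comp D.assoc)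
  also have "\<dots> = f\<^sub>*\<^sub>a (i \<cdot>\<^sub>C p \<^bold>+\<^bsub>CC W\<^esub> j \<cdot>\<^sub>C q)"
    unfolding aw bw by (simp add: low.F_add star.R.F_comp)
  also have "\<dots> = idD (f\<^sub>*\<^sub>o P)" unfolding eq by simp
  finally have 2: "w \<cdot>\<^sub>D omega W P = idD (f\<^sub>*\<^sub>o P)" .
  show ?thesis by (rule D.isomI[of w]) (simp_all add: w 1 2)
qed

lemma omega_isom_zero:
  assumes "idC Z = Zer (CC W) Z Z" shows "isom (DD W) (omega W Z)"
proof (rule D.isomI[of "Zer (DD W) (Fo (fsharp W) Z) (f\<^sub>*\<^sub>o Z)"])
  show "Zer (DD W) (Fo (fsharp W) Z) (f\<^sub>*\<^sub>o Z) \<cdot>\<^sub>D omega W Z = idD (Dom (DD W) (omega W Z))"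
    using assms star.R.F_ident[of Z] by simp
  show "omega W Z \<cdot>\<^sub>D Zer (DD W) (Fo (fsharp W) Z) (f\<^sub>*\<^sub>o Z) = idD (Cod (DD W) (omega W Z))"
    using assms sharp.F_ident[of Z] by simp
qed simp_all

text \<open>That \<open>f_*\<close> respects coproducts is never stated; arrows from
  \<open>H\<close> are tested instead. For injectivity an arrow \<open>V \<rightarrow> f_* P\<close>
  is transposed to \<open>f^* V \<rightarrow> P\<close>, which has finite support because
  \<open>f^* V\<close> is compact. For surjectivity an arrow \<open>V \<rightarrow> fsharp P\<close>
  has finite support because \<open>V\<close> is compact and \<open>fsharp\<close> preserves
  coproducts. Both are then settled component by component.\<close>

lemma omega_isom_coproduct:
  assumes H: "generated_triangulated_category (DD W) U H"
    and up: "\<And>Y. Y \<in> H \<Longrightarrow> small_object U (CC W) (f\<^sup>*\<^sub>o Y)"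
    and I: "I \<subseteq> U" "I \<prec> U" and P: "is_coproduct (CC W) I X P \<iota>"
    and iso: "\<And>i. i \<in> I \<Longrightarrow> isom (DD W) (omega W (X i))"
  shows "isom (DD W) (omega W P)"
proof -
  interpret H: generated_triangulated_category "DD W" U H by fact
  note \<iota> [simp] = C.coproduct_dom[OF P] C.coproduct_cod[OF P]
  show ?thesis
  proof (rule H.detect_isom)
    fix y assume y: "Dom (DD W) y \<in> H" "Cod (DD W) y = Dom (DD W) (omega W P)"
      "omega W P \<cdot>\<^sub>D y = Zer (DD W) (Dom (DD W) y) (Cod (DD W) (omega W P))"
    then have cy: "Cod (DD W) y = f\<^sub>*\<^sub>o P" by simp
    define y' where "y' = eps W P \<cdot>\<^sub>C f\<^sup>*\<^sub>a y"
    have y': "Dom (CC W) y' = f\<^sup>*\<^sub>o (Dom (DD W) y)" "Cod (CC W) y' = P" using cy by (simp_all add: y'_def)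
    have fs: "finite_support (CC W) I P \<iota> y'"
      using up[OF y(1)] I P y' unfolding small_object_def by blast
    have "y' = Zer (CC W) (Dom (CC W) y') P"
    proof (rule C.finite_support_induct[OF P fs y'(2), where Q = "\<lambda>a. a = Zer (CC W) (Dom (CC W) y') P"])
      fix i p assume i: "i \<in> I" and p: "Dom (CC W) p = P" "Cod (CC W) p = X i"
      \<comment> \<open>The component of \<open>y'\<close> at \<open>i\<close> is the transpose of
        \<open>f_* p y\<close>, which is zero because the invertible \<open>omega W (X i)\<close>
        kills it.\<close>
      have "omega W (X i) \<cdot>\<^sub>D (f\<^sub>*\<^sub>a p \<cdot>\<^sub>D y) = Fa (fsharp W) p \<cdot>\<^sub>D (omega W P \<cdot>\<^sub>D y)"
        by (rule D.comp_push) (use omega_natural[of p] p cy in simp_all)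
      also have "\<dots> = omega W (X i) \<cdot>\<^sub>D Zer (DD W) (Dom (DD W) y) (f\<^sub>*\<^sub>o (X i))"
        unfolding y(3) using p by simp
      finally have "f\<^sub>*\<^sub>a p \<cdot>\<^sub>D y = Zer (DD W) (Dom (DD W) y) (f\<^sub>*\<^sub>o (X i))"
        by (rule D.isom_cancel_left[OF iso[OF i]]) (use p cy in simp_all)
      then have 0: "eps W (X i) \<cdot>\<^sub>C f\<^sup>*\<^sub>a (f\<^sub>*\<^sub>a p \<cdot>\<^sub>D y) = Zer (CC W) (f\<^sup>*\<^sub>o (Dom (DD W) y)) (X i)" by simp
      have "p \<cdot>\<^sub>C y' = eps W (X i) \<cdot>\<^sub>C (f\<^sup>*\<^sub>a (f\<^sub>*\<^sub>a p) \<cdot>\<^sub>C f\<^sup>*\<^sub>a y)"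
        unfolding y'_def by (rule C.comp_push) (use star.counit_natural[of p] p cy in simp_all)
      also have "\<dots> = Zer (CC W) (f\<^sup>*\<^sub>o (Dom (DD W) y)) (X i)"
        using 0 p cy by (simp add: shriek.R.F_comp)
      finally show "\<iota> i \<cdot>\<^sub>C (p \<cdot>\<^sub>C y') = Zer (CC W) (Dom (CC W) y') P" using i y' by simp
    qed simp_all
    then have "eps W P \<cdot>\<^sub>C f\<^sup>*\<^sub>a y = eps W P \<cdot>\<^sub>C f\<^sup>*\<^sub>a (Zer (DD W) (Dom (DD W) y) (f\<^sub>*\<^sub>o P))"
      using y'(1) by (simp add: y'_def)
    then have "y = Zer (DD W) (Dom (DD W) y) (f\<^sub>*\<^sub>o P)"
      by (rule star.counit_cancel[rotated 3]) (use cy in simp_all)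
    then show "y = Zer (DD W) (Dom (DD W) y) (Dom (DD W) (omega W P))" by simp
  next
    fix z assume z: "Dom (DD W) z \<in> H" "Cod (DD W) z = Cod (DD W) (omega W P)"
    then have cz: "Cod (DD W) z = Fo (fsharp W) P" by simp
    note FP = fsharp_coproduct[OF P]
    have fs: "finite_support (DD W) I (Fo (fsharp W) P) (\<lambda>i. Fa (fsharp W) (\<iota> i)) z"
      using H.generators_small_object[OF z(1)] I FP cz unfolding small_object_def by blast
    show "\<exists>w. Dom (DD W) w = Dom (DD W) z \<and> Cod (DD W) w = Dom (DD W) (omega W P) \<and> omega W P \<cdot>\<^sub>D w = z"
    proof (rule D.finite_support_induct[OF FP fs cz, where Q = "\<lambda>a. \<exists>w. Dom (DD W) w = Dom (DD W) z
        \<and> Cod (DD W) w = Dom (DD W) (omega W P) \<and> omega W P \<cdot>\<^sub>D w = a"])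
      show "\<exists>w. Dom (DD W) w = Dom (DD W) z \<and> Cod (DD W) w = Dom (DD W) (omega W P)
          \<and> omega W P \<cdot>\<^sub>D w = Zer (DD W) (Dom (DD W) z) (Fo (fsharp W) P)"
        by (intro exI[of _ "Zer (DD W) (Dom (DD W) z) (f\<^sub>*\<^sub>o P)"]) simp
    next
      fix a b
      assume "\<exists>w. Dom (DD W) w = Dom (DD W) z \<and> Cod (DD W) w = Dom (DD W) (omega W P) \<and> omega W P \<cdot>\<^sub>D w = a"
        and "\<exists>w. Dom (DD W) w = Dom (DD W) z \<and> Cod (DD W) w = Dom (DD W) (omega W P) \<and> omega W P \<cdot>\<^sub>D w = b"
      then obtain v w where "Dom (DD W) v = Dom (DD W) z" "Cod (DD W) v = f\<^sub>*\<^sub>o P" "omega W P \<cdot>\<^sub>D v = a"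
        "Dom (DD W) w = Dom (DD W) z" "Cod (DD W) w = f\<^sub>*\<^sub>o P" "omega W P \<cdot>\<^sub>D w = b" by auto
      then show "\<exists>w. Dom (DD W) w = Dom (DD W) z \<and> Cod (DD W) w = Dom (DD W) (omega W P)
          \<and> omega W P \<cdot>\<^sub>D w = a \<^bold>+\<^bsub>DD W\<^esub> b"
        by (intro exI[of _ "v \<^bold>+\<^bsub>DD W\<^esub> w"]) (simp add: D.comp_distrib_add)
    next
      fix i p assume i: "i \<in> I" and p: "Dom (DD W) p = Fo (fsharp W) P" "Cod (DD W) p = Fo (fsharp W) (X i)"
      define w where "w = invD (omega W (X i)) \<cdot>\<^sub>D (p \<cdot>\<^sub>D z)"
      have w: "Dom (DD W) w = Dom (DD W) z" "Cod (DD W) w = f\<^sub>*\<^sub>o (X i)" "omega W (X i) \<cdot>\<^sub>D w = p \<cdot>\<^sub>D z"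
        using iso[OF i] p cz by (simp_all add: w_def)
      have "omega W P \<cdot>\<^sub>D (f\<^sub>*\<^sub>a (\<iota> i) \<cdot>\<^sub>D w) = Fa (fsharp W) (\<iota> i) \<cdot>\<^sub>D (omega W (X i) \<cdot>\<^sub>D w)"
        by (rule D.comp_push) (use omega_natural[of "\<iota> i"] i w(2) in simp_all)
      then show "\<exists>w. Dom (DD W) w = Dom (DD W) z \<and> Cod (DD W) w = Dom (DD W) (omega W P)
          \<and> omega W P \<cdot>\<^sub>D w = Fa (fsharp W) (\<iota> i) \<cdot>\<^sub>D (p \<cdot>\<^sub>D z)"
        unfolding w(3) using w(1,2) i by (intro exI[of _ "f\<^sub>*\<^sub>a (\<iota> i) \<cdot>\<^sub>D w"]) simp
    qed
  qed
qed

text \<open>The class \<open>T\<close> inherits its closure properties from those of compactness and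
  of invertibility of \<open>omega\<close> separately. The identity of \<open>X\<close> factors
  through \<open>T\<close>, and naturality makes \<open>omega\<close> at \<open>X\<close> a retract
  of \<open>omega\<close> at the middle object.\<close>

lemma omega_isom_small_object:
  assumes G: "generated_triangulated_category (CC W) U G"
    and iso: "\<And>X. X \<in> G \<Longrightarrow> isom (DD W) (omega W X)" and X: "small_object U (CC W) X"
  shows "isom (DD W) (omega W X)"
proof -
  interpret G: generated_triangulated_category "CC W" U G by fact
  define T where "T X \<longleftrightarrow> small_object U (CC W) X \<and> isom (DD W) (omega W X)" for X
  have "G.factors_through T (idC X)"
  proof (rule G.small_object_factors)
    show "T X" if "X \<in> G" for X using that iso G.generators_small_object by (simp add: T_def)
    show "T Z" if Z: "idC Z = Zer (CC W) Z Z" for Z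
    proof -
      \<comment> \<open>Arrows out of a zero object vanish, so the empty set supports them and the
        zero object is compact.\<close>
      have "x = Zer (CC W) Z (Cod (CC W) x)" if "Dom (CC W) x = Z" for x
        using that Z by (metis C.comp_zero C.ident_right)
      then have "supports (CC W) {} P \<iota> x" if "Dom (CC W) x = Z" "Cod (CC W) x = P" for P \<iota> x
        using that C.comp_zero unfolding supports_def by metis
      then have "small_object U (CC W) Z" unfolding small_object_def finite_support_def by blast
      then show ?thesis using omega_isom_zero[OF Z] by (simp add: T_def)
    qed
    show "small_object U (CC W) X" if "T X" for X using that by (simp add: T_def)
    show "T (Cod (CC W) g)" if "(f, g, h) \<in> Tri (CC W)" "T (Dom (CC W) f)" "T (Cod (CC W) f)" for f g h
      using that omega_isom_cone C.small_object_cone[OF _ _ _ G.coproducts] by (simp add: T_def)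
    show "T (Cod (CC W) f)" if "isom (CC W) f" "T (Dom (CC W) f)" for f
      using that omega_isom_isom C.small_object_isom[of U, OF _ that(1) refl refl] by (simp add: T_def)
    show "T (So (CC W) X)" if "T X" for X
      using that C.small_object_sus[OF _ G.coproducts] by (simp add: T_def omega_sus_isom_iff)
    show "T X" if "T (So (CC W) X)" for X
      using that C.small_object_desus[of U X] by (simp add: T_def omega_sus_isom_iff)
    show "T (Dom (CC W) p)"
      if T: "T X" "T Y" and d: "Dom (CC W) i = X" "Dom (CC W) j = Y" "Cod (CC W) i = Dom (CC W) p"
        "Cod (CC W) j = Dom (CC W) p" "Dom (CC W) q = Dom (CC W) p" "Cod (CC W) p = X" "Cod (CC W) q = Y"
        and eq: "i \<cdot>\<^sub>C p \<^bold>+\<^bsub>CC W\<^esub> j \<cdot>\<^sub>C q = idC (Dom (CC W) p)" for X Y i j p q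
    proof -
      have "isom (DD W) (omega W (Dom (CC W) p))"
        by (rule omega_isom_biproduct[OF _ _ _ _ _ eq]) (use T d in \<open>simp_all add: T_def\<close>)
      moreover have "small_object U (CC W) (Dom (CC W) p)"
        by (rule C.small_object_biproduct[OF d(3-5) _ _ eq]) (use T d in \<open>simp_all add: T_def\<close>)
      ultimately show ?thesis by (simp add: T_def)
    qed
    show "small_object U (CC W) (Dom (CC W) (idC X))" using X by simp
  qed
  then obtain a b where ab: "Dom (CC W) a = X" "Cod (CC W) a = Dom (CC W) b" "Cod (CC W) b = X"
      "T (Dom (CC W) b)" "b \<cdot>\<^sub>C a = idC X"
    by (auto elim: G.factors_throughE)
  define F where "F = Dom (CC W) b"
  have iF: "isom (DD W) (omega W F)" using ab(4) by (simp add: T_def F_def)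
  have d [simp]: "Dom (CC W) a = X" "Cod (CC W) a = F" "Dom (CC W) b = F" "Cod (CC W) b = X"
    using ab by (simp_all add: F_def)
  show ?thesis
  proof (rule D.isom_retract[OF iF, of "f\<^sub>*\<^sub>a a" _ "f\<^sub>*\<^sub>a b" "Fa (fsharp W) a" "Fa (fsharp W) b"])
    show "f\<^sub>*\<^sub>a b \<cdot>\<^sub>D f\<^sub>*\<^sub>a a = idD (Dom (DD W) (omega W X))"
      using ab(5) star.R.F_comp[of a b] by simp
    show "Fa (fsharp W) b \<cdot>\<^sub>D Fa (fsharp W) a = idD (Cod (DD W) (omega W X))"
      using ab(5) sharp.F_comp[of a b] by simp
    show "Fa (fsharp W) a \<cdot>\<^sub>D omega W X = omega W F \<cdot>\<^sub>D f\<^sub>*\<^sub>a a" using omega_natural[of a] by simp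
    show "omega W X \<cdot>\<^sub>D f\<^sub>*\<^sub>a b = Fa (fsharp W) b \<cdot>\<^sub>D omega W F" using omega_natural[of b] by simp
  qed simp_all
qed

end

theorem theorem6p1:
  fixes W :: "('c, 'k, 'd, 'l) adjoint_data"
    and U :: "'u set"
    and G :: "'c set"
  assumes "smallness_bound U"
    and "adjoint_context W"
    and "compactly_generated U (CC W) G"
    and "\<forall>Y. \<forall>X\<in>G. isom (DD W) (pibar W Y X)"
  shows "(\<forall>Y X. isom (DD W) (pibar W Y X))
    \<and> (\<forall>X. omega W X \<in> Mor (DD W) (Fo (low_star W) X)
                              (Fo (low_shriek W) (X \<otimes>\<^sub>o\<^bsub>CC W\<^esub> CObj W)))
    \<and> ((\<forall>X\<in>G. isom (DD W) (omega W X)) \<longrightarrow>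
        ((\<forall>X\<in>G. dualizable (CC W) X)
           \<longrightarrow> (\<forall>X. dualizable (CC W) X \<longrightarrow> isom (DD W) (omega W X)))
      \<and> (\<forall>H. compactly_generated U (DD W) H
             \<and> (\<forall>Y\<in>H. compact_object U (CC W) (Fo (up_star W) Y))
           \<longrightarrow> (\<forall>X. isom (DD W) (omega W X))))"
proof -
  interpret adjoint_context W by fact
  have G: "generated_triangulated_category (CC W) U G"
    by (rule C.generated_triangulated_category[OF assms(1,3)])
  have pibar: "isom (DD W) (pibar W Y X)" for Y X
    by (rule pibar_isom_of_generators[OF G]) (use assms(4) in blast)
  interpret pibar_context W by unfold_locales (rule pibar)
  interpret G: generated_triangulated_category "CC W" U G by (rule G)
  have "omega W X \<in> Mor (DD W) (Fo (low_star W) X) (Fo (low_shriek W) (X \<otimes>\<^sub>o\<^bsub>CC W\<^esub> CObj W))" for X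
    by (simp add: D.Mor_iff fsharp_simps)
  moreover have "isom (DD W) (omega W X)"
    if "\<forall>X\<in>G. isom (DD W) (omega W X)" "dualizable (CC W) X" for X
    \<comment> \<open>Compactness of the unit object enters here, making dualizable objects
      compact.\<close>
    by (rule omega_isom_small_object[OF G _ C.dualizable_small_object[OF C.unit_small_object[OF assms(3)] that(2)]])
      (use that(1) in blast)
  moreover have "isom (DD W) (omega W X)"
    if iso: "\<forall>X\<in>G. isom (DD W) (omega W X)" and H: "compactly_generated U (DD W) H"
      and up: "\<forall>Y\<in>H. compact_object U (CC W) (Fo (up_star W) Y)" for H X
  proof (rule G.generators_generate[of "\<lambda>X. isom (DD W) (omega W X)"])
    show "isom (DD W) (omega W X)" if "X \<in> G" for X using iso that by blast
    show "coproduct_closed U (CC W) (\<lambda>X. isom (DD W) (omega W X))"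
      unfolding coproduct_closed_def
      using omega_isom_coproduct[OF D.generated_triangulated_category[OF assms(1) H]] up
        C.compact_object_small_object by blast
  qed (use omega_isom_cone omega_isom_isom in blast)+
  ultimately show ?thesis using pibar by blast
qed

end
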